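(* Let $F$ be a field of characteristic zero and $t\in F$. Deligne's category $\underline{\mathrm{Rep}}(S_t;F)$ is semisimple if and only if $t$ is not a nonnegative integer.
   Context: The category. For $n,m\ge 0$ let $P_{n,m}$ be the set of all set partitions of $\{1,\ldots,n,1',\ldots,m'\}$ ($P_{0,0}$ consists of the empty partition), and $FP_{n,m}$ the $F$-vector space with basis $P_{n,m}$. For $\pi\in P_{n,m}$, $\mu\in P_{m,l}$, let $\mu\star\pi$ be the partition of $\{1,\ldots,n,1'',\ldots,m'',1',\ldots,l'\}$ obtained by identifying the vertex $j'$ of $\pi$ with the vertex $j$ of $\mu$, renamed $j''$, and taking connected components of the glued graph; $\ell(\mu,\pi)$ is the number of parts of $\mu\star\pi$ consisting only of doubly primed elements, and $\mu\cdot\pi\in P_{n,l}$ is the restriction of $\mu\star\pi$ to $\{1,\ldots,n,1',\ldots,l'\}$. The category $\underline{\mathrm{Rep}}_0(S_t;F)$ has objects $[n]$ ($n\ge 0$), $\mathrm{Hom}([n],[m])=FP_{n,m}$, and bilinear composition with $\mu\circ\pi=t^{\ell(\mu,\pi)}\,\mu\cdot\pi$. $\underline{\mathrm{Rep}}(S_t;F)$ is the Karoubian (idempotent) completion of the additive envelope of $\underline{\mathrm{Rep}}_0(S_t;F)$. Semisimple means: the category is abelian and every object is a finite direct sum of simple objects; for this category this amounts to the Hom space between any two non-isomorphic indecomposable objects being zero and the endomorphism ring of each indecomposable object being a division algebra. *)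

theory Defs
  imports Complex_Main "HOL-Library.Disjoint_Sets" "HOL-Library.Poly_Mapping"
    "HOL-Library.Function_Algebras"
begin

section \<open>Preadditive categories\<close>

text \<open>
  Composition takes the three objects involved as arguments, so hom sets need not be disjoint:
  \<open>Comp C X Y Z g f\<close> is the composite of \<open>f \<in> Hom C X Y\<close> and \<open>g \<in> Hom C Y Z\<close>.
  All hom groups of a preadditive category are subgroups of one ambient abelian group, the type of
  morphisms; the zero morphism of every hom group is therefore written \<open>0\<close>.
\<close>

record ('o, 'm) cat_data =
  Ob :: "'o set"
  Hom :: "'o \<Rightarrow> 'o \<Rightarrow> 'm set"
  Comp :: "'o \<Rightarrow> 'o \<Rightarrow> 'o \<Rightarrow> 'm \<Rightarrow> 'm \<Rightarrow> 'm"
  Ident :: "'o \<Rightarrow> 'm"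

locale preadditive_category =
  fixes C :: "('o, 'm::ab_group_add) cat_data"
  assumes Ident_in_Hom: "X \<in> Ob C \<Longrightarrow> Ident C X \<in> Hom C X X"
    and Comp_in_Hom:
      "\<lbrakk>X \<in> Ob C; Y \<in> Ob C; Z \<in> Ob C; f \<in> Hom C X Y; g \<in> Hom C Y Z\<rbrakk>
        \<Longrightarrow> Comp C X Y Z g f \<in> Hom C X Z"
    and Comp_assoc:
      "\<lbrakk>W \<in> Ob C; X \<in> Ob C; Y \<in> Ob C; Z \<in> Ob C;
        f \<in> Hom C W X; g \<in> Hom C X Y; h \<in> Hom C Y Z\<rbrakk>
        \<Longrightarrow> Comp C W Y Z h (Comp C W X Y g f) = Comp C W X Z (Comp C X Y Z h g) f"
    and Comp_Ident_left:
      "\<lbrakk>X \<in> Ob C; Y \<in> Ob C; f \<in> Hom C X Y\<rbrakk> \<Longrightarrow> Comp C X Y Y (Ident C Y) f = f"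
    and Comp_Ident_right:
      "\<lbrakk>X \<in> Ob C; Y \<in> Ob C; f \<in> Hom C X Y\<rbrakk> \<Longrightarrow> Comp C X X Y f (Ident C X) = f"
    and zero_in_Hom: "\<lbrakk>X \<in> Ob C; Y \<in> Ob C\<rbrakk> \<Longrightarrow> 0 \<in> Hom C X Y"
    and add_in_Hom:
      "\<lbrakk>X \<in> Ob C; Y \<in> Ob C; f \<in> Hom C X Y; g \<in> Hom C X Y\<rbrakk> \<Longrightarrow> f + g \<in> Hom C X Y"
    and uminus_in_Hom:
      "\<lbrakk>X \<in> Ob C; Y \<in> Ob C; f \<in> Hom C X Y\<rbrakk> \<Longrightarrow> - f \<in> Hom C X Y"
    and Comp_add_left:
      "\<lbrakk>X \<in> Ob C; Y \<in> Ob C; Z \<in> Ob C; f \<in> Hom C X Y; g \<in> Hom C Y Z; g' \<in> Hom C Y Z\<rbrakk>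
        \<Longrightarrow> Comp C X Y Z (g + g') f = Comp C X Y Z g f + Comp C X Y Z g' f"
    and Comp_add_right:
      "\<lbrakk>X \<in> Ob C; Y \<in> Ob C; Z \<in> Ob C; f \<in> Hom C X Y; f' \<in> Hom C X Y; g \<in> Hom C Y Z\<rbrakk>
        \<Longrightarrow> Comp C X Y Z g (f + f') = Comp C X Y Z g f + Comp C X Y Z g f'"

definition is_zero_object :: "('o, 'm) cat_data \<Rightarrow> 'o \<Rightarrow> bool" where
  "is_zero_object C Z \<longleftrightarrow> Z \<in> Ob C \<and>
     (\<forall>X\<in>Ob C. (\<exists>!f. f \<in> Hom C Z X) \<and> (\<exists>!f. f \<in> Hom C X Z))"

definition is_mono :: "('o, 'm) cat_data \<Rightarrow> 'o \<Rightarrow> 'o \<Rightarrow> 'm \<Rightarrow> bool" where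
  "is_mono C X Y f \<longleftrightarrow> f \<in> Hom C X Y \<and>
     (\<forall>W\<in>Ob C. \<forall>g\<in>Hom C W X. \<forall>h\<in>Hom C W X.
        Comp C W X Y f g = Comp C W X Y f h \<longrightarrow> g = h)"

definition is_epi :: "('o, 'm) cat_data \<Rightarrow> 'o \<Rightarrow> 'o \<Rightarrow> 'm \<Rightarrow> bool" where
  "is_epi C X Y f \<longleftrightarrow> f \<in> Hom C X Y \<and>
     (\<forall>Z\<in>Ob C. \<forall>g\<in>Hom C Y Z. \<forall>h\<in>Hom C Y Z.
        Comp C X Y Z g f = Comp C X Y Z h f \<longrightarrow> g = h)"

definition is_iso :: "('o, 'm) cat_data \<Rightarrow> 'o \<Rightarrow> 'o \<Rightarrow> 'm \<Rightarrow> bool" where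
  "is_iso C X Y f \<longleftrightarrow> f \<in> Hom C X Y \<and>
     (\<exists>g\<in>Hom C Y X. Comp C X Y X g f = Ident C X \<and> Comp C Y X Y f g = Ident C Y)"

text \<open>\<open>is_kernel C K X Y k f\<close>: the morphism \<open>k : K \<rightarrow> X\<close> is a kernel of \<open>f : X \<rightarrow> Y\<close>.\<close>

definition is_kernel ::
    "('o, 'm::zero) cat_data \<Rightarrow> 'o \<Rightarrow> 'o \<Rightarrow> 'o \<Rightarrow> 'm \<Rightarrow> 'm \<Rightarrow> bool" where
  "is_kernel C K X Y k f \<longleftrightarrow> k \<in> Hom C K X \<and> f \<in> Hom C X Y \<and> Comp C K X Y f k = 0 \<and>
     (\<forall>W\<in>Ob C. \<forall>g\<in>Hom C W X. Comp C W X Y f g = 0 \<longrightarrow>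
        (\<exists>!u. u \<in> Hom C W K \<and> Comp C W K X k u = g))"

text \<open>\<open>is_cokernel C X Y Q f q\<close>: the morphism \<open>q : Y \<rightarrow> Q\<close> is a cokernel of \<open>f : X \<rightarrow> Y\<close>.\<close>

definition is_cokernel ::
    "('o, 'm::zero) cat_data \<Rightarrow> 'o \<Rightarrow> 'o \<Rightarrow> 'o \<Rightarrow> 'm \<Rightarrow> 'm \<Rightarrow> bool" where
  "is_cokernel C X Y Q f q \<longleftrightarrow> f \<in> Hom C X Y \<and> q \<in> Hom C Y Q \<and> Comp C X Y Q q f = 0 \<and>
     (\<forall>Z\<in>Ob C. \<forall>g\<in>Hom C Y Z. Comp C X Y Z g f = 0 \<longrightarrow>
        (\<exists>!u. u \<in> Hom C Q Z \<and> Comp C Y Q Z u q = g))"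

text \<open>
  Direct sums are biproducts, with injections \<open>a k\<close> and projections \<open>b k\<close>.  The empty list is
  allowed; its direct sums are the zero objects.
\<close>

definition is_direct_sum :: "('o, 'm::ab_group_add) cat_data \<Rightarrow> 'o list \<Rightarrow> 'o \<Rightarrow> bool" where
  "is_direct_sum C Xs S \<longleftrightarrow> set Xs \<subseteq> Ob C \<and> S \<in> Ob C \<and>
     (\<exists>a b. (\<forall>k<length Xs. a k \<in> Hom C (Xs ! k) S \<and> b k \<in> Hom C S (Xs ! k)) \<and>
        (\<forall>k<length Xs. \<forall>l<length Xs.
           Comp C (Xs ! k) S (Xs ! l) (b l) (a k) = (if k = l then Ident C (Xs ! k) else 0)) \<and>
        (\<Sum>k<length Xs. Comp C S (Xs ! k) S (a k) (b k)) = Ident C S)"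

locale abelian_category = preadditive_category +
  assumes has_zero_object: "\<exists>Z. is_zero_object C Z"
    and has_binary_direct_sums: "\<lbrakk>X \<in> Ob C; Y \<in> Ob C\<rbrakk> \<Longrightarrow> \<exists>S. is_direct_sum C [X, Y] S"
    and has_kernels:
      "\<lbrakk>X \<in> Ob C; Y \<in> Ob C; f \<in> Hom C X Y\<rbrakk> \<Longrightarrow> \<exists>K\<in>Ob C. \<exists>k. is_kernel C K X Y k f"
    and has_cokernels:
      "\<lbrakk>X \<in> Ob C; Y \<in> Ob C; f \<in> Hom C X Y\<rbrakk> \<Longrightarrow> \<exists>Q\<in>Ob C. \<exists>q. is_cokernel C X Y Q f q"
    and monos_are_kernels:
      "\<lbrakk>X \<in> Ob C; Y \<in> Ob C; is_mono C X Y f\<rbrakk> \<Longrightarrow> \<exists>Z\<in>Ob C. \<exists>g. is_kernel C X Y Z f g"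
    and epis_are_cokernels:
      "\<lbrakk>X \<in> Ob C; Y \<in> Ob C; is_epi C X Y f\<rbrakk> \<Longrightarrow> \<exists>W\<in>Ob C. \<exists>g. is_cokernel C W X Y g f"

definition is_simple :: "('o, 'm) cat_data \<Rightarrow> 'o \<Rightarrow> bool" where
  "is_simple C X \<longleftrightarrow> X \<in> Ob C \<and> \<not> is_zero_object C X \<and>
     (\<forall>A\<in>Ob C. \<forall>i. is_mono C A X i \<longrightarrow> is_zero_object C A \<or> is_iso C A X i)"

definition semisimple_category :: "('o, 'm::ab_group_add) cat_data \<Rightarrow> bool" where
  "semisimple_category C \<longleftrightarrow> abelian_category C \<and>
     (\<forall>X\<in>Ob C. \<exists>Ss. (\<forall>S\<in>set Ss. is_simple C S) \<and> is_direct_sum C Ss X)"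


section \<open>Additive envelope and idempotent completion\<close>

text \<open>
  Objects of the additive envelope are formal finite direct sums, i.e. lists of objects.  A morphism
  is a matrix whose entry in row \<open>i\<close> and column \<open>j\<close> is a morphism from the \<open>j\<close>-th summand of the
  source to the \<open>i\<close>-th summand of the target; entries outside the range of indices are \<open>0\<close>.
\<close>

definition additive_envelope ::
    "('o, 'm::ab_group_add) cat_data \<Rightarrow> ('o list, nat \<Rightarrow> nat \<Rightarrow> 'm) cat_data" where
  "additive_envelope C =
    \<lparr>Ob = lists (Ob C),
     Hom = (\<lambda>Xs Ys. {f. \<forall>i j. if i < length Ys \<and> j < length Xs
                              then f i j \<in> Hom C (Xs ! j) (Ys ! i) else f i j = 0}),
     Comp = (\<lambda>Xs Ys Zs g f i k.
               if i < length Zs \<and> k < length Xs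
               then \<Sum>j<length Ys. Comp C (Xs ! k) (Ys ! j) (Zs ! i) (g i j) (f j k) else 0),
     Ident = (\<lambda>Xs i j. if i < length Xs \<and> i = j then Ident C (Xs ! i) else 0)\<rparr>"

definition karoubi_envelope :: "('o, 'm) cat_data \<Rightarrow> ('o \<times> 'm, 'm) cat_data" where
  "karoubi_envelope C =
    \<lparr>Ob = {(X, e). X \<in> Ob C \<and> e \<in> Hom C X X \<and> Comp C X X X e e = e},
     Hom = (\<lambda>(X, e) (Y, e'). {f \<in> Hom C X Y. Comp C X X Y (Comp C X Y Y e' f) e = f}),
     Comp = (\<lambda>(X, _) (Y, _) (Z, _). Comp C X Y Z),
     Ident = (\<lambda>(X, e). e)\<rparr>"


section \<open>Deligne's category\<close>

text \<open>The vertex \<open>i\<close> is \<open>Inl i\<close> and the primed vertex \<open>j'\<close> is \<open>Inr j\<close>.\<close>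

type_synonym vertex_partition = "(nat + nat) set set"

definition partitions :: "nat \<Rightarrow> nat \<Rightarrow> vertex_partition set" where
  "partitions n m = {\<pi>. partition_on ({1..n} <+> {1..m}) \<pi>}"

text \<open>Vertices of the glued graph: unprimed, doubly primed and primed.\<close>

datatype glued_vertex = Source nat | Middle nat | Target nat

definition glued_blocks :: "vertex_partition \<Rightarrow> vertex_partition \<Rightarrow> glued_vertex set set" where
  "glued_blocks \<mu> \<pi> =
     (\<lambda>B. case_sum Source Middle ` B) ` \<pi> \<union> (\<lambda>B. case_sum Middle Target ` B) ` \<mu>"

definition glued_adjacency ::
    "vertex_partition \<Rightarrow> vertex_partition \<Rightarrow> (glued_vertex \<times> glued_vertex) set" where
  "glued_adjacency \<mu> \<pi> = {(x, y). \<exists>B\<in>glued_blocks \<mu> \<pi>. x \<in> B \<and> y \<in> B}"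

definition glued_partition ::
    "vertex_partition \<Rightarrow> vertex_partition \<Rightarrow> glued_vertex set set"  (infixl "\<star>" 70) where
  "\<mu> \<star> \<pi> = \<Union> (glued_blocks \<mu> \<pi>) // (glued_adjacency \<mu> \<pi>)\<^sup>*"

definition middle_parts :: "vertex_partition \<Rightarrow> vertex_partition \<Rightarrow> nat" where
  "middle_parts \<mu> \<pi> = card {B \<in> \<mu> \<star> \<pi>. B \<subseteq> range Middle}"

definition partition_product ::
    "vertex_partition \<Rightarrow> vertex_partition \<Rightarrow> vertex_partition"  (infixl "\<cdot>" 70) where
  "\<mu> \<cdot> \<pi> = (\<lambda>B. case_sum Source Target -` B) ` (\<mu> \<star> \<pi>) - {{}}"

text \<open>
  The vector space with basis \<open>P\<close> is the space of formal linear combinations supported on \<open>P\<close>.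
  The identity of \<open>n\<close> is the partition with parts \<open>{i, i'}\<close>.
\<close>

definition Rep0 :: "'a::field \<Rightarrow> (nat, vertex_partition \<Rightarrow>\<^sub>0 'a) cat_data" where
  "Rep0 t =
    \<lparr>Ob = UNIV,
     Hom = (\<lambda>n m. {f. Poly_Mapping.keys f \<subseteq> partitions n m}),
     Comp = (\<lambda>n m l g f.
       \<Sum>\<pi>\<in>partitions n m. \<Sum>\<mu>\<in>partitions m l.
         Poly_Mapping.single (\<mu> \<cdot> \<pi>)
           (t ^ middle_parts \<mu> \<pi> * Poly_Mapping.lookup g \<mu> * Poly_Mapping.lookup f \<pi>)),
     Ident = (\<lambda>n. Poly_Mapping.single ((\<lambda>i. {Inl i, Inr i}) ` {1..n}) 1)\<rparr>"

definition Deligne_Rep ::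
    "'a::field \<Rightarrow> (nat list \<times> (nat \<Rightarrow> nat \<Rightarrow> vertex_partition \<Rightarrow>\<^sub>0 'a),
                   nat \<Rightarrow> nat \<Rightarrow> vertex_partition \<Rightarrow>\<^sub>0 'a) cat_data" where
  "Deligne_Rep t = karoubi_envelope (additive_envelope (Rep0 t))"

end

theory Submission
  imports Defs "HOL-Combinatorics.Permutations" "HOL-Computational_Algebra.Polynomial"
begin

text \<open>
  The Karoubi envelope of an additive category is semisimple as soon as every morphism \<open>f\<close> has a
  quasi-inverse \<open>g\<close>, i.e. \<open>f g f = f\<close>, and hom spaces are finite-dimensional.  This holds when no
  nonzero morphism \<open>f\<close> of the original category is such that all idempotents of the form \<open>f g\<close> vanish.

  For \<open>t\<close> not a natural number, the latter is shown for the endomorphisms of \<open>[n]\<close> by induction on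
  \<open>n\<close>.  The Gram matrix of the trace form is \<open>\<Sum>\<^sub>\<rho> [\<pi> \<le> \<rho>] [\<mu> \<le> \<rho>] t (t - 1) \<dots> (t - |\<rho>| + 1)\<close>,
  hence nondegenerate, so by induction such an \<open>f\<close> is annihilated by the ideal of morphisms factoring
  through some \<open>[k]\<close> with \<open>k < n\<close>.  The partitions outside that ideal are the permutations, and
  Maschke's averaging argument gives an idempotent \<open>e\<close> in the left ideal of \<open>f\<close> with \<open>f = f e\<close>.

  For \<open>t = N\<close>, there is a nonzero morphism \<open>[0] \<rightarrow> [N + 1]\<close> killed by all morphisms \<open>[N + 1] \<rightarrow> [0]\<close>,
  which Schur's lemma forbids in a semisimple category.
\<close>

section \<open>Linear categories\<close>

text \<open>The absence of nonzero idempotents passes to composites on either side and therefore to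
  matrices, entry by entry. Quasi-inverses are produced only afterwards, and the Karoubi envelope
  inherits them by cutting with idempotents. In the induction on \<open>n\<close>, endomorphisms
  suffice because the nondegenerate trace recovers a morphism between different objects from its
  composites back to one of them. The delicate point is the ideal \<open>J\<close> of endomorphisms
  factoring through smaller objects: it is not known to have a unit, so the group algebra of the
  symmetric group cannot simply be split off. What is averaged is therefore a linear projection onto
  the left ideal \<open>L\<close> of \<open>f\<close> that vanishes on \<open>J\<close>. It exists
  because \<open>L\<close> meets \<open>J\<close> in 0, and averaging over permutations alone is
  enough because \<open>J\<close> annihilates \<open>L\<close>. The falling factorial in the Gram
  matrix counts injective colourings of the parts of \<rho> by \<open>N\<close> colours; the
  resulting identity is polynomial in \<open>N\<close> and so holds for every
  \<open>t\<close>.\<close>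

lemma (in vector_space) dim_less_if_kernel:
  assumes "finite T" "V \<subseteq> span T"
    and "Vector_Spaces.linear scale scale \<psi>" "inj_on \<psi> (span U)" "\<psi> ` U \<subseteq> V"
    and "Vector_Spaces.linear scale scale \<phi>" "\<And>u. u \<in> U \<Longrightarrow> \<phi> (\<psi> u) = 0"
    and "w \<in> V" "\<phi> w \<noteq> 0"
  shows "dim U < dim V"
proof -
  interpret \<psi>: Vector_Spaces.linear scale scale \<psi> by fact
  interpret \<phi>: Vector_Spaces.linear scale scale \<phi> by fact
  obtain B where B: "B \<subseteq> U" "independent B" "U \<subseteq> span B" "card B = dim U"
    by (rule basis_exists)
  obtain B' where B': "B' \<subseteq> V" "independent B'" "V \<subseteq> span B'" "card B' = dim V"
    by (rule basis_exists)
  \<comment> \<open>A basis of \<open>U\<close> is carried to independent vectors of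
    \<open>V\<close> killed by \<open>\<phi>\<close>, and \<open>w\<close> lies outside their span
    because \<open>\<phi> w\<close> is nonzero. The finite set \<open>T\<close> matters since
    \<open>dim\<close> of an infinite-dimensional space is 0.\<close>
  have inj: "inj_on \<psi> (span B)"
    by (rule inj_on_subset[OF assms(4) span_mono[OF B(1)]])
  then have "independent (\<psi> ` B)"
    using \<psi>.independent_inj_on_image[OF B(2)] by simp
  moreover have "\<phi> x = 0" if "x \<in> span (\<psi> ` B)" for x
    by (rule \<phi>.eq_0_on_span[OF _ that]) (use assms(7) B(1) in auto)
  then have "w \<notin> span (\<psi> ` B)"
    using assms(9) by blast
  ultimately have ind: "independent (insert w (\<psi> ` B))" "w \<notin> \<psi> ` B"
    by (auto simp: independent_insert span_base)
  have "finite B'"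
    using independent_span_bound[OF assms(1) B'(2)] B'(1) assms(2) by blast
  then have "finite (insert w (\<psi> ` B)) \<and> card (insert w (\<psi> ` B)) \<le> card B'"
    using ind(1) B(1) B'(3) assms(5,8) by (intro independent_span_bound) blast+
  then have "card (\<psi> ` B) < dim V"
    using ind(2) B'(4) by auto
  moreover have "card (\<psi> ` B) = card B"
    using inj span_superset[of B] by (meson card_image inj_on_subset)
  ultimately show ?thesis
    using B(4) by simp
qed

section \<open>Idempotents, the radical and von Neumann regularity\<close>

context preadditive_category
begin

lemma diff_in_Hom:
  "\<lbrakk>X \<in> Ob C; Y \<in> Ob C; f \<in> Hom C X Y; g \<in> Hom C X Y\<rbrakk> \<Longrightarrow> f - g \<in> Hom C X Y"
  using add_in_Hom[of X Y f "- g"] uminus_in_Hom[of X Y g] by simp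

lemma sum_in_Hom:
  "\<lbrakk>X \<in> Ob C; Y \<in> Ob C; \<And>k. k \<in> K \<Longrightarrow> f k \<in> Hom C X Y\<rbrakk> \<Longrightarrow> sum f K \<in> Hom C X Y"
  by (induction K rule: infinite_finite_induct) (auto intro: zero_in_Hom add_in_Hom)

end

text \<open>The composites \<open>f g\<close> form a right ideal of the endomorphisms of
  \<open>Y\<close>; in a finite-dimensional algebra a right ideal without nonzero idempotents
  consists of nilpotent elements. The condition thus stands in for membership in the
  radical.\<close>

definition idempotent_free :: "('o, 'm::zero) cat_data \<Rightarrow> 'o \<Rightarrow> 'o \<Rightarrow> 'm \<Rightarrow> bool" where
  "idempotent_free C X Y f \<longleftrightarrow> f \<in> Hom C X Y \<and>
     (\<forall>g\<in>Hom C Y X. Comp C Y Y Y (Comp C Y X Y f g) (Comp C Y X Y f g) = Comp C Y X Y f g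
        \<longrightarrow> Comp C Y X Y f g = 0)"

text \<open>
  For finite-dimensional endomorphism algebras this says that the Jacobson radical of the category
  has no nonzero morphism from \<open>X\<close> to \<open>Y\<close>.
\<close>

definition radical_free :: "('o, 'm::zero) cat_data \<Rightarrow> 'o \<Rightarrow> 'o \<Rightarrow> bool" where
  "radical_free C X Y \<longleftrightarrow> (\<forall>f. idempotent_free C X Y f \<longrightarrow> f = 0)"

definition is_regular :: "('o, 'm) cat_data \<Rightarrow> 'o \<Rightarrow> 'o \<Rightarrow> 'm \<Rightarrow> bool" where
  "is_regular C X Y f \<longleftrightarrow>
     (\<exists>g\<in>Hom C Y X. Comp C X Y Y (Comp C Y X Y f g) f = f)"

definition splits :: "('o, 'm) cat_data \<Rightarrow> 'o \<Rightarrow> 'm \<Rightarrow> bool" where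
  "splits C X p \<longleftrightarrow> (\<exists>K\<in>Ob C. \<exists>i\<in>Hom C K X. \<exists>r\<in>Hom C X K.
     Comp C K X K r i = Ident C K \<and> Comp C X K X i r = p)"

text \<open>
  Composition is required to be associative and bilinear for arbitrary arguments, not only for
  composable morphisms, so that rewriting with these laws needs no membership side conditions.
\<close>

locale linear_category = preadditive_category C + vector_space scale
  for C :: "('o, 'm::ab_group_add) cat_data" and scale :: "'a::field \<Rightarrow> 'm \<Rightarrow> 'm" +
  assumes assoc: "Comp C V Y Z h (Comp C V X Y g f) = Comp C V X Z (Comp C X Y Z h g) f"
    and scale_in_Hom:
      "\<lbrakk>X \<in> Ob C; Y \<in> Ob C; f \<in> Hom C X Y\<rbrakk> \<Longrightarrow> scale c f \<in> Hom C X Y"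
    and linear_Comp_left: "Vector_Spaces.linear scale scale (\<lambda>g. Comp C X Y Z g f)"
    and linear_Comp_right: "Vector_Spaces.linear scale scale (Comp C X Y Z g)"
    and Hom_finite_dim:
      "\<lbrakk>X \<in> Ob C; Y \<in> Ob C\<rbrakk> \<Longrightarrow> \<exists>T. finite T \<and> Hom C X Y \<subseteq> span T"
begin

sublocale vsp: vector_space_pair scale scale
  by unfold_locales

lemma Comp_simps:
  "Comp C X Y Z (g + g') f = Comp C X Y Z g f + Comp C X Y Z g' f"
  "Comp C X Y Z g (f + f') = Comp C X Y Z g f + Comp C X Y Z g f'"
  "Comp C X Y Z (g - g') f = Comp C X Y Z g f - Comp C X Y Z g' f"
  "Comp C X Y Z g (f - f') = Comp C X Y Z g f - Comp C X Y Z g f'"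
  "Comp C X Y Z 0 f = 0"
  "Comp C X Y Z g 0 = 0"
  "Comp C X Y Z (scale c g) f = scale c (Comp C X Y Z g f)"
  "Comp C X Y Z g (scale c f) = scale c (Comp C X Y Z g f)"
  by (simp_all add: vsp.linear_add[OF linear_Comp_left] vsp.linear_add[OF linear_Comp_right]
      vsp.linear_diff[OF linear_Comp_left] vsp.linear_diff[OF linear_Comp_right]
      vsp.linear_0[OF linear_Comp_left] vsp.linear_0[OF linear_Comp_right]
      vsp.linear_scale[OF linear_Comp_left] vsp.linear_scale[OF linear_Comp_right])

lemma Comp_sum_left: "Comp C X Y Z (\<Sum>k\<in>K. g k) f = (\<Sum>k\<in>K. Comp C X Y Z (g k) f)"
  by (rule vsp.linear_sum[OF linear_Comp_left])

lemma Comp_sum_right: "Comp C X Y Z g (\<Sum>k\<in>K. f k) = (\<Sum>k\<in>K. Comp C X Y Z g (f k))"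
  by (rule vsp.linear_sum[OF linear_Comp_right])

lemmas Hom_intros = Comp_in_Hom Ident_in_Hom zero_in_Hom add_in_Hom uminus_in_Hom diff_in_Hom
  scale_in_Hom sum_in_Hom

lemma subspace_Hom: "\<lbrakk>X \<in> Ob C; Y \<in> Ob C\<rbrakk> \<Longrightarrow> subspace (Hom C X Y)"
  by (auto simp: subspace_def intro: Hom_intros)

text \<open>Since \<open>(f u) g = f (u g)\<close>, the right ideal of \<open>f u\<close> lies
  inside that of \<open>f\<close>.\<close>

lemma idempotent_free_Comp_right:
  assumes "X \<in> Ob C" "Y \<in> Ob C" "Z \<in> Ob C" "idempotent_free C Y Z f" "u \<in> Hom C X Y"
  shows "idempotent_free C X Z (Comp C X Y Z f u)"
  using assms unfolding idempotent_free_def by (simp add: assoc[symmetric] Comp_in_Hom)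

lemma idempotent_free_Comp_left:
  assumes ob: "X \<in> Ob C" "Y \<in> Ob C" "Z \<in> Ob C"
    and f: "idempotent_free C X Y f" and v: "v \<in> Hom C Y Z"
  shows "idempotent_free C X Z (Comp C X Y Z v f)"
  unfolding idempotent_free_def
proof (intro conjI ballI impI)
  have fH: "f \<in> Hom C X Y"
    using f by (simp add: idempotent_free_def)
  show "Comp C X Y Z v f \<in> Hom C X Z"
    using ob fH v by (intro Hom_intros)
  fix g
  assume g: "g \<in> Hom C Z X"
  define p where "p = Comp C Z X Z (Comp C X Y Z v f) g"
  have p: "Comp C Z Y Z v (Comp C Z X Y f g) = p"
    unfolding p_def by (rule assoc)
  assume "Comp C Z Z Z (Comp C Z X Z (Comp C X Y Z v f) g) (Comp C Z X Z (Comp C X Y Z v f) g) =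
    Comp C Z X Z (Comp C X Y Z v f) g"
  then have pp: "Comp C Z Z Z p p = p"
    by (fold p_def)
  have pH: "p \<in> Hom C Z Z"
    unfolding p[symmetric] using ob fH v g by (intro Hom_intros)
  \<comment> \<open>\<open>q = f g p v\<close> is idempotent because \<open>v f g = p\<close>, and \<open>p = v q f g\<close>.\<close>
  define q where "q = Comp C Y X Y f (Comp C Y Z X (Comp C Z Z X g p) v)"
  have fgH: "Comp C Z X Y f g \<in> Hom C Z Y"
    using ob fH g by (intro Hom_intros)
  have q: "q = Comp C Y Z Y (Comp C Z Z Y (Comp C Z X Y f g) p) v"
    using ob fH g v pH by (simp add: q_def assoc)
  have "Comp C Y Y Y q q = Comp C Y Z Y (Comp C Z Z Y (Comp C Z X Y f g)
      (Comp C Z Z Z p (Comp C Z Z Z (Comp C Z Y Z v (Comp C Z X Y f g)) p))) v"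
    unfolding q using ob v pH fgH by (simp add: assoc[symmetric])
  then have "Comp C Y Y Y q q = q"
    unfolding p pp q .
  moreover have "Comp C Y Z X (Comp C Z Z X g p) v \<in> Hom C Y X"
    using ob g v pH by (intro Hom_intros)
  ultimately have "q = 0"
    using f unfolding idempotent_free_def q_def by blast
  have "Comp C Z Y Z v (Comp C Z Y Y q (Comp C Z X Y f g)) =
      Comp C Z Z Z (Comp C Z Y Z v (Comp C Z X Y f g))
        (Comp C Z Z Z p (Comp C Z Y Z v (Comp C Z X Y f g)))"
    unfolding q using ob v pH fgH by (simp add: assoc[symmetric])
  then show "Comp C Z X Z (Comp C X Y Z v f) g = 0"
    unfolding p pp p_def[symmetric] \<open>q = 0\<close> by (simp add: Comp_simps)
qed

text \<open>McCoy's lemma on von Neumann regular elements.\<close>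

lemma is_regular_if_diff:
  assumes ob: "X \<in> Ob C" "Y \<in> Ob C" and y: "y \<in> Hom C X Y" and g: "g \<in> Hom C Y X"
    and reg: "is_regular C X Y (y - Comp C X Y Y (Comp C Y X Y y g) y)"
  shows "is_regular C X Y y"
proof -
  define y' where "y' = y - Comp C X Y Y (Comp C Y X Y y g) y"
  obtain h where h: "h \<in> Hom C Y X" "Comp C X Y Y (Comp C Y X Y y' h) y' = y'"
    using reg unfolding is_regular_def y'_def by blast
  define a b where "a = Ident C X - Comp C X Y X g y" and "b = Ident C Y - Comp C Y X Y y g"
  have aH: "a \<in> Hom C X X" and bH: "b \<in> Hom C Y Y"
    unfolding a_def b_def using ob y g by (auto intro!: Hom_intros)
  have ya: "y' = Comp C X X Y y a" and yb: "y' = Comp C X Y Y b y"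
    unfolding y'_def a_def b_def using ob y g
    by (simp_all add: Comp_simps Comp_Ident_left Comp_Ident_right assoc)
  \<comment> \<open>From \<open>y a = b y = y'\<close> follows
    \<open>y (a h b + g) y = y' h y' + y g y = y' + y g y = y\<close>, which is where this witness
    comes from.\<close>
  define k where "k = Comp C Y X X a (Comp C Y Y X h b) + g"
  have kH: "k \<in> Hom C Y X"
    unfolding k_def using ob aH bH h g by (intro Hom_intros)
  have "Comp C X Y Y (Comp C Y X Y y k) y =
      Comp C X Y Y (Comp C Y X Y (Comp C X X Y y a) h) (Comp C X Y Y b y) +
      Comp C X Y Y (Comp C Y X Y y g) y"
    unfolding k_def using ob aH bH h g y
    by (simp add: Comp_simps assoc[symmetric])
  also have "\<dots> = y"
    unfolding ya[symmetric] yb[symmetric] h(2) by (simp add: y'_def)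
  finally show ?thesis
    using kH unfolding is_regular_def by blast
qed

text \<open>Induction on the dimension of the right ideal of \<open>y\<close>. A nonzero
  \<open>y\<close> gives a nonzero idempotent \<open>p = y g\<close>. The right ideal of
  \<open>y' = y - p y\<close> lies in that of \<open>y\<close> and is killed by \<open>p\<close>,
  while \<open>p\<close> itself is not, so the dimension drops; McCoy's lemma carries regularity
  from \<open>y'\<close> back to \<open>y\<close>.\<close>

theorem is_regular_if_radical_free:
  assumes ob: "X \<in> Ob C" "Y \<in> Ob C" and rad: "radical_free C X Y" and "y \<in> Hom C X Y"
  shows "is_regular C X Y y"
  using \<open>y \<in> Hom C X Y\<close>
proof (induction "dim (Comp C Y X Y y ` Hom C Y X)" arbitrary: y rule: less_induct)
  case less
  show ?case
  proof (cases "y = 0")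
    case True
    then show ?thesis
      using ob zero_in_Hom[of Y X] by (auto simp: is_regular_def Comp_simps)
  next
    case False
    then obtain g where g: "g \<in> Hom C Y X"
      and pp: "Comp C Y Y Y (Comp C Y X Y y g) (Comp C Y X Y y g) = Comp C Y X Y y g"
      and p0: "Comp C Y X Y y g \<noteq> 0"
      using rad less.prems unfolding radical_free_def idempotent_free_def by blast
    define p where "p = Comp C Y X Y y g"
    have pH: "p \<in> Hom C Y Y"
      unfolding p_def using ob less.prems g by (intro Hom_intros)
    define y' where "y' = y - Comp C X Y Y p y"
    have y'H: "y' \<in> Hom C X Y"
      unfolding y'_def using ob less.prems pH by (intro Hom_intros)
    obtain T where T: "finite T" "Hom C Y Y \<subseteq> span T"
      using Hom_finite_dim ob by blast
    have "dim (Comp C Y X Y y' ` Hom C Y X) < dim (Comp C Y X Y y ` Hom C Y X)"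
    proof (rule dim_less_if_kernel[OF T(1), where \<psi> = id and \<phi> = "Comp C Y Y Y p" and w = p])
      show "Comp C Y X Y y ` Hom C Y X \<subseteq> span T"
        using T(2) ob less.prems by (auto intro: Comp_in_Hom)
      show "Vector_Spaces.linear scale scale id"
        by (rule linear_id)
      show "id ` Comp C Y X Y y' ` Hom C Y X \<subseteq> Comp C Y X Y y ` Hom C Y X"
      proof clarsimp
        fix u assume u: "u \<in> Hom C Y X"
        have "Comp C Y X Y y' u = Comp C Y X Y y (u - Comp C Y Y X g (Comp C Y X Y y u))"
          unfolding y'_def p_def using ob less.prems g u
          by (simp add: Comp_simps assoc)
        moreover have "u - Comp C Y Y X g (Comp C Y X Y y u) \<in> Hom C Y X"
          using ob less.prems g u by (intro Hom_intros)
        ultimately show "Comp C Y X Y y' u \<in> Comp C Y X Y y ` Hom C Y X"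
          by blast
      qed
      show "Comp C Y Y Y p (id u) = 0" if u: "u \<in> Comp C Y X Y y' ` Hom C Y X" for u
      proof -
        obtain v where v: "v \<in> Hom C Y X" "u = Comp C Y X Y y' v"
          using u by blast
        have "Comp C X Y Y p y' = 0"
          unfolding y'_def using ob less.prems pH pp
          by (simp add: Comp_simps assoc flip: p_def)
        then show ?thesis
          using ob v pH y'H by (simp add: assoc Comp_simps)
      qed
      show "p \<in> Comp C Y X Y y ` Hom C Y X"
        using g p_def by blast
      show "Comp C Y Y Y p p \<noteq> 0"
        using pp p0 by (simp add: p_def)
    qed (auto simp: linear_Comp_right)
    then have "is_regular C X Y y'"
      using less.hyps y'H by blast
    then show ?thesis
      using is_regular_if_diff[OF ob less.prems g] unfolding y'_def p_def by blast
  qed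
qed

end

section \<open>Zero objects, retracts and direct sums\<close>

lemma sum_lessThan_add:
  fixes f :: "nat \<Rightarrow> 'b::comm_monoid_add"
  shows "(\<Sum>k<m + n. f k) = (\<Sum>k<m. f k) + (\<Sum>k<n. f (m + k))"
  by (induction n) (auto simp: ac_simps)

context linear_category
begin

lemma is_zero_object_iff: "X \<in> Ob C \<Longrightarrow> is_zero_object C X \<longleftrightarrow> Ident C X = 0"
proof
  assume X: "X \<in> Ob C" and "is_zero_object C X"
  then show "Ident C X = 0"
    unfolding is_zero_object_def using Ident_in_Hom zero_in_Hom by blast
next
  assume X: "X \<in> Ob C" and I: "Ident C X = 0"
  have "f = 0" if "Y \<in> Ob C" "f \<in> Hom C X Y" for Y f
    using Comp_Ident_right[OF X that] I by (simp add: Comp_simps)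
  moreover have "f = 0" if "Y \<in> Ob C" "f \<in> Hom C Y X" for Y f
    using Comp_Ident_left[OF that(1) X that(2)] I by (simp add: Comp_simps)
  ultimately show "is_zero_object C X"
    using X zero_in_Hom unfolding is_zero_object_def by metis
qed

text \<open>The map \<open>b \<mapsto> i b r\<close> embeds the endomorphisms of \<open>A\<close>
  into those of \<open>X\<close>. Its image is annihilated by the nonzero idempotent
  \<open>w = 1 - i r\<close>, which does not annihilate itself. This is the measure for decomposing
  an object into simple ones.\<close>

lemma dim_Hom_less_if_retract:
  assumes ob: "A \<in> Ob C" "X \<in> Ob C" and i: "i \<in> Hom C A X" and r: "r \<in> Hom C X A"
    and ri: "Comp C A X A r i = Ident C A" and ir: "Comp C X A X i r \<noteq> Ident C X"
  shows "dim (Hom C A A) < dim (Hom C X X)"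
proof -
  define w where "w = Ident C X - Comp C X A X i r"
  obtain T where T: "finite T" "Hom C X X \<subseteq> span T"
    using Hom_finite_dim ob by blast
  have wi: "Comp C A X X w i = 0"
    unfolding w_def using ob i ri
    by (simp add: Comp_simps assoc[symmetric] Comp_Ident_left Comp_Ident_right)
  show ?thesis
  proof (rule dim_less_if_kernel[OF T, where \<psi> = "\<lambda>b. Comp C X A X (Comp C A A X i b) r"
        and \<phi> = "Comp C X X X w" and w = w])
    show "Vector_Spaces.linear scale scale (\<lambda>b. Comp C X A X (Comp C A A X i b) r)"
      by (auto simp: Vector_Spaces.linear_iff Comp_simps vector_space_axioms)
    have "Comp C A X A (Comp C X X A r (Comp C X A X (Comp C A A X i b) r)) i = b"
      if "b \<in> Hom C A A" for b
    proof -
      have "Comp C A X A (Comp C X X A r (Comp C X A X (Comp C A A X i b) r)) i =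
          Comp C A A A (Comp C A X A r i) (Comp C A A A b (Comp C A X A r i))"
        by (simp add: assoc)
      then show ?thesis
        using ob that by (simp add: ri Comp_Ident_left Comp_Ident_right)
    qed
    then show "inj_on (\<lambda>b. Comp C X A X (Comp C A A X i b) r) (span (Hom C A A))"
      unfolding span_eq_iff[THEN iffD2, OF subspace_Hom[OF ob(1) ob(1)]] by (rule inj_on_inverseI[where g = "\<lambda>y. Comp C A X A (Comp C X X A r y) i"])
    show "(\<lambda>b. Comp C X A X (Comp C A A X i b) r) ` Hom C A A \<subseteq> Hom C X X"
      using ob i r by (auto intro!: Comp_in_Hom)
    show "Comp C X X X w (Comp C X A X (Comp C A A X i u) r) = 0" for u
      by (simp add: assoc wi Comp_simps)
    show "w \<in> Hom C X X"
      unfolding w_def using ob i r by (intro Hom_intros)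
    have "Comp C X X X w w = w"
      using ob i r Comp_Ident_right[OF ob(2,2)] \<open>w \<in> Hom C X X\<close>
      by (subst (2) w_def) (simp add: Comp_simps assoc wi)
    then show "Comp C X X X w w \<noteq> 0"
      using ir by (simp add: w_def)
  qed (rule linear_Comp_right)
qed

lemma is_direct_sum_Nil: "X \<in> Ob C \<Longrightarrow> Ident C X = 0 \<Longrightarrow> is_direct_sum C [] X"
  by (simp add: is_direct_sum_def)

lemma is_direct_sum_singleton: "X \<in> Ob C \<Longrightarrow> is_direct_sum C [X] X"
  unfolding is_direct_sum_def
  by (intro conjI exI[of _ "\<lambda>_. Ident C X"]) (auto simp: Ident_in_Hom Comp_Ident_left)

text \<open>Orthogonality need not be assumed: multiplying \<open>i r + j s = 1\<close> by
  \<open>r\<close> gives \<open>r j s = 0\<close>, hence \<open>r j = 0\<close> because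
  \<open>s j = 1\<close>, and \<open>s i = 0\<close> follows symmetrically. With singleton lists
  this is also the way binary direct sums are built in both envelopes.\<close>

lemma is_direct_sum_append:
  assumes X: "X \<in> Ob C"
    and i: "i \<in> Hom C A X" and r: "r \<in> Hom C X A" and j: "j \<in> Hom C B X" and s: "s \<in> Hom C X B"
    and ri: "Comp C A X A r i = Ident C A" and sj: "Comp C B X B s j = Ident C B"
    and sum: "Comp C X A X i r + Comp C X B X j s = Ident C X"
    and A: "is_direct_sum C Ss A" and B: "is_direct_sum C Ts B"
  shows "is_direct_sum C (Ss @ Ts) X"
proof -
  have ob: "A \<in> Ob C" "B \<in> Ob C" "set Ss \<subseteq> Ob C" "set Ts \<subseteq> Ob C"
    using A B by (auto simp: is_direct_sum_def)
  have "Comp C X X A r (Ident C X) = Comp C X X A r (Comp C X A X i r) + Comp C X X A r (Comp C X B X j s)"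
    by (simp add: sum Comp_simps(2)[symmetric])
  then have "Comp C X X A r (Comp C X B X j s) = 0"
    using X ob r by (simp add: assoc ri Comp_Ident_right Comp_Ident_left)
  then have "Comp C B X A (Comp C X X A r (Comp C X B X j s)) j = 0"
    by (simp add: Comp_simps)
  then have "Comp C B B A (Comp C B X A r j) (Comp C B X B s j) = 0"
    by (simp add: assoc)
  then have rj: "Comp C B X A r j = 0"
    using X ob r j by (simp add: sj Comp_in_Hom Comp_Ident_right)
  have "Comp C X X B s (Ident C X) = Comp C X X B s (Comp C X A X i r) + Comp C X X B s (Comp C X B X j s)"
    by (simp add: sum Comp_simps(2)[symmetric])
  then have "Comp C X X B s (Comp C X A X i r) = 0"
    using X ob s by (simp add: assoc sj Comp_Ident_right Comp_Ident_left)
  then have "Comp C A X B (Comp C X X B s (Comp C X A X i r)) i = 0"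
    by (simp add: Comp_simps)
  then have "Comp C A A B (Comp C A X B s i) (Comp C A X A r i) = 0"
    by (simp add: assoc)
  then have si: "Comp C A X B s i = 0"
    using X ob s i by (simp add: ri Comp_in_Hom Comp_Ident_right)
  obtain a b where
    ab: "\<And>k. k < length Ss \<Longrightarrow> a k \<in> Hom C (Ss ! k) A \<and> b k \<in> Hom C A (Ss ! k)"
      "\<And>k l. k < length Ss \<Longrightarrow> l < length Ss \<Longrightarrow>
         Comp C (Ss ! k) A (Ss ! l) (b l) (a k) = (if k = l then Ident C (Ss ! k) else 0)"
      "(\<Sum>k<length Ss. Comp C A (Ss ! k) A (a k) (b k)) = Ident C A"
    using A unfolding is_direct_sum_def by blast
  obtain c d where
    cd: "\<And>k. k < length Ts \<Longrightarrow> c k \<in> Hom C (Ts ! k) B \<and> d k \<in> Hom C B (Ts ! k)"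
      "\<And>k l. k < length Ts \<Longrightarrow> l < length Ts \<Longrightarrow>
         Comp C (Ts ! k) B (Ts ! l) (d l) (c k) = (if k = l then Ident C (Ts ! k) else 0)"
      "(\<Sum>k<length Ts. Comp C B (Ts ! k) B (c k) (d k)) = Ident C B"
    using B unfolding is_direct_sum_def by blast
  let ?n = "length Ss"
  define u where "u k = (if k < ?n then Comp C (Ss ! k) A X i (a k)
    else Comp C (Ts ! (k - ?n)) B X j (c (k - ?n)))" for k
  define v where "v k = (if k < ?n then Comp C X A (Ss ! k) (b k) r
    else Comp C X B (Ts ! (k - ?n)) (d (k - ?n)) s)" for k
  \<comment> \<open>Rebrackets a fourfold composite so that the inner pair stands alone and can be
    rewritten by the relations among \<open>i\<close>, \<open>j\<close>, \<open>r\<close> and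
    \<open>s\<close>.\<close>
  have mid: "Comp C V X W (Comp C X Y W x y) (Comp C V Z X z w) =
      Comp C V Y W x (Comp C V Z Y (Comp C Z X Y y z) w)" for V W Y Z x y z w
    by (simp add: assoc)
  have nth: "Ss ! k \<in> Ob C" if "k < ?n" for k
    using ob that by auto
  have nth': "Ts ! k \<in> Ob C" if "k < length Ts" for k
    using ob that by auto
  show ?thesis
    unfolding is_direct_sum_def
  proof (intro conjI exI[of _ u, OF exI[of _ v]] allI impI)
    show "set (Ss @ Ts) \<subseteq> Ob C" "X \<in> Ob C"
      using ob X by auto
  next
    fix k assume "k < length (Ss @ Ts)"
    then show "u k \<in> Hom C ((Ss @ Ts) ! k) X" "v k \<in> Hom C X ((Ss @ Ts) ! k)"
      using X ob i j r s ab(1) cd(1) nth nth'[of "k - ?n"]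
      by (auto simp: u_def v_def nth_append intro!: Comp_in_Hom)
  next
    fix k l assume k: "k < length (Ss @ Ts)" and l: "l < length (Ss @ Ts)"
    show "Comp C ((Ss @ Ts) ! k) X ((Ss @ Ts) ! l) (v l) (u k) =
        (if k = l then Ident C ((Ss @ Ts) ! k) else 0)"
    proof (cases "k < ?n"; cases "l < ?n")
      assume "k < ?n" "l < ?n"
      then show ?thesis
        using ob nth[of k] ab(1)[of k] ab(2)[of k l]
        by (simp add: u_def v_def nth_append mid ri Comp_Ident_left)
    next
      assume "k < ?n" "\<not> l < ?n"
      then show ?thesis
        by (auto simp: u_def v_def nth_append mid si Comp_simps)
    next
      assume "\<not> k < ?n" "l < ?n"
      then show ?thesis
        by (auto simp: u_def v_def nth_append mid rj Comp_simps)
    next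
      assume "\<not> k < ?n" "\<not> l < ?n"
      then show ?thesis
        using k l ob nth'[of "k - ?n"] cd(1)[of "k - ?n"] cd(2)[of "k - ?n" "l - ?n"]
        by (simp add: u_def v_def nth_append mid sj Comp_Ident_left) auto
    qed
  next
    have "(\<Sum>k<length (Ss @ Ts). Comp C X ((Ss @ Ts) ! k) X (u k) (v k)) =
        (\<Sum>k<?n. Comp C X A X i (Comp C X A A (Comp C A (Ss ! k) A (a k) (b k)) r)) +
        (\<Sum>k<length Ts. Comp C X B X j (Comp C X B B (Comp C B (Ts ! k) B (c k) (d k)) s))"
      unfolding length_append sum_lessThan_add
      by (simp add: u_def v_def nth_append assoc)
    also have "\<dots> = Ident C X"
      unfolding Comp_sum_left[symmetric] Comp_sum_right[symmetric] ab(3) cd(3)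
      using X ob r s sum by (simp add: Comp_Ident_left)
    finally show "(\<Sum>k<length (Ss @ Ts). Comp C X ((Ss @ Ts) ! k) X (u k) (v k)) = Ident C X" .
  qed
qed

end

section \<open>From quasi-inverses to abelian and semisimple categories\<close>

locale regular_category = linear_category +
  assumes zero_object: "\<exists>Z. is_zero_object C Z"
    and binary_direct_sums: "\<lbrakk>X \<in> Ob C; Y \<in> Ob C\<rbrakk> \<Longrightarrow> \<exists>S. is_direct_sum C [X, Y] S"
    and split_idempotents:
      "\<lbrakk>X \<in> Ob C; p \<in> Hom C X X; Comp C X X X p p = p\<rbrakk> \<Longrightarrow> splits C X p"
    and regular: "\<lbrakk>X \<in> Ob C; Y \<in> Ob C; f \<in> Hom C X Y\<rbrakk> \<Longrightarrow> is_regular C X Y f"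
begin

text \<open>Cancelling \<open>f\<close> in \<open>f (g f) = f\<close> turns a quasi-inverse into a
  left inverse.\<close>

lemma mono_split:
  assumes ob: "X \<in> Ob C" "Y \<in> Ob C" and f: "is_mono C X Y f"
  obtains g where "g \<in> Hom C Y X" "Comp C X Y X g f = Ident C X"
proof -
  have fH: "f \<in> Hom C X Y"
    using f by (simp add: is_mono_def)
  then obtain g where g: "g \<in> Hom C Y X" "Comp C X Y Y (Comp C Y X Y f g) f = f"
    using regular ob unfolding is_regular_def by blast
  then have "Comp C X X Y f (Comp C X Y X g f) = Comp C X X Y f (Ident C X)"
    using ob fH by (simp add: assoc Comp_Ident_right)
  moreover have "Comp C X Y X g f \<in> Hom C X X" "Ident C X \<in> Hom C X X"
    using ob fH g by (auto intro: Hom_intros)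
  ultimately have "Comp C X Y X g f = Ident C X"
    using f ob unfolding is_mono_def by blast
  with g(1) show thesis
    by (rule that)
qed

lemma epi_split:
  assumes ob: "X \<in> Ob C" "Y \<in> Ob C" and f: "is_epi C X Y f"
  obtains g where "g \<in> Hom C Y X" "Comp C Y X Y f g = Ident C Y"
proof -
  have fH: "f \<in> Hom C X Y"
    using f by (simp add: is_epi_def)
  then obtain g where g: "g \<in> Hom C Y X" "Comp C X Y Y (Comp C Y X Y f g) f = f"
    using regular ob unfolding is_regular_def by blast
  then have "Comp C X Y Y (Comp C Y X Y f g) f = Comp C X Y Y (Ident C Y) f"
    using ob fH by (simp add: Comp_Ident_left)
  moreover have "Comp C Y X Y f g \<in> Hom C Y Y" "Ident C Y \<in> Hom C Y Y"
    using ob fH g by (auto intro: Hom_intros)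
  ultimately have "Comp C Y X Y f g = Ident C Y"
    using f ob unfolding is_epi_def by blast
  with g(1) show thesis
    by (rule that)
qed

text \<open>For a quasi-inverse \<open>g\<close> of \<open>f\<close>, the kernel of \<open>f\<close>
  is the image of the idempotent \<open>1 - g f\<close> and the cokernel that of
  \<open>1 - f g\<close>. A monomorphism has a left inverse \<open>g\<close> and is then a kernel of
  \<open>1 - f g\<close>; an epimorphism has a right inverse \<open>g\<close> and is a cokernel of
  \<open>1 - g f\<close>.\<close>

sublocale abelian_category C
proof (unfold_locales, goal_cases)
  case 1
  show ?case by (rule zero_object)
next
  case (2 X Y)
  then show ?case by (rule binary_direct_sums)
next
  case (3 X Y f)
  note ob = 3(1,2)
  obtain g where g: "g \<in> Hom C Y X" "Comp C X Y Y (Comp C Y X Y f g) f = f"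
    using regular 3 unfolding is_regular_def by blast
  define p where "p = Ident C X - Comp C X Y X g f"
  have fp: "Comp C X X Y f p = 0"
    unfolding p_def using 3 g by (simp add: Comp_simps assoc Comp_Ident_right)
  have pH: "p \<in> Hom C X X"
    unfolding p_def using 3 g by (intro Hom_intros)
  have "Comp C X X X p p = p"
    by (subst p_def) (use 3 pH in \<open>simp add: Comp_simps assoc[symmetric] fp Comp_Ident_left\<close>)
  then obtain K i r where K: "K \<in> Ob C" "i \<in> Hom C K X" "r \<in> Hom C X K"
    "Comp C K X K r i = Ident C K" "Comp C X K X i r = p"
    using split_idempotents ob pH unfolding splits_def by blast
  have "is_kernel C K X Y i f"
    unfolding is_kernel_def
  proof (intro conjI ballI impI)
    have "Comp C K X Y f i = Comp C K K Y (Comp C K X Y f i) (Comp C K X K r i)"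
      using 3 K by (simp add: Comp_in_Hom Comp_Ident_right)
    also have "\<dots> = Comp C K X Y (Comp C X X Y f (Comp C X K X i r)) i"
      by (simp add: assoc)
    also have "\<dots> = 0"
      by (simp add: K fp Comp_simps)
    finally show "Comp C K X Y f i = 0" .
    fix W h assume W: "W \<in> Ob C" and h: "h \<in> Hom C W X" and fh: "Comp C W X Y f h = 0"
    have "Comp C W X X p h = h"
      unfolding p_def using W h ob by (simp add: Comp_simps assoc[symmetric] fh Comp_Ident_left)
    then have "Comp C W K X i (Comp C W X K r h) = h"
      by (simp add: assoc K)
    moreover have "Comp C W X K r h \<in> Hom C W K"
      using W h K ob by (intro Hom_intros)
    moreover have "u = Comp C W X K r h" if "u \<in> Hom C W K" "Comp C W K X i u = h" for u
      using that W K by (auto simp: assoc Comp_Ident_left)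
    ultimately show "\<exists>!u. u \<in> Hom C W K \<and> Comp C W K X i u = h"
      by blast
  qed (use 3 K in auto)
  then show ?case
    using K by blast
next
  case (4 X Y f)
  note ob = 4(1,2)
  obtain g where g: "g \<in> Hom C Y X" "Comp C X Y Y (Comp C Y X Y f g) f = f"
    using regular 4 unfolding is_regular_def by blast
  define p where "p = Ident C Y - Comp C Y X Y f g"
  have pf: "Comp C X Y Y p f = 0"
    unfolding p_def using 4 g by (simp add: Comp_simps Comp_Ident_left)
  have pH: "p \<in> Hom C Y Y"
    unfolding p_def using 4 g by (intro Hom_intros)
  have "Comp C Y Y Y p p = p"
    by (subst (2) p_def) (use 4 pH in \<open>simp add: Comp_simps assoc pf Comp_Ident_right\<close>)
  then obtain K i r where K: "K \<in> Ob C" "i \<in> Hom C K Y" "r \<in> Hom C Y K"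
    "Comp C K Y K r i = Ident C K" "Comp C Y K Y i r = p"
    using split_idempotents ob pH unfolding splits_def by blast
  have "is_cokernel C X Y K f r"
    unfolding is_cokernel_def
  proof (intro conjI ballI impI)
    have "Comp C X Y K r f = Comp C X K K (Comp C K Y K r i) (Comp C X Y K r f)"
      using 4 K by (simp add: Comp_in_Hom Comp_Ident_left)
    also have "\<dots> = Comp C X Y K r (Comp C X Y Y (Comp C Y K Y i r) f)"
      by (simp add: assoc)
    also have "\<dots> = 0"
      by (simp add: K pf Comp_simps)
    finally show "Comp C X Y K r f = 0" .
    fix Z h assume Z: "Z \<in> Ob C" and h: "h \<in> Hom C Y Z" and hf: "Comp C X Y Z h f = 0"
    have "Comp C Y Y Z h p = h"
      unfolding p_def using Z h ob by (simp add: Comp_simps assoc hf Comp_Ident_right)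
    then have "Comp C Y K Z (Comp C K Y Z h i) r = h"
      by (simp add: assoc[symmetric] K)
    moreover have "Comp C K Y Z h i \<in> Hom C K Z"
      using Z h K ob by (intro Hom_intros)
    moreover have "u = Comp C K Y Z h i" if "u \<in> Hom C K Z" "Comp C Y K Z u r = h" for u
      using that Z K by (auto simp: assoc[symmetric] Comp_Ident_right)
    ultimately show "\<exists>!u. u \<in> Hom C K Z \<and> Comp C Y K Z u r = h"
      by blast
  qed (use 4 K in auto)
  then show ?case
    using K by blast
next
  case (5 X Y f)
  note ob = 5(1,2)
  have fH: "f \<in> Hom C X Y"
    using 5 by (simp add: is_mono_def)
  obtain g where g: "g \<in> Hom C Y X" "Comp C X Y X g f = Ident C X"
    using mono_split 5 by blast
  define q where "q = Ident C Y - Comp C Y X Y f g"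
  have qH: "q \<in> Hom C Y Y"
    unfolding q_def using ob fH g by (intro Hom_intros)
  have "is_kernel C X Y Y f q"
    unfolding is_kernel_def
  proof (intro conjI ballI impI)
    show "Comp C X Y Y q f = 0"
      unfolding q_def using ob fH g
      by (simp add: Comp_simps assoc[symmetric] Comp_Ident_left Comp_Ident_right)
    fix W h assume W: "W \<in> Ob C" and h: "h \<in> Hom C W Y" and "Comp C W Y Y q h = 0"
    then have "Comp C W X Y f (Comp C W Y X g h) = h"
      using ob unfolding q_def by (simp add: Comp_simps assoc Comp_Ident_left)
    moreover have "Comp C W Y X g h \<in> Hom C W X"
      using W h ob g by (intro Hom_intros)
    moreover have "u = Comp C W Y X g h" if "u \<in> Hom C W X" "Comp C W X Y f u = h" for u
      using that W ob by (auto simp: assoc g Comp_Ident_left)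
    ultimately show "\<exists>!u. u \<in> Hom C W X \<and> Comp C W X Y f u = h"
      by blast
  qed (use fH qH in auto)
  then show ?case
    using ob by blast
next
  case (6 X Y f)
  note ob = 6(1,2)
  have fH: "f \<in> Hom C X Y"
    using 6 by (simp add: is_epi_def)
  obtain g where g: "g \<in> Hom C Y X" "Comp C Y X Y f g = Ident C Y"
    using epi_split 6 by blast
  define q where "q = Ident C X - Comp C X Y X g f"
  have qH: "q \<in> Hom C X X"
    unfolding q_def using ob fH g by (intro Hom_intros)
  have "is_cokernel C X X Y q f"
    unfolding is_cokernel_def
  proof (intro conjI ballI impI)
    show "Comp C X X Y f q = 0"
      unfolding q_def using ob fH g
      by (simp add: Comp_simps assoc Comp_Ident_left Comp_Ident_right)
    fix Z h assume Z: "Z \<in> Ob C" and h: "h \<in> Hom C X Z" and "Comp C X X Z h q = 0"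
    then have "Comp C X Y Z (Comp C Y X Z h g) f = h"
      using ob unfolding q_def by (simp add: Comp_simps assoc Comp_Ident_right)
    moreover have "Comp C Y X Z h g \<in> Hom C Y Z"
      using Z h ob g by (intro Hom_intros)
    moreover have "u = Comp C Y X Z h g" if "u \<in> Hom C Y Z" "Comp C X Y Z u f = h" for u
      using that Z ob by (auto simp: assoc[symmetric] g Comp_Ident_right)
    ultimately show "\<exists>!u. u \<in> Hom C Y Z \<and> Comp C X Y Z u f = h"
      by blast
  qed (use fH qH in auto)
  then show ?case
    using ob by blast
qed

text \<open>An object that is neither zero nor simple has a monomorphism \<open>i\<close> from some
  nonzero \<open>A\<close> that is not an isomorphism. It splits, and the image \<open>B\<close> of
  the complementary idempotent completes \<open>A\<close> to \<open>X\<close>; both summands have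
  smaller endomorphism algebras than \<open>X\<close>.\<close>

lemma direct_sum_of_simples:
  "X \<in> Ob C \<Longrightarrow> \<exists>Ss. (\<forall>S\<in>set Ss. is_simple C S) \<and> is_direct_sum C Ss X"
proof (induction "dim (Hom C X X)" arbitrary: X rule: less_induct)
  case less
  note X = less.prems
  consider "is_zero_object C X" | "is_simple C X" |
    A i where "A \<in> Ob C" "is_mono C A X i" "\<not> is_zero_object C A" "\<not> is_iso C A X i"
    using X unfolding is_simple_def by blast
  then show ?case
  proof cases
    case 1
    then show ?thesis
      using X is_direct_sum_Nil[OF X] is_zero_object_iff by (intro exI[of _ "[]"]) auto
  next
    case 2
    then show ?thesis
      using X is_direct_sum_singleton by (intro exI[of _ "[X]"]) auto
  next
    case 3
    obtain g where g: "g \<in> Hom C X A" "Comp C A X A g i = Ident C A"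
      using mono_split X 3 by blast
    have iH: "i \<in> Hom C A X"
      using 3 by (simp add: is_mono_def)
    define p where "p = Ident C X - Comp C X A X i g"
    have pH: "p \<in> Hom C X X"
      unfolding p_def using X 3(1) iH g by (intro Hom_intros)
    have pi: "Comp C A X X p i = 0"
      unfolding p_def using X 3(1) iH g
      by (simp add: Comp_simps assoc[symmetric] Comp_Ident_left Comp_Ident_right)
    have "Comp C X X X p p = p"
      by (subst (2) p_def) (use X pH in \<open>simp add: Comp_simps assoc pi Comp_Ident_right\<close>)
    then obtain B j s where B: "B \<in> Ob C" "j \<in> Hom C B X" "s \<in> Hom C X B"
      "Comp C B X B s j = Ident C B" "Comp C X B X j s = p"
      using split_idempotents X pH unfolding splits_def by blast
    have "Comp C X A X i g \<noteq> Ident C X"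
      using 3(4) iH g unfolding is_iso_def by blast
    then have "dim (Hom C A A) < dim (Hom C X X)"
      using dim_Hom_less_if_retract X 3(1) iH g by blast
    \<comment> \<open>This makes \<open>j s = 1 - i g\<close> different from the identity, so that
      the complement \<open>B\<close> is also strictly smaller.\<close>
    moreover have "Comp C X A X i g \<noteq> 0"
    proof
      assume "Comp C X A X i g = 0"
      then have "Comp C A X A g (Comp C A X X (Comp C X A X i g) i) = 0"
        by (simp add: Comp_simps)
      then have "Comp C A A A (Comp C A X A g i) (Comp C A X A g i) = 0"
        by (simp add: assoc)
      then have "Ident C A = 0"
        using g 3(1) by (simp add: Comp_Ident_left Ident_in_Hom)
      then show False
        using 3 is_zero_object_iff by blast
    qed
    then have "dim (Hom C B B) < dim (Hom C X X)"
      using B X by (intro dim_Hom_less_if_retract) (auto simp: p_def)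
    ultimately obtain Ss Ts where
      ST: "\<forall>S\<in>set Ss. is_simple C S" "is_direct_sum C Ss A"
          "\<forall>S\<in>set Ts. is_simple C S" "is_direct_sum C Ts B"
      using less.hyps 3(1) B(1) by meson
    have "is_direct_sum C (Ss @ Ts) X"
      using is_direct_sum_append[OF X iH g(1) B(2,3) g(2) B(4) _ ST(2,4)] B(5)
      by (simp add: p_def)
    then show ?thesis
      using ST by (intro exI[of _ "Ss @ Ts"]) auto
  qed
qed

theorem semisimple: "semisimple_category C"
  unfolding semisimple_category_def
  using abelian_category_axioms direct_sum_of_simples by blast

end

section \<open>Schur's lemma in a semisimple category\<close>

context linear_category
begin

text \<open>A nonzero \<open>f\<close> has a nonzero component \<open>h\<close> between simple
  summands of \<open>X\<close> and \<open>Y\<close>, which is invertible by Schur's lemma; its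
  inverse, padded by the injection and the projection, detects \<open>f\<close>. This rules out
  nonzero morphisms whose composites back to the source all vanish.\<close>

lemma semisimple_nonzero_left_composite:
  assumes ss: "semisimple_category C" and ob: "X \<in> Ob C" "Y \<in> Ob C"
    and f: "f \<in> Hom C X Y" "f \<noteq> 0"
  obtains g where "g \<in> Hom C Y X" "Comp C X Y X g f \<noteq> 0"
proof -
  interpret abelian_category C
    using ss by (simp add: semisimple_category_def)
  obtain Ss Ts where Ss: "\<forall>S\<in>set Ss. is_simple C S" "is_direct_sum C Ss X"
    and Ts: "\<forall>S\<in>set Ts. is_simple C S" "is_direct_sum C Ts Y"
    using ss ob unfolding semisimple_category_def by meson
  obtain a b where
    ab: "\<forall>k<length Ss. a k \<in> Hom C (Ss ! k) X \<and> b k \<in> Hom C X (Ss ! k)"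
      "\<forall>k<length Ss. \<forall>l<length Ss.
         Comp C (Ss ! k) X (Ss ! l) (b l) (a k) = (if k = l then Ident C (Ss ! k) else 0)"
      "(\<Sum>k<length Ss. Comp C X (Ss ! k) X (a k) (b k)) = Ident C X"
    using Ss(2) unfolding is_direct_sum_def by blast
  obtain c d where
    cd: "\<forall>k<length Ts. c k \<in> Hom C (Ts ! k) Y \<and> d k \<in> Hom C Y (Ts ! k)"
      "(\<Sum>k<length Ts. Comp C Y (Ts ! k) Y (c k) (d k)) = Ident C Y"
    using Ts(2) unfolding is_direct_sum_def by blast
  have "f = Comp C X X Y f (\<Sum>k<length Ss. Comp C X (Ss ! k) X (a k) (b k))"
    using ob f ab(3) by (simp add: Comp_Ident_right)
  also have "\<dots> = (\<Sum>k<length Ss. Comp C X (Ss ! k) Y (Comp C (Ss ! k) X Y f (a k)) (b k))"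
    by (simp add: Comp_sum_right assoc)
  finally have "(\<Sum>k<length Ss. Comp C X (Ss ! k) Y (Comp C (Ss ! k) X Y f (a k)) (b k)) \<noteq> 0"
    using f(2) by simp
  then obtain k where "k \<in> {..<length Ss}" "Comp C X (Ss ! k) Y (Comp C (Ss ! k) X Y f (a k)) (b k) \<noteq> 0"
    by (rule sum.not_neutral_contains_not_neutral)
  then have k: "k < length Ss" "Comp C (Ss ! k) X Y f (a k) \<noteq> 0"
    by (auto simp: Comp_simps)
  define S where "S = Ss ! k"
  define fa where "fa = Comp C S X Y f (a k)"
  have S: "S \<in> Ob C" "is_simple C S" "a k \<in> Hom C S X" "b k \<in> Hom C X S"
    using k(1) Ss ab(1) by (auto simp: S_def is_direct_sum_def)
  have fa: "fa \<in> Hom C S Y" "fa \<noteq> 0"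
    using S ob f k(2) unfolding fa_def S_def by (auto intro: Comp_in_Hom)
  have "fa = Comp C S Y Y (\<Sum>l<length Ts. Comp C Y (Ts ! l) Y (c l) (d l)) fa"
    using ob S fa cd(2) by (simp add: Comp_Ident_left)
  also have "\<dots> = (\<Sum>l<length Ts. Comp C S (Ts ! l) Y (c l) (Comp C S Y (Ts ! l) (d l) fa))"
    by (simp add: Comp_sum_left assoc)
  finally have "(\<Sum>l<length Ts. Comp C S (Ts ! l) Y (c l) (Comp C S Y (Ts ! l) (d l) fa)) \<noteq> 0"
    using fa(2) by simp
  then obtain l where "l \<in> {..<length Ts}" "Comp C S (Ts ! l) Y (c l) (Comp C S Y (Ts ! l) (d l) fa) \<noteq> 0"
    by (rule sum.not_neutral_contains_not_neutral)
  then have l: "l < length Ts" "Comp C S Y (Ts ! l) (d l) fa \<noteq> 0"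
    by (auto simp: Comp_simps)
  define T where "T = Ts ! l"
  define h where "h = Comp C S Y T (d l) fa"
  have T: "T \<in> Ob C" "is_simple C T" "d l \<in> Hom C Y T"
    using l(1) Ts cd(1) by (auto simp: T_def is_direct_sum_def)
  have h: "h \<in> Hom C S T" "h \<noteq> 0"
    using S T ob fa l(2) unfolding h_def T_def by (auto intro: Comp_in_Hom)
  obtain K i where K: "K \<in> Ob C" "is_kernel C K S T i h"
    using has_kernels S T h by blast
  have i: "i \<in> Hom C K S" "Comp C K S T h i = 0"
    using K by (auto simp: is_kernel_def)
  have factor: "\<exists>!u. u \<in> Hom C W K \<and> Comp C W K S i u = v"
    if "W \<in> Ob C" "v \<in> Hom C W S" "Comp C W S T h v = 0" for W v
    using K that unfolding is_kernel_def by blast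
  have "is_mono C K S i"
    unfolding is_mono_def
  proof (intro conjI ballI impI)
    fix W u v assume W: "W \<in> Ob C" "u \<in> Hom C W K" "v \<in> Hom C W K" "Comp C W K S i u = Comp C W K S i v"
    have "Comp C W S T h (Comp C W K S i u) = 0"
      by (simp add: assoc i Comp_simps)
    moreover have "Comp C W K S i u \<in> Hom C W S"
      using W K S i by (intro Comp_in_Hom)
    ultimately show "u = v"
      using factor[of W "Comp C W K S i u"] W by metis
  qed (rule i)
  \<comment> \<open>An invertible kernel inclusion \<open>i\<close> would turn
    \<open>h i = 0\<close> into \<open>h = 0\<close>. Simplicity of \<open>S\<close> then leaves
    only a zero kernel, which makes \<open>h\<close> a monomorphism and, by simplicity of
    \<open>T\<close>, an isomorphism.\<close>
  moreover have "\<not> is_iso C K S i"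
  proof
    assume "is_iso C K S i"
    then obtain j where "j \<in> Hom C S K" "Comp C S K S i j = Ident C S"
      unfolding is_iso_def by blast
    then have "Comp C S S T h (Comp C S K S i j) = h"
      using S T h by (simp add: Comp_Ident_right)
    then show False
      using h(2) by (simp add: assoc i Comp_simps)
  qed
  ultimately have "is_zero_object C K"
    using S(2) K(1) unfolding is_simple_def by blast
  then have K0: "u = 0" if "W \<in> Ob C" "u \<in> Hom C W K" for W u
    using that K(1) zero_in_Hom unfolding is_zero_object_def by blast
  have "is_mono C S T h"
    unfolding is_mono_def
  proof (intro conjI ballI impI)
    fix W u v assume W: "W \<in> Ob C" "u \<in> Hom C W S" "v \<in> Hom C W S" "Comp C W S T h u = Comp C W S T h v"
    then have "Comp C W S T h (u - v) = 0" "u - v \<in> Hom C W S"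
      using S by (auto simp: Comp_simps intro: diff_in_Hom)
    then obtain w where "w \<in> Hom C W K" "Comp C W K S i w = u - v"
      using factor W by blast
    moreover from this have "w = 0"
      using K0 W(1) by blast
    ultimately show "u = v"
      by (simp add: Comp_simps)
  qed (rule h)
  then have "is_iso C S T h"
    using T(2) S(1,2) unfolding is_simple_def by blast
  then obtain g' where g': "g' \<in> Hom C T S" "Comp C S T S g' h = Ident C S"
    unfolding is_iso_def by blast
  \<comment> \<open>Chosen so that \<open>g f\<close> restricted along \<open>a k\<close> is
    \<open>a k\<close> composed with \<open>g' h = 1\<close>; since \<open>a k\<close> is a split
    injection of a nonzero object, \<open>g f\<close> cannot be 0.\<close>
  define g where "g = Comp C Y T X (Comp C T S X (a k) g') (d l)"
  have "g \<in> Hom C Y X"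
    unfolding g_def using ob S T g' by (intro Comp_in_Hom)
  moreover have "Comp C X Y X g f \<noteq> 0"
  proof
    assume 0: "Comp C X Y X g f = 0"
    have "a k = Comp C S S X (a k) (Comp C S T S g' h)"
      using S ob g' by (simp add: Comp_Ident_right)
    also have "\<dots> = Comp C S X X (Comp C X Y X g f) (a k)"
      by (simp add: g_def h_def fa_def assoc)
    finally have "a k = 0"
      by (simp add: 0 Comp_simps)
    moreover have "Comp C S X S (b k) (a k) = Ident C S"
      using ab(2) k(1) by (simp add: S_def)
    ultimately have "Ident C S = 0"
      by (simp add: Comp_simps)
    then show False
      using S is_zero_object_iff by (simp add: is_simple_def)
  qed
  ultimately show thesis
    by (rule that)
qed

end

section \<open>Envelopes of linear categories\<close>

context linear_category
begin

lemma direct_sum_pairE: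
  assumes "is_direct_sum C [A, B] S"
  obtains i j r s where "i \<in> Hom C A S" "j \<in> Hom C B S" "r \<in> Hom C S A" "s \<in> Hom C S B"
    "Comp C A S A r i = Ident C A" "Comp C B S B s j = Ident C B"
    "Comp C A S B s i = 0" "Comp C B S A r j = 0"
    "Comp C S A S i r + Comp C S B S j s = Ident C S"
proof -
  obtain a b where ab:
    "\<forall>k<length [A, B]. a k \<in> Hom C ([A, B] ! k) S \<and> b k \<in> Hom C S ([A, B] ! k)"
    "\<forall>k<length [A, B]. \<forall>l<length [A, B]. Comp C ([A, B] ! k) S ([A, B] ! l) (b l) (a k) =
       (if k = l then Ident C ([A, B] ! k) else 0)"
    "(\<Sum>k<length [A, B]. Comp C S ([A, B] ! k) S (a k) (b k)) = Ident C S"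
    using assms unfolding is_direct_sum_def by blast
  show thesis
    using ab(3) ab(1)[rule_format, of 0] ab(1)[rule_format, of 1]
      ab(2)[rule_format, of 0 0] ab(2)[rule_format, of 1 1]
      ab(2)[rule_format, of 0 1] ab(2)[rule_format, of 1 0]
    by (intro that[of "a 0" "a 1" "b 0" "b 1"]) (simp_all add: numeral_2_eq_2)
qed

text \<open>The components \<open>f i\<close> and \<open>f j\<close> are again idempotent-free,
  hence 0, and \<open>f = f i r + f j s\<close>.\<close>

lemma radical_free_direct_sum_left:
  assumes Z: "Z \<in> Ob C" and S: "is_direct_sum C [A, B] S"
    and A: "radical_free C A Z" and B: "radical_free C B Z"
  shows "radical_free C S Z"
  unfolding radical_free_def
proof (intro allI impI)
  fix f assume f: "idempotent_free C S Z f"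
  obtain i j r s where ij: "i \<in> Hom C A S" "j \<in> Hom C B S"
    "Comp C S A S i r + Comp C S B S j s = Ident C S"
    by (rule direct_sum_pairE[OF S])
  have ob: "A \<in> Ob C" "B \<in> Ob C" "S \<in> Ob C"
    using S by (auto simp: is_direct_sum_def)
  have "f = Comp C S S Z f (Comp C S A S i r + Comp C S B S j s)"
    using f ob Z by (simp add: ij idempotent_free_def Comp_Ident_right)
  also have "\<dots> = Comp C S A Z (Comp C A S Z f i) r + Comp C S B Z (Comp C B S Z f j) s"
    by (simp add: Comp_simps assoc)
  also have "Comp C A S Z f i = 0"
    using A ij f ob Z idempotent_free_Comp_right unfolding radical_free_def by blast
  also have "Comp C B S Z f j = 0"
    using B ij f ob Z idempotent_free_Comp_right unfolding radical_free_def by blast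
  finally show "f = 0"
    by (simp add: Comp_simps)
qed

lemma radical_free_direct_sum_right:
  assumes Z: "Z \<in> Ob C" and S: "is_direct_sum C [A, B] S"
    and A: "radical_free C Z A" and B: "radical_free C Z B"
  shows "radical_free C Z S"
  unfolding radical_free_def
proof (intro allI impI)
  fix f assume f: "idempotent_free C Z S f"
  obtain i j r s where ij: "r \<in> Hom C S A" "s \<in> Hom C S B"
    "Comp C S A S i r + Comp C S B S j s = Ident C S"
    by (rule direct_sum_pairE[OF S])
  have ob: "A \<in> Ob C" "B \<in> Ob C" "S \<in> Ob C"
    using S by (auto simp: is_direct_sum_def)
  have "f = Comp C Z S S (Comp C S A S i r + Comp C S B S j s) f"
    using f ob Z by (simp add: ij idempotent_free_def Comp_Ident_left)
  also have "\<dots> = Comp C Z A S i (Comp C Z S A r f) + Comp C Z B S j (Comp C Z S B s f)"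
    by (simp add: Comp_simps assoc)
  also have "Comp C Z S A r f = 0"
    using A ij f ob Z idempotent_free_Comp_left unfolding radical_free_def by blast
  also have "Comp C Z S B s f = 0"
    using B ij f ob Z idempotent_free_Comp_left unfolding radical_free_def by blast
  finally show "f = 0"
    by (simp add: Comp_simps)
qed

section \<open>Matrices: the additive envelope as a linear category\<close>

abbreviation mat_scale :: "'a \<Rightarrow> (nat \<Rightarrow> nat \<Rightarrow> 'm) \<Rightarrow> nat \<Rightarrow> nat \<Rightarrow> 'm" where
  "mat_scale c f \<equiv> \<lambda>i j. scale c (f i j)"

definition mat_unit :: "nat \<Rightarrow> nat \<Rightarrow> 'm \<Rightarrow> nat \<Rightarrow> nat \<Rightarrow> 'm" where
  "mat_unit i j x = (\<lambda>k l. if k = i \<and> l = j then x else 0)"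

lemma vector_space_mat: "vector_space mat_scale"
  by unfold_locales (auto simp: fun_eq_iff scale_right_distrib scale_left_distrib)

lemma Comp_if_left: "Comp C X Y Z (if P then g else 0) f = (if P then Comp C X Y Z g f else 0)"
  by (simp add: Comp_simps)

lemma Comp_if_right: "Comp C X Y Z g (if P then f else 0) = (if P then Comp C X Y Z g f else 0)"
  by (simp add: Comp_simps)

lemma sum_fun_apply: "(\<Sum>k\<in>K. F k) x = (\<Sum>k\<in>K. F k x)"
  by (induction K rule: infinite_finite_induct) auto

lemma linear_category_additive_envelope: "linear_category (additive_envelope C) mat_scale"
proof -
  interpret mat: vector_space mat_scale
    by (rule vector_space_mat)
  interpret pair: vector_space_pair scale mat_scale
    by unfold_locales
  have "mat_unit i j x \<in> mat.span (mat_unit i j ` T)" if "x \<in> span T" for i j x T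
  proof -
    have "Vector_Spaces.linear scale mat_scale (mat_unit i j)"
      by (auto simp: Vector_Spaces.linear_iff mat_unit_def fun_eq_iff vector_space_axioms
          mat.vector_space_axioms)
    then show ?thesis
      using pair.linear_span_image[of "mat_unit i j" T] that by blast
  qed note unit_span = this
  have nth: "Xs ! i \<in> Ob C" if "Xs \<in> lists (Ob C)" "i < length Xs" for Xs i
    using that by (metis in_lists_conv_set nth_mem)
  show ?thesis
  proof (unfold_locales, goal_cases)
    case (1 X)
    then show ?case
      using nth[of X] by (auto simp: additive_envelope_def Ident_in_Hom zero_in_Hom)
  next
    case (2 X Y Z f g)
    then show ?case
      using nth[of X] nth[of Y] nth[of Z] unfolding additive_envelope_def
      by (auto intro!: sum_in_Hom Comp_in_Hom)
  next
    case (3 W X Y Z f g h)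
    show ?case
      unfolding additive_envelope_def
      by (auto simp: fun_eq_iff Comp_sum_left Comp_sum_right assoc intro: sum.swap)
  next
    case (4 X Y f)
    then show ?case
      using nth[of X] nth[of Y] unfolding additive_envelope_def
      by (auto simp: fun_eq_iff Comp_if_left Comp_Ident_left)
  next
    case (5 X Y f)
    then show ?case
      using nth[of X] nth[of Y] unfolding additive_envelope_def
      by (auto simp: fun_eq_iff Comp_if_right Comp_Ident_right)
  next
    case (6 X Y)
    then show ?case
      using nth[of X] nth[of Y] by (auto simp: additive_envelope_def zero_in_Hom)
  next
    case (7 X Y f g)
    then show ?case
      using nth[of X] nth[of Y] unfolding additive_envelope_def by (auto intro: add_in_Hom)
  next
    case (8 X Y f)
    then show ?case
      using nth[of X] nth[of Y] unfolding additive_envelope_def by (auto intro: uminus_in_Hom)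
  next
    case (9 X Y Z f g g')
    show ?case
      by (auto simp: additive_envelope_def fun_eq_iff Comp_simps sum.distrib)
  next
    case (10 X Y Z f f' g)
    show ?case
      by (auto simp: additive_envelope_def fun_eq_iff Comp_simps sum.distrib)
  next
    case (11 V Y Z h X g f)
    show ?case
      unfolding additive_envelope_def
      by (auto simp: fun_eq_iff Comp_sum_left Comp_sum_right assoc intro: sum.swap)
  next
    case (12 X Y f c)
    then show ?case
      using nth[of X] nth[of Y] unfolding additive_envelope_def by (auto intro: scale_in_Hom)
  next
    case 13
    show ?case
      by (auto simp: additive_envelope_def fun_eq_iff Comp_simps sum.distrib scale_sum_right)
  next
    case 14
    show ?case
      by (auto simp: additive_envelope_def fun_eq_iff Comp_simps sum.distrib scale_sum_right)
  next
    case 15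
    show ?case
      by (auto simp: additive_envelope_def fun_eq_iff Comp_simps sum.distrib scale_sum_right)
  next
    case 16
    show ?case
      by (auto simp: additive_envelope_def fun_eq_iff Comp_simps sum.distrib scale_sum_right)
  next
    case (17 Xs Ys)
    \<comment> \<open>The range conditions stand inside the existential so that \<open>T\<close> can
      be chosen for all index pairs at once. The elementary matrices with entries in the sets
      \<open>T i j\<close> then span the hom space.\<close>
    then have "\<forall>i j. \<exists>T. i < length Ys \<and> j < length Xs \<longrightarrow> finite T \<and> Hom C (Xs ! j) (Ys ! i) \<subseteq> span T"
      using nth[of Xs] nth[of Ys] Hom_finite_dim
      by (simp add: additive_envelope_def)
    then obtain T where T: "\<And>i j. i < length Ys \<Longrightarrow> j < length Xs \<Longrightarrow>
      finite (T i j) \<and> Hom C (Xs ! j) (Ys ! i) \<subseteq> span (T i j)"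
      by metis
    define B where "B = (\<Union>i<length Ys. \<Union>j<length Xs. mat_unit i j ` T i j)"
    have "f \<in> mat.span B" if f: "f \<in> Hom (additive_envelope C) Xs Ys" for f
    proof -
      have "f i j \<in> Hom C (Xs ! j) (Ys ! i)" if "i < length Ys" "j < length Xs" for i j
        using f that by (auto simp: additive_envelope_def)
      then have "mat_unit i j (f i j) \<in> mat.span B" if "i < length Ys" "j < length Xs" for i j
        using that T[OF that] mat.span_mono[of "mat_unit i j ` T i j" B]
          unit_span[of "f i j" "T i j" i j] unfolding B_def by blast
      then have "(\<Sum>i<length Ys. \<Sum>j<length Xs. mat_unit i j (f i j)) \<in> mat.span B"
        by (intro mat.span_sum) auto
      also have "(\<Sum>i<length Ys. \<Sum>j<length Xs. mat_unit i j (f i j)) = f"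
      proof (intro ext)
        fix k l
        have "(\<Sum>i<length Ys. \<Sum>j<length Xs. mat_unit i j (f i j)) k l =
            (\<Sum>i<length Ys. if k = i then \<Sum>j<length Xs. if l = j then f k j else 0 else 0)"
          unfolding sum_fun_apply mat_unit_def by (intro sum.cong refl) auto
        also have "\<dots> = f k l"
          using f by (auto simp: additive_envelope_def)
        finally show "(\<Sum>i<length Ys. \<Sum>j<length Xs. mat_unit i j (f i j)) k l = f k l" .
      qed
      finally show ?thesis .
    qed
    moreover have "finite B"
      unfolding B_def using T by auto
    ultimately show ?case
      by blast
  qed
qed

lemma additive_HomD:
  "\<lbrakk>f \<in> Hom (additive_envelope C) Xs Ys; i < length Ys; j < length Xs\<rbrakk>
    \<Longrightarrow> f i j \<in> Hom C (Xs ! j) (Ys ! i)"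
  by (auto simp: additive_envelope_def)

text \<open>Concatenation of lists is the biproduct, with block identity matrices. Since entries out
  of range are 0, the same matrix \<open>i\<close> serves as injection and as projection for
  \<open>Xs\<close>; \<open>j\<close> and \<open>s\<close> shift the index by the length of
  \<open>Xs\<close>.\<close>

lemma is_direct_sum_additive_envelope:
  assumes X: "Xs \<in> lists (Ob C)" and Y: "Ys \<in> lists (Ob C)"
  shows "is_direct_sum (additive_envelope C) [Xs, Ys] (Xs @ Ys)"
proof -
  let ?A = "additive_envelope C"
  interpret add: linear_category ?A mat_scale
    by (rule linear_category_additive_envelope)
  have nthX: "Xs ! i \<in> Ob C" if "i < length Xs" for i
    using that X by (metis in_lists_conv_set nth_mem)
  have nthY: "Ys ! i \<in> Ob C" if "i < length Ys" for i
    using that Y by (metis in_lists_conv_set nth_mem)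
  define i where "i = (\<lambda>k l. if k = l then if k < length Xs then Ident C (Xs ! k) else 0 else 0)"
  define j where "j = (\<lambda>k l. if k = length Xs + l then
    if l < length Ys then Ident C (Ys ! l) else 0 else 0)"
  define s where "s = (\<lambda>l k. if k = length Xs + l then
    if l < length Ys then Ident C (Ys ! l) else 0 else 0)"
  have "is_direct_sum ?A ([Xs] @ [Ys]) (Xs @ Ys)"
  proof (rule add.is_direct_sum_append[of _ i _ i j _ s])
    show "Xs @ Ys \<in> Ob ?A"
      using X Y by (auto simp: additive_envelope_def)
    show "i \<in> Hom ?A Xs (Xs @ Ys)" "i \<in> Hom ?A (Xs @ Ys) Xs"
      using nthX nthY
      by (auto simp: additive_envelope_def i_def nth_append Ident_in_Hom zero_in_Hom)
    show "j \<in> Hom ?A Ys (Xs @ Ys)" "s \<in> Hom ?A (Xs @ Ys) Ys"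
      using nthX nthY
      by (auto simp: additive_envelope_def j_def s_def nth_append Ident_in_Hom zero_in_Hom)
    show "Comp ?A Xs (Xs @ Ys) Xs i i = Ident ?A Xs"
      using nthX
      by (auto simp: additive_envelope_def i_def fun_eq_iff Comp_if_left Comp_simps
          nth_append Comp_Ident_left Ident_in_Hom)
    show "Comp ?A Ys (Xs @ Ys) Ys s j = Ident ?A Ys"
      using nthY
      by (auto simp: additive_envelope_def s_def j_def fun_eq_iff Comp_if_left Comp_simps
          nth_append Comp_Ident_left Ident_in_Hom)
    show "Comp ?A (Xs @ Ys) Xs (Xs @ Ys) i i +
        Comp ?A (Xs @ Ys) Ys (Xs @ Ys) j s =
        Ident ?A (Xs @ Ys)"
    proof (intro ext)
      fix k l
      have "(\<Sum>m<length Ys. Comp C ((Xs @ Ys) ! l) (Ys ! m) ((Xs @ Ys) ! k) (j k m) (s m l)) =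
         (if k = l \<and> length Xs \<le> k then Ident C (Ys ! (k - length Xs)) else 0)"
        if "k < length Xs + length Ys" "l < length Xs + length Ys"
      proof (cases "length Xs \<le> k")
        case True
        then have "(\<Sum>m<length Ys. Comp C ((Xs @ Ys) ! l) (Ys ! m) ((Xs @ Ys) ! k) (j k m) (s m l)) =
           (\<Sum>m<length Ys. if k - length Xs = m then
             Comp C ((Xs @ Ys) ! l) (Ys ! m) ((Xs @ Ys) ! k) (Ident C (Ys ! m)) (s m l) else 0)"
          by (intro sum.cong) (auto simp: j_def Comp_simps)
        also have "\<dots> = (if k = l then Ident C (Ys ! (k - length Xs)) else 0)"
          using that True nthY[of "k - length Xs"]
          by (auto simp: s_def Comp_simps nth_append Comp_Ident_left Ident_in_Hom)
        finally show ?thesis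
          using True by simp
      next
        case False
        then show ?thesis
          by (auto simp: j_def Comp_simps)
      qed
      then show "(Comp ?A (Xs @ Ys) Xs (Xs @ Ys) i i +
        Comp ?A (Xs @ Ys) Ys (Xs @ Ys) j s) k l =
        Ident ?A (Xs @ Ys) k l"
        using nthX
        by (auto simp: additive_envelope_def i_def Comp_if_left Comp_simps
          nth_append Comp_Ident_left Ident_in_Hom)
    qed
    have "Xs \<in> Ob ?A" "Ys \<in> Ob ?A"
      using X Y by (auto simp: additive_envelope_def)
    then show "is_direct_sum ?A [Xs] Xs" "is_direct_sum ?A [Ys] Ys"
      by (auto intro: add.is_direct_sum_singleton)
  qed
  then show ?thesis
    by simp
qed

lemma is_zero_object_additive_envelope: "is_zero_object (additive_envelope C) []"
proof -
  interpret add: linear_category "additive_envelope C" mat_scale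
    by (rule linear_category_additive_envelope)
  have "[] \<in> Ob (additive_envelope C)" "Ident (additive_envelope C) [] = 0"
    by (auto simp: additive_envelope_def fun_eq_iff)
  then show ?thesis
    using add.is_zero_object_iff by blast
qed

text \<open>Peeling off one summand at a time, in the target and then in the source, reduces the
  claim to 1 x 1 matrices, where composition is that of \<open>C\<close>.\<close>

lemma radical_free_additive_envelope:
  assumes rad: "\<And>X Y. X \<in> Ob C \<Longrightarrow> Y \<in> Ob C \<Longrightarrow> radical_free C X Y"
    and "Xs \<in> lists (Ob C)" and "Ys \<in> lists (Ob C)"
  shows "radical_free (additive_envelope C) Xs Ys"
proof -
  let ?A = "additive_envelope C"
  interpret add: linear_category ?A mat_scale
    by (rule linear_category_additive_envelope)
  have single: "radical_free ?A [x] [y]" if ob: "x \<in> Ob C" "y \<in> Ob C" for x y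
    unfolding radical_free_def
  proof (intro allI impI)
    fix f assume f: "idempotent_free ?A [x] [y] f"
    have unit: "Comp ?A [a] [b] [c] u v = mat_unit 0 0 (Comp C a b c (u 0 0) (v 0 0))"
      for a b c u v
      by (auto simp: additive_envelope_def mat_unit_def fun_eq_iff)
    have "idempotent_free C x y (f 0 0)"
      unfolding idempotent_free_def
    proof (intro conjI ballI impI)
      show "f 0 0 \<in> Hom C x y"
        using f additive_HomD[of f "[x]" "[y]" 0 0] by (simp add: idempotent_free_def)
      fix g assume g: "g \<in> Hom C y x"
      let ?p = "Comp C y x y (f 0 0) g"
      assume p: "Comp C y y y ?p ?p = ?p"
      have "mat_unit 0 0 g \<in> Hom ?A [y] [x]"
        using g by (auto simp: additive_envelope_def mat_unit_def)
      moreover have "Comp ?A [y] [x] [y] f (mat_unit 0 0 g) = mat_unit 0 0 ?p"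
        unfolding unit by (simp add: mat_unit_def)
      moreover have "Comp ?A [y] [y] [y] (mat_unit 0 0 ?p) (mat_unit 0 0 ?p) =
          mat_unit 0 0 ?p"
        unfolding unit by (simp add: mat_unit_def p)
      ultimately have "mat_unit 0 0 ?p = 0"
        using f unfolding idempotent_free_def by metis
      then show "?p = 0"
        by (auto simp: mat_unit_def fun_eq_iff split: if_splits)
    qed
    then have "f 0 0 = 0"
      using rad ob unfolding radical_free_def by blast
    moreover have "f i j = 0" if "i \<noteq> 0 \<or> j \<noteq> 0" for i j
      using f that by (auto simp: idempotent_free_def additive_envelope_def)
    ultimately show "f = 0"
      by (metis (no_types) ext zero_fun_apply)
  qed
  have lists: "Ob ?A = lists (Ob C)"
    by (simp add: additive_envelope_def)
  have zero: "radical_free ?A [] Zs" "radical_free ?A Zs []" for Zs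
    by (auto simp: radical_free_def idempotent_free_def additive_envelope_def fun_eq_iff)
  have row: "radical_free ?A [x] Ys" if "x \<in> Ob C" for x
    using \<open>Ys \<in> lists (Ob C)\<close>
  proof (induction Ys)
    case (Cons y Ys)
    then show ?case
      using add.radical_free_direct_sum_right[of "[x]" "[y]" Ys "y # Ys"] that single[of x y]
        is_direct_sum_additive_envelope[of "[y]" Ys] by (simp add: lists)
  qed (rule zero)
  show ?thesis
    using \<open>Xs \<in> lists (Ob C)\<close>
  proof (induction Xs)
    case (Cons x Xs)
    then show ?case
      using add.radical_free_direct_sum_left[of Ys "[x]" Xs "x # Xs"] row[of x]
        is_direct_sum_additive_envelope[of "[x]" Xs] \<open>Ys \<in> lists (Ob C)\<close> by (simp add: lists)
  qed (rule zero)
qed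

section \<open>The Karoubi envelope\<close>

lemma karoubi_HomD:
  assumes "(X, e) \<in> Ob (karoubi_envelope C)" "(Y, e') \<in> Ob (karoubi_envelope C)"
    "f \<in> Hom (karoubi_envelope C) (X, e) (Y, e')"
  shows "f \<in> Hom C X Y" "Comp C X Y Y e' f = f" "Comp C X X Y f e = f"
proof -
  have *: "Comp C X X X e e = e" "Comp C Y Y Y e' e' = e'" "Comp C X X Y (Comp C X Y Y e' f) e = f"
    using assms by (auto simp: karoubi_envelope_def)
  show "f \<in> Hom C X Y"
    using assms by (auto simp: karoubi_envelope_def)
  \<comment> \<open>As \<open>e\<close> and \<open>e'\<close> are idempotent, multiplying
    \<open>e' f e\<close> once more on either side changes nothing; the single condition on
    morphisms thus splits into two one-sided laws usable for rewriting.\<close>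
  have "Comp C X Y Y e' (Comp C X X Y (Comp C X Y Y e' f) e) = Comp C X X Y (Comp C X Y Y e' f) e"
    by (simp only: assoc *(2))
  then show "Comp C X Y Y e' f = f"
    unfolding *(3) .
  have "Comp C X X Y (Comp C X X Y (Comp C X Y Y e' f) e) e = Comp C X X Y (Comp C X Y Y e' f) e"
    by (simp only: assoc[symmetric] *(1))
  then show "Comp C X X Y f e = f"
    unfolding *(3) .
qed

lemma karoubi_HomI:
  assumes "f \<in> Hom C X Y" "Comp C X Y Y e' f = f" "Comp C X X Y f e = f"
  shows "f \<in> Hom (karoubi_envelope C) (X, e) (Y, e')"
  using assms by (auto simp: karoubi_envelope_def)

lemma karoubi_Ob_iff:
  "(X, e) \<in> Ob (karoubi_envelope C) \<longleftrightarrow> X \<in> Ob C \<and> e \<in> Hom C X X \<and> Comp C X X X e e = e"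
  by (simp add: karoubi_envelope_def)

lemma karoubi_Comp [simp]: "Comp (karoubi_envelope C) X Y Z = Comp C (fst X) (fst Y) (fst Z)"
  by (auto simp: karoubi_envelope_def split: prod.splits)

lemma karoubi_Ident [simp]: "Ident (karoubi_envelope C) X = snd X"
  by (auto simp: karoubi_envelope_def split: prod.splits)

lemma linear_category_karoubi_envelope: "linear_category (karoubi_envelope C) scale"
proof (unfold_locales, goal_cases)
  case (1 X)
  then show ?case
    by (cases X) (auto simp: karoubi_Ob_iff intro: karoubi_HomI)
next
  case (2 X Y Z f g)
  obtain X' x Y' y Z' z where [simp]: "X = (X', x)" "Y = (Y', y)" "Z = (Z', z)"
    by (metis prod.exhaust)
  note f = karoubi_HomD[of X' x Y' y f] and g = karoubi_HomD[of Y' y Z' z g]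
  show ?case
    using 2 f g
    by (auto intro!: karoubi_HomI Comp_in_Hom simp: karoubi_Ob_iff assoc)
       (simp add: assoc[symmetric])
next
  case (3 W X Y Z f g h)
  show ?case by (simp add: assoc)
next
  case (4 X Y f)
  then show ?case
    using karoubi_HomD[of "fst X" "snd X" "fst Y" "snd Y" f] by simp
next
  case (5 X Y f)
  then show ?case
    using karoubi_HomD[of "fst X" "snd X" "fst Y" "snd Y" f] by simp
next
  case (6 X Y)
  then show ?case
    by (auto simp: karoubi_envelope_def zero_in_Hom Comp_simps)
next
  case (7 X Y f g)
  then show ?case
    by (auto simp: karoubi_envelope_def Comp_simps intro: add_in_Hom)
next
  case (8 X Y f)
  have "Comp C (fst X) (fst X) (fst Y) (Comp C (fst X) (fst Y) (fst Y) (snd Y) (- f)) (snd X) =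
    - Comp C (fst X) (fst X) (fst Y) (Comp C (fst X) (fst Y) (fst Y) (snd Y) f) (snd X)"
    using Comp_simps(3)[where g = 0] Comp_simps(4)[where f = 0] by (simp add: Comp_simps)
  with 8 show ?case
    by (auto simp: karoubi_envelope_def intro: uminus_in_Hom)
next
  case (9 X Y Z f g g')
  show ?case by (simp add: Comp_simps)
next
  case (10 X Y Z f f' g)
  show ?case by (simp add: Comp_simps)
next
  case (11 V Y Z h X g f)
  show ?case by (simp add: assoc)
next
  case (12 X Y f c)
  then show ?case
    by (auto simp: karoubi_envelope_def Comp_simps intro: scale_in_Hom)
next
  case 13
  show ?case by (simp add: Comp_simps)
next
  case 14
  show ?case by (simp add: Comp_simps)
next
  case 15
  show ?case by (simp add: Comp_simps)
next
  case 16
  show ?case by (simp add: Comp_simps)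
next
  case (17 X Y)
  then show ?case
    using Hom_finite_dim[of "fst X" "fst Y"] by (force simp: karoubi_envelope_def)
qed

text \<open>Everything is inherited from \<open>C\<close> by inserting the idempotents: injections,
  projections and quasi-inverses are cut down until they satisfy the conditions on morphisms of the
  envelope.\<close>

theorem regular_category_karoubi_envelope:
  assumes zero: "\<exists>Z. is_zero_object C Z"
    and sums: "\<And>X Y. \<lbrakk>X \<in> Ob C; Y \<in> Ob C\<rbrakk> \<Longrightarrow> \<exists>S. is_direct_sum C [X, Y] S"
    and reg: "\<And>X Y f. \<lbrakk>X \<in> Ob C; Y \<in> Ob C; f \<in> Hom C X Y\<rbrakk> \<Longrightarrow> is_regular C X Y f"
  shows "regular_category (karoubi_envelope C) scale"
proof -
  interpret kar: linear_category "karoubi_envelope C" scale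
    by (rule linear_category_karoubi_envelope)
  show ?thesis
  proof (unfold_locales, goal_cases)
    case 1
    obtain Z where "Z \<in> Ob C"
      using zero by (auto simp: is_zero_object_def)
    then have "(Z, 0) \<in> Ob (karoubi_envelope C)"
      by (simp add: karoubi_Ob_iff Comp_simps zero_in_Hom)
    then show ?case
      using kar.is_zero_object_iff[of "(Z, 0)"] by auto
  next
    case (2 Xe Ye)
    obtain X e Y e' where [simp]: "Xe = (X, e)" "Ye = (Y, e')"
      by (metis prod.exhaust)
    have X: "X \<in> Ob C" "e \<in> Hom C X X" "Comp C X X X e e = e"
      and Y: "Y \<in> Ob C" "e' \<in> Hom C Y Y" "Comp C Y Y Y e' e' = e'"
      using 2 by (auto simp: karoubi_Ob_iff)
    obtain S where S: "is_direct_sum C [X, Y] S"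
      using sums X Y by blast
    then have ob: "S \<in> Ob C"
      by (simp add: is_direct_sum_def)
    obtain i j r s where h: "i \<in> Hom C X S" "j \<in> Hom C Y S" "r \<in> Hom C S X" "s \<in> Hom C S Y"
      "Comp C X S X r i = Ident C X" "Comp C Y S Y s j = Ident C Y"
      "Comp C X S Y s i = 0" "Comp C Y S X r j = 0"
      by (rule direct_sum_pairE[OF S])
    define i' r' j' s' where "i' = Comp C X X S i e" and "r' = Comp C S X X e r"
      and "j' = Comp C Y Y S j e'" and "s' = Comp C S Y Y e' s"
    have H: "i' \<in> Hom C X S" "r' \<in> Hom C S X" "j' \<in> Hom C Y S" "s' \<in> Hom C S Y"
      unfolding i'_def r'_def j'_def s'_def using X Y ob h by (auto intro: Comp_in_Hom)
    have ie: "Comp C X X S i' e = i'" "Comp C S X X e r' = r'"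
      "Comp C Y Y S j' e' = j'" "Comp C S Y Y e' s' = s'"
      unfolding i'_def r'_def j'_def s'_def using X(3) Y(3) by (metis assoc)+
    have mid: "Comp C V S W (Comp C S A W a b) (Comp C V B S c d) =
      Comp C V A W a (Comp C V B A (Comp C B S A b c) d)" for V W A B a b c d
      by (simp add: assoc)
    have ri: "Comp C X S X r' i' = e" "Comp C Y S Y s' j' = e'"
      "Comp C X S Y s' i' = 0" "Comp C Y S X r' j' = 0"
      unfolding i'_def r'_def j'_def s'_def mid h using X Y
      by (simp_all add: Comp_simps Comp_Ident_left)
    \<comment> \<open>The direct sum of \<open>(X, e)\<close> and \<open>(Y, e')\<close> lives on
      \<open>S\<close>, cut by the idempotent \<open>i e r + j e' s\<close>.\<close>
    define p where "p = Comp C S X S i' r' + Comp C S Y S j' s'"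
    have p: "Comp C X S S p i' = i'" "Comp C S S X r' p = r'"
      "Comp C Y S S p j' = j'" "Comp C S S Y s' p = s'"
    proof -
      show "Comp C X S S p i' = i'" "Comp C Y S S p j' = j'"
        unfolding p_def Comp_simps assoc[symmetric] ri ie by (simp_all add: Comp_simps)
      show "Comp C S S X r' p = r'" "Comp C S S Y s' p = s'"
        unfolding p_def Comp_simps assoc ri ie by (simp_all add: Comp_simps)
    qed
    have "Comp C S S S p (Comp C S X S i' r' + Comp C S Y S j' s') =
        Comp C S X S i' r' + Comp C S Y S j' s'"
      unfolding Comp_simps assoc p ..
    then have "Comp C S S S p p = p"
      unfolding p_def[symmetric] .
    moreover have "p \<in> Hom C S S"
      unfolding p_def using X Y ob H by (intro Hom_intros)
    ultimately have Sp: "(S, p) \<in> Ob (karoubi_envelope C)"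
      using ob by (simp add: karoubi_Ob_iff)
    have "is_direct_sum (karoubi_envelope C) ([Xe] @ [Ye]) (S, p)"
      by (rule kar.is_direct_sum_append[OF Sp, where i = i' and r = r' and j = j' and s = s'])
        (use 2 H ie ri p in \<open>auto intro!: karoubi_HomI kar.is_direct_sum_singleton simp: p_def[symmetric]\<close>)
    then show ?case
      by auto
  next
    case (3 Xe p)
    obtain X e where [simp]: "Xe = (X, e)"
      by fastforce
    have p: "p \<in> Hom C X X" "Comp C X X X e p = p" "Comp C X X X p e = p"
      using karoubi_HomD[of X e X e p] 3 by auto
    have X: "X \<in> Ob C" "Comp C X X X p p = p"
      using 3 by (auto simp: karoubi_Ob_iff)
    \<comment> \<open>The image of \<open>p\<close> is the object \<open>(X, p)\<close>. Its
      identity is \<open>p\<close>, so \<open>p\<close> is at once the inclusion and the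
      projection.\<close>
    show ?case
      unfolding splits_def
      by (rule bexI[of _ "(X, p)"], rule bexI[of _ p], rule bexI[of _ p])
        (use X p in \<open>auto intro!: karoubi_HomI simp: karoubi_Ob_iff\<close>)
  next
    case (4 Xe Ye f)
    obtain X e Y e' where [simp]: "Xe = (X, e)" "Ye = (Y, e')"
      by (metis prod.exhaust)
    have X: "X \<in> Ob C" "e \<in> Hom C X X" "Comp C X X X e e = e"
      and Y: "Y \<in> Ob C" "e' \<in> Hom C Y Y" "Comp C Y Y Y e' e' = e'"
      using 4 by (auto simp: karoubi_Ob_iff)
    have f: "f \<in> Hom C X Y" "Comp C X Y Y e' f = f" "Comp C X X Y f e = f"
      using karoubi_HomD[of X e Y e' f] 4 by auto
    obtain g where g: "g \<in> Hom C Y X" "Comp C X Y Y (Comp C Y X Y f g) f = f"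
      using reg X Y f(1) unfolding is_regular_def by blast
    \<comment> \<open>A quasi-inverse \<open>g\<close> in \<open>C\<close> need not be a morphism of
      the envelope. Its truncation \<open>e g e'\<close> is one, and \<open>f e = f\<close> and
      \<open>e' f = f\<close> preserve \<open>f g' f = f\<close>.\<close>
    define g' where "g' = Comp C Y Y X (Comp C Y X X e g) e'"
    have "g' \<in> Hom (karoubi_envelope C) Ye Xe"
    proof (simp, rule karoubi_HomI)
      show "g' \<in> Hom C Y X"
        unfolding g'_def using X Y g by (intro Hom_intros)
      show "Comp C Y X X e g' = g'"
        unfolding g'_def by (simp add: assoc X)
      show "Comp C Y Y X g' e' = g'"
        unfolding g'_def by (simp add: assoc[symmetric] Y)
    qed
    moreover have "Comp C X Y Y (Comp C Y X Y f g') f =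
        Comp C X Y Y (Comp C Y X Y (Comp C X X Y f e) g) (Comp C X Y Y e' f)"
      unfolding g'_def by (simp add: assoc)
    ultimately show ?case
      unfolding is_regular_def by (auto simp: f g)
  qed
qed

theorem semisimple_karoubi_additive_envelope:
  assumes "\<And>X Y. X \<in> Ob C \<Longrightarrow> Y \<in> Ob C \<Longrightarrow> radical_free C X Y"
  shows "semisimple_category (karoubi_envelope (additive_envelope C))"
proof -
  interpret add: linear_category "additive_envelope C" mat_scale
    by (rule linear_category_additive_envelope)
  have lists: "Ob (additive_envelope C) = lists (Ob C)"
    by (simp add: additive_envelope_def)
  interpret kar: regular_category "karoubi_envelope (additive_envelope C)" mat_scale
  proof (rule add.regular_category_karoubi_envelope)
    show "\<exists>Z. is_zero_object (additive_envelope C) Z"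
      using is_zero_object_additive_envelope by blast
    show "\<exists>S. is_direct_sum (additive_envelope C) [Xs, Ys] S"
      if "Xs \<in> Ob (additive_envelope C)" "Ys \<in> Ob (additive_envelope C)" for Xs Ys
      using is_direct_sum_additive_envelope that unfolding lists by blast
    show "is_regular (additive_envelope C) Xs Ys f"
      if "Xs \<in> Ob (additive_envelope C)" "Ys \<in> Ob (additive_envelope C)"
        "f \<in> Hom (additive_envelope C) Xs Ys" for Xs Ys f
      using add.is_regular_if_radical_free radical_free_additive_envelope assms that
      unfolding lists by blast
  qed
  show ?thesis
    by (rule kar.semisimple)
qed

end

section \<open>Counting colourings\<close>

text \<open>
  For a natural number \<open>t = N\<close>, partitions act as matrices on functions with values in
  \<open>{..<N}\<close>; identities between partitions and exponents of \<open>t\<close> can be read off from these matrices.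
\<close>

definition constant_on_parts :: "('b \<Rightarrow> 'c) \<Rightarrow> 'b set set \<Rightarrow> bool" where
  "constant_on_parts v P \<longleftrightarrow> (\<forall>B\<in>P. \<forall>x\<in>B. \<forall>y\<in>B. v x = v y)"

definition same_part :: "'b set set \<Rightarrow> ('b \<times> 'b) set" where
  "same_part P = {(x, y). \<exists>B\<in>P. x \<in> B \<and> y \<in> B}"

lemma constant_on_parts_iff_same_part:
  "constant_on_parts v P \<longleftrightarrow> (\<forall>(x, y)\<in>same_part P. v x = v y)"
  by (auto simp: constant_on_parts_def same_part_def)

lemma constant_on_parts_cong:
  "\<lbrakk>\<And>x. x \<in> \<Union>P \<Longrightarrow> v x = w x\<rbrakk> \<Longrightarrow> constant_on_parts v P \<longleftrightarrow> constant_on_parts w P"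
  unfolding constant_on_parts_def by (metis UnionI)

lemma quotient_same_part: "partition_on V P \<Longrightarrow> V // same_part P = P"
  unfolding same_part_def by (rule partition_on_eq_quotient)

lemma equiv_same_part: "partition_on V P \<Longrightarrow> equiv V (same_part P)"
  unfolding same_part_def by (rule equiv_partition_on)

lemma partition_part_unique:
  "\<lbrakk>partition_on V P; B \<in> P; D \<in> P; x \<in> B; x \<in> D\<rbrakk> \<Longrightarrow> B = D"
  using partition_onD2[of V P] by (auto simp: disjoint_def)

text \<open>The indicator function of the part of \<open>Q\<close> containing \<open>x\<close> is
  constant on the parts of \<open>Q\<close>, hence on those of \<open>P\<close>, so \<open>y\<close>
  lies in the same part of \<open>Q\<close>. It has two values, which is why all later identities of
  partitions are tested with two colours only.\<close>

lemma same_part_subset_if_colourings: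
  assumes P: "partition_on V P" and Q: "partition_on V Q"
    and imp: "\<And>v. v \<in> V \<rightarrow> {..<2::nat} \<Longrightarrow> constant_on_parts v Q \<Longrightarrow> constant_on_parts v P"
  shows "same_part P \<subseteq> same_part Q"
proof clarify
  fix x y assume "(x, y) \<in> same_part P"
  then obtain B where B: "B \<in> P" "x \<in> B" "y \<in> B"
    by (auto simp: same_part_def)
  then obtain D where D: "D \<in> Q" "x \<in> D"
    using partition_onD1[OF P] partition_onD1[OF Q] by blast
  define v where "v z = (if z \<in> D then 1 else 0 :: nat)" for z
  have "constant_on_parts v Q"
    unfolding constant_on_parts_def v_def using partition_part_unique[OF Q _ D(1)] by metis
  then have "constant_on_parts v P"
    by (rule imp[rotated]) (auto simp: v_def)
  then have "v x = v y"
    using B unfolding constant_on_parts_def by blast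
  then show "(x, y) \<in> same_part Q"
    using D by (auto simp: v_def same_part_def split: if_splits)
qed

lemma partition_eqI_colourings:
  assumes "partition_on V P" "partition_on V Q"
    and "\<And>v. v \<in> V \<rightarrow> {..<2::nat} \<Longrightarrow> constant_on_parts v P \<longleftrightarrow> constant_on_parts v Q"
  shows "P = Q"
proof -
  have "same_part P = same_part Q"
    using same_part_subset_if_colourings[of V] assms by blast
  then show ?thesis
    using quotient_same_part assms(1,2) by metis
qed

text \<open>A colouring constant on parts is a function on the parts. A part meeting
  \<open>U\<close> has its colour forced, if \<open>u\<close> prescribes only one there; each of the
  others contributes a free factor \<open>N\<close>.\<close>

lemma card_colourings_extending:
  assumes P: "partition_on V P" and V: "finite V" and U: "U \<subseteq> V"
    and u: "u \<in> U \<rightarrow> {..<N::nat}"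
  shows "card {v \<in> V \<rightarrow>\<^sub>E {..<N}. constant_on_parts v P \<and> (\<forall>x\<in>U. v x = u x)} =
    (if \<forall>B\<in>P. \<forall>x\<in>B \<inter> U. \<forall>y\<in>B \<inter> U. u x = u y then N ^ card {B \<in> P. B \<inter> U = {}} else 0)"
    (is "card ?S = (if ?c then _ else _)")
proof (cases ?c)
  case False
  then have "?S = {}"
    by (force simp: constant_on_parts_def)
  with False show ?thesis
    by (simp only: card.empty if_False)
next
  case True
  define M where "M = {B \<in> P. B \<inter> U = {}}"
  define part where "part x = (THE B. B \<in> P \<and> x \<in> B)" for x
  have part: "part x = B" if "B \<in> P" "x \<in> B" for x B
    unfolding part_def by (rule the_equality) (use that partition_part_unique[OF P] in auto)
  have part_mem: "part x \<in> P" "x \<in> part x" if "x \<in> V" for x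
    using that part partition_onD1[OF P] by auto
  have nonempty: "(SOME x. x \<in> B) \<in> B" if "B \<in> P" for B
    using that partition_onD3[OF P] by (metis some_in_eq)
  have sub: "B \<subseteq> V" if "B \<in> P" for B
    using that partition_onD1[OF P] by blast
  \<comment> \<open>A point of \<open>U\<close> in the part, whose prescribed colour becomes the
    colour of the whole part.\<close>
  define rep where "rep B = (SOME y. y \<in> B \<inter> U)" for B
  have rep: "rep B \<in> B \<inter> U" if "B \<in> P" "B \<notin> M" for B
  proof -
    have "B \<inter> U \<noteq> {}"
      using that by (auto simp: M_def)
    then show ?thesis
      unfolding rep_def by (simp only: some_in_eq not_False_eq_True)
  qed
  have "bij_betw (\<lambda>v. \<lambda>B\<in>M. v (SOME x. x \<in> B)) ?S (M \<rightarrow>\<^sub>E {..<N})"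
  proof (rule bij_betw_byWitness[where
        f' = "\<lambda>h. \<lambda>x\<in>V. if part x \<in> M then h (part x) else u (rep (part x))"])
    show "\<forall>v\<in>?S. (\<lambda>x\<in>V. if part x \<in> M then (\<lambda>B\<in>M. v (SOME x. x \<in> B)) (part x)
        else u (rep (part x))) = v"
    proof (intro ballI ext)
      fix v x assume v: "v \<in> ?S"
      show "(\<lambda>x\<in>V. if part x \<in> M then (\<lambda>B\<in>M. v (SOME x. x \<in> B)) (part x)
        else u (rep (part x))) x = v x"
      proof (cases "x \<in> V")
        case True
        note pm = part_mem[OF True]
        have "constant_on_parts v P"
          using v[unfolded mem_Collect_eq, THEN conjunct2, THEN conjunct1] .
        then have eq: "v y = v x" if "y \<in> part x" for y
          using that pm unfolding constant_on_parts_def by metis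
        have "v (SOME y. y \<in> part x) = v x"
          by (intro eq nonempty pm(1))
        moreover have "part x \<notin> M \<Longrightarrow> v (rep (part x)) = v x"
          using rep[OF pm(1)] by (intro eq) simp
        moreover have "\<forall>x\<in>U. v x = u x"
          using v[unfolded mem_Collect_eq, THEN conjunct2, THEN conjunct2] .
        then have "part x \<notin> M \<Longrightarrow> u (rep (part x)) = v (rep (part x))"
          using rep[OF pm(1)] by simp
        ultimately show ?thesis
          using True by (cases "part x \<in> M") simp_all
      next
        case False
        then show ?thesis
          using v by (auto simp: PiE_def extensional_def)
      qed
    qed
    show "\<forall>h\<in>M \<rightarrow>\<^sub>E {..<N}. (\<lambda>B\<in>M. (\<lambda>x\<in>V. if part x \<in> M then h (part x)
        else u (rep (part x))) (SOME x. x \<in> B)) = h"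
    proof (intro ballI ext)
      fix h B assume h: "h \<in> M \<rightarrow>\<^sub>E {..<N}"
      show "(\<lambda>B\<in>M. (\<lambda>x\<in>V. if part x \<in> M then h (part x)
        else u (rep (part x))) (SOME x. x \<in> B)) B = h B"
      proof (cases "B \<in> M")
        case True
        then have "B \<in> P"
          by (simp add: M_def)
        then show ?thesis
          using True nonempty[of B] part[of B "SOME x. x \<in> B"] sub[of B] by auto
      next
        case False
        then show ?thesis
          using h by (auto simp: PiE_def extensional_def)
      qed
    qed
    show "(\<lambda>v. \<lambda>B\<in>M. v (SOME x. x \<in> B)) ` ?S \<subseteq> M \<rightarrow>\<^sub>E {..<N}"
    proof (intro image_subsetI restrict_PiE_iff[THEN iffD2] ballI)
      fix v B assume "v \<in> ?S" "B \<in> M"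
      then show "v (SOME x. x \<in> B) \<in> {..<N}"
        using nonempty[of B] sub[of B] by (auto simp: M_def PiE_def Pi_def)
    qed
    show "(\<lambda>h. \<lambda>x\<in>V. if part x \<in> M then h (part x) else u (rep (part x))) `
        (M \<rightarrow>\<^sub>E {..<N}) \<subseteq> ?S"
    proof (intro image_subsetI CollectI conjI ballI restrict_PiE_iff[THEN iffD2])
      fix h assume h: "h \<in> M \<rightarrow>\<^sub>E {..<N}"
      let ?v = "\<lambda>x\<in>V. if part x \<in> M then h (part x) else u (rep (part x))"
      show "(if part x \<in> M then h (part x) else u (rep (part x))) \<in> {..<N}" if "x \<in> V" for x
        using h u rep[OF part_mem(1)[OF that]] by (auto simp: PiE_def Pi_def)
      show "constant_on_parts ?v P"
        unfolding constant_on_parts_def using part sub by (auto simp: subset_iff)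
      show "?v x = u x" if x: "x \<in> U" for x
      proof -
        have pm: "part x \<in> P" "x \<in> part x"
          using part_mem x U by auto
        then have "part x \<notin> M"
          using x by (auto simp: M_def)
        moreover from this have "u (rep (part x)) = u x"
          using True[rule_format, OF pm(1), of "rep (part x)" x] rep[OF pm(1)] pm(2) x by blast
        ultimately show ?thesis
          using x U by auto
      qed
    qed
  qed
  then have "card ?S = card (M \<rightarrow>\<^sub>E {..<N})"
    by (rule bij_betw_same_card)
  also have "\<dots> = N ^ card M"
  proof (subst card_funcsetE)
    show "finite M"
      unfolding M_def using finite_elements[OF V P] by simp
  qed simp
  finally show ?thesis
    unfolding M_def if_P[OF True] .
qed

section \<open>Composition of partitions as matrix multiplication\<close>

lemma finite_partitions: "finite (partitions n m)"
  unfolding partitions_def by (intro finitely_many_partition_on) auto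

lemma partitions_iff: "\<pi> \<in> partitions n m \<longleftrightarrow> partition_on ({1..n} <+> {1..m}) \<pi>"
  by (simp add: partitions_def)

abbreviation glued_vertices :: "nat \<Rightarrow> nat \<Rightarrow> nat \<Rightarrow> glued_vertex set" where
  "glued_vertices n m l \<equiv> Source ` {1..n} \<union> Middle ` {1..m} \<union> Target ` {1..l}"

lemma Union_glued_blocks:
  assumes "\<pi> \<in> partitions n m" "\<mu> \<in> partitions m l"
  shows "\<Union> (glued_blocks \<mu> \<pi>) = glued_vertices n m l"
proof -
  have "\<Union> (glued_blocks \<mu> \<pi>) =
      case_sum Source Middle ` \<Union>\<pi> \<union> case_sum Middle Target ` \<Union>\<mu>"
    unfolding glued_blocks_def by blast
  also have "\<dots> = case_sum Source Middle ` ({1..n} <+> {1..m}) \<union>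
      case_sum Middle Target ` ({1..m} <+> {1..l})"
    using assms[unfolded partitions_iff, THEN partition_onD1] by simp
  also have "\<dots> = glued_vertices n m l"
    by (force simp: Plus_def image_Un image_image)
  finally show ?thesis .
qed

text \<open>The reflexive closure relates also vertices outside the glued graph to themselves, so it
  is not an equivalence on the vertex set \<open>?V\<close>. Adjacency never leaves
  \<open>?V\<close>, hence intersecting with \<open>?V \<times> ?V\<close> keeps the classes of its
  elements.\<close>

lemma partition_on_glued:
  assumes "\<pi> \<in> partitions n m" "\<mu> \<in> partitions m l"
  shows "partition_on (glued_vertices n m l) (\<mu> \<star> \<pi>)"
proof -
  let ?V = "glued_vertices n m l"
  let ?R = "(glued_adjacency \<mu> \<pi>)\<^sup>*"
  have adj: "glued_adjacency \<mu> \<pi> \<subseteq> ?V \<times> ?V"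
    unfolding Union_glued_blocks[OF assms, symmetric] glued_adjacency_def by blast
  have "sym (glued_adjacency \<mu> \<pi>)"
    by (auto simp: sym_def glued_adjacency_def)
  then have R: "sym ?R" "trans ?R"
    by (auto simp: sym_rtrancl trans_rtrancl)
  have closed: "y \<in> ?V" if "(x, y) \<in> ?R" "x \<in> ?V" for x y
    using that by induction (use adj in auto)
  have "equiv ?V (?R \<inter> ?V \<times> ?V)"
  proof (rule equivI)
    show "?R \<inter> ?V \<times> ?V \<subseteq> ?V \<times> ?V" "refl_on ?V (?R \<inter> ?V \<times> ?V)"
      by (auto simp: refl_on_def)
    show "sym (?R \<inter> ?V \<times> ?V)"
      using R(1) by (intro symI) (blast dest: symD)
    show "trans (?R \<inter> ?V \<times> ?V)"
      using R(2) by (intro transI) (blast dest: transD)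
  qed
  then have "partition_on ?V (?V // (?R \<inter> ?V \<times> ?V))"
    by (rule partition_on_quotient)
  also have "?V // (?R \<inter> ?V \<times> ?V) = ?V // ?R"
  proof -
    have "(?R \<inter> ?V \<times> ?V) `` {x} = ?R `` {x}" if "x \<in> ?V" for x
      using closed that by blast
    then show ?thesis
      unfolding quotient_def by (intro SUP_cong) auto
  qed
  finally show ?thesis
    unfolding glued_partition_def Union_glued_blocks[OF assms] .
qed

text \<open>Equality of colours propagates along paths, so constancy on components amounts to
  constancy on the glued blocks, each of which comes from one of the two partitions.\<close>

lemma constant_on_glued_iff:
  "constant_on_parts v (\<mu> \<star> \<pi>) \<longleftrightarrow>
    constant_on_parts (\<lambda>x. v (case_sum Source Middle x)) \<pi> \<and>
    constant_on_parts (\<lambda>x. v (case_sum Middle Target x)) \<mu>"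
proof -
  have "constant_on_parts v (\<mu> \<star> \<pi>) \<longleftrightarrow> constant_on_parts v (glued_blocks \<mu> \<pi>)"
  proof
    assume c: "constant_on_parts v (\<mu> \<star> \<pi>)"
    show "constant_on_parts v (glued_blocks \<mu> \<pi>)"
      unfolding constant_on_parts_def
    proof (intro ballI)
      fix B x y assume B: "B \<in> glued_blocks \<mu> \<pi>" "x \<in> B" "y \<in> B"
      then have "(glued_adjacency \<mu> \<pi>)\<^sup>* `` {x} \<in> \<mu> \<star> \<pi>"
        unfolding glued_partition_def by (intro quotientI) auto
      moreover have "(x, y) \<in> glued_adjacency \<mu> \<pi>"
        using B by (auto simp: glued_adjacency_def)
      then have "x \<in> (glued_adjacency \<mu> \<pi>)\<^sup>* `` {x}" "y \<in> (glued_adjacency \<mu> \<pi>)\<^sup>* `` {x}"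
        by auto
      ultimately show "v x = v y"
        using c unfolding constant_on_parts_def by fast
    qed
  next
    assume c: "constant_on_parts v (glued_blocks \<mu> \<pi>)"
    have "v y = v x" if "(x, y) \<in> (glued_adjacency \<mu> \<pi>)\<^sup>*" for x y
      using that
    proof induction
      case (step y z)
      then show ?case
        using c by (fastforce simp: constant_on_parts_def glued_adjacency_def)
    qed auto
    note const = this
    show "constant_on_parts v (\<mu> \<star> \<pi>)"
      unfolding constant_on_parts_def
    proof (intro ballI)
      fix B x y assume "B \<in> \<mu> \<star> \<pi>" "x \<in> B" "y \<in> B"
      then obtain z where "(z, x) \<in> (glued_adjacency \<mu> \<pi>)\<^sup>*" "(z, y) \<in> (glued_adjacency \<mu> \<pi>)\<^sup>*"
        unfolding glued_partition_def by (auto elim!: quotientE)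
      then show "v x = v y"
        using const[of z x] const[of z y] by simp
    qed
  qed
  also have "\<dots> \<longleftrightarrow> constant_on_parts (\<lambda>x. v (case_sum Source Middle x)) \<pi> \<and>
    constant_on_parts (\<lambda>x. v (case_sum Middle Target x)) \<mu>"
    by (simp add: constant_on_parts_def glued_blocks_def ball_Un)
  finally show ?thesis .
qed

lemma product_in_partitions:
  assumes "\<pi> \<in> partitions n m" "\<mu> \<in> partitions m l"
  shows "\<mu> \<cdot> \<pi> \<in> partitions n l"
proof -
  have "case_sum Source Target -` glued_vertices n m l = {1..n} <+> {1..l}"
    by (auto simp: Plus_def split: sum.splits)
  then show ?thesis
    using partition_on_vimage[OF partition_on_glued[OF assms], of "case_sum Source Target"]
    by (simp add: partitions_iff partition_product_def)
qed

abbreviation colourings :: "nat \<Rightarrow> nat \<Rightarrow> (nat \<Rightarrow> nat) set" where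
  "colourings N n \<equiv> {1..n} \<rightarrow>\<^sub>E {..<N}"

lemma finite_colourings: "finite (colourings N n)"
  by (intro finite_PiE) auto

text \<open>For \<open>t = N\<close> this is the matrix of \<open>\<pi>\<close> under the standard
  functor to representations of the symmetric group on \<open>N\<close> letters, which sends
  \<open>[n]\<close> to the n-th tensor power of the permutation representation.\<close>

definition matrix_entry :: "vertex_partition \<Rightarrow> (nat \<Rightarrow> nat) \<Rightarrow> (nat \<Rightarrow> nat) \<Rightarrow> nat" where
  "matrix_entry \<pi> i j = of_bool (constant_on_parts (case_sum i j) \<pi>)"

text \<open>With the outer colours \<open>i\<close> and \<open>k\<close> fixed, the sum counts the
  colourings of the middle vertices that extend them to a colouring constant on the parts of
  \<open>\<mu> \<star> \<pi>\<close>. Parts meeting the outside decide whether there is any; each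
  middle part gives a factor \<open>N\<close>.\<close>

lemma sum_matrix_entry_mult:
  assumes \<pi>: "\<pi> \<in> partitions n m" and \<mu>: "\<mu> \<in> partitions m l"
    and i: "i \<in> {1..n} \<rightarrow> {..<N}" and k: "k \<in> {1..l} \<rightarrow> {..<N}"
  shows "(\<Sum>j\<in>colourings N m. matrix_entry \<pi> i j * matrix_entry \<mu> j k) =
    N ^ middle_parts \<mu> \<pi> * matrix_entry (\<mu> \<cdot> \<pi>) i k"
proof -
  let ?V = "glued_vertices n m l"
  let ?U = "Source ` {1..n} \<union> Target ` {1..l}"
  define glue where "glue j = (\<lambda>x. case x of Source a \<Rightarrow> i a | Middle b \<Rightarrow> j b | Target c \<Rightarrow> k c)" for j
  \<comment> \<open>The colour 0 on middle vertices is a dummy, as \<open>?u\<close> is only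
    evaluated on the outer vertices \<open>?U\<close>.\<close>
  let ?u = "glue (\<lambda>_. 0)"
  let ?S = "{v \<in> ?V \<rightarrow>\<^sub>E {..<N}. constant_on_parts v (\<mu> \<star> \<pi>) \<and> (\<forall>x\<in>?U. v x = ?u x)}"
  let ?J = "{j \<in> colourings N m. constant_on_parts (case_sum i j) \<pi> \<and>
     constant_on_parts (case_sum j k) \<mu>}"
  note part = partition_on_glued[OF \<pi> \<mu>]
  have const: "constant_on_parts (\<lambda>x\<in>?V. glue j x) (\<mu> \<star> \<pi>) \<longleftrightarrow>
      constant_on_parts (case_sum i j) \<pi> \<and> constant_on_parts (case_sum j k) \<mu>" for j
  proof -
    have "constant_on_parts (\<lambda>x\<in>?V. glue j x) (\<mu> \<star> \<pi>) \<longleftrightarrow> constant_on_parts (glue j) (\<mu> \<star> \<pi>)"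
      by (rule constant_on_parts_cong) (simp only: partition_onD1[OF part, symmetric] restrict_apply if_True)
    moreover have "(\<lambda>x. glue j (case_sum Source Middle x)) = case_sum i j"
      "(\<lambda>x. glue j (case_sum Middle Target x)) = case_sum j k"
      by (auto simp: fun_eq_iff glue_def split: sum.splits)
    ultimately show ?thesis
      by (simp add: constant_on_glued_iff)
  qed
  have "bij_betw (\<lambda>j. \<lambda>x\<in>?V. glue j x) ?J ?S"
  proof (rule bij_betw_byWitness[where f' = "\<lambda>v. \<lambda>b\<in>{1..m}. v (Middle b)"])
    have ext: "(\<lambda>b\<in>{1..m}. (\<lambda>x\<in>?V. glue j x) (Middle b)) = j" if "j \<in> colourings N m" for j
      using that by (auto simp: fun_eq_iff glue_def PiE_def extensional_def)
    then show "\<forall>j\<in>?J. (\<lambda>b\<in>{1..m}. (\<lambda>x\<in>?V. glue j x) (Middle b)) = j"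
      by blast
    have ext': "(\<lambda>x\<in>?V. glue (\<lambda>b\<in>{1..m}. v (Middle b)) x) = v"
      if "v \<in> ?V \<rightarrow>\<^sub>E {..<N}" "\<forall>x\<in>?U. v x = ?u x" for v
    proof
      fix x show "(\<lambda>x\<in>?V. glue (\<lambda>b\<in>{1..m}. v (Middle b)) x) x = v x"
        using that by (cases x) (auto simp: glue_def PiE_def extensional_def)
    qed
    show "\<forall>v\<in>?S. (\<lambda>x\<in>?V. glue (\<lambda>b\<in>{1..m}. v (Middle b)) x) = v"
      by (intro ballI ext') simp_all
    show "(\<lambda>j. \<lambda>x\<in>?V. glue j x) ` ?J \<subseteq> ?S"
    proof (intro image_subsetI CollectI conjI)
      fix j assume j: "j \<in> ?J"
      show "(\<lambda>x\<in>?V. glue j x) \<in> ?V \<rightarrow>\<^sub>E {..<N}"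
        using j i k by (auto simp: glue_def PiE_def Pi_def)
      show "constant_on_parts (\<lambda>x\<in>?V. glue j x) (\<mu> \<star> \<pi>)"
        using j const by blast
      show "\<forall>x\<in>?U. (\<lambda>x\<in>?V. glue j x) x = ?u x"
        by (auto simp: glue_def)
    qed
    show "(\<lambda>v. \<lambda>b\<in>{1..m}. v (Middle b)) ` ?S \<subseteq> ?J"
    proof (intro image_subsetI CollectI conjI)
      fix v assume v: "v \<in> ?S"
      note v' = conjunct1[OF v[unfolded mem_Collect_eq]]
        conjunct2[OF conjunct2[OF v[unfolded mem_Collect_eq]]]
        conjunct1[OF conjunct2[OF v[unfolded mem_Collect_eq]]]
      show "(\<lambda>b\<in>{1..m}. v (Middle b)) \<in> colourings N m"
        using v'(1) by (auto simp: PiE_def Pi_def)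
      show "constant_on_parts (case_sum i (\<lambda>b\<in>{1..m}. v (Middle b))) \<pi>"
        "constant_on_parts (case_sum (\<lambda>b\<in>{1..m}. v (Middle b)) k) \<mu>"
        using const[of "\<lambda>b\<in>{1..m}. v (Middle b)"] v'(3) unfolding ext'[OF v'(1,2)] by blast+
    qed
  qed
  then have "card ?J = card ?S"
    by (rule bij_betw_same_card)
  also have "\<dots> = (if \<forall>B\<in>\<mu> \<star> \<pi>. \<forall>x\<in>B \<inter> ?U. \<forall>y\<in>B \<inter> ?U. ?u x = ?u y
     then N ^ card {B \<in> \<mu> \<star> \<pi>. B \<inter> ?U = {}} else 0)"
    by (rule card_colourings_extending[OF part]) (use i k in \<open>auto simp: glue_def\<close>)
  also have "(\<forall>B\<in>\<mu> \<star> \<pi>. \<forall>x\<in>B \<inter> ?U. \<forall>y\<in>B \<inter> ?U. ?u x = ?u y) \<longleftrightarrow>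
      constant_on_parts (case_sum i k) (\<mu> \<cdot> \<pi>)"
  proof -
    have sub: "B \<subseteq> ?V" if "B \<in> \<mu> \<star> \<pi>" for B
      using that partition_onD1[OF part] by blast
    have U: "B \<inter> ?U = case_sum Source Target ` (case_sum Source Target -` B)" if "B \<in> \<mu> \<star> \<pi>" for B
    proof -
      have "range (case_sum Source Target) = range Source \<union> range Target"
        by (force simp: image_iff split: sum.splits intro: exI[of _ "Inl _"] exI[of _ "Inr _"])
      then show ?thesis
        using sub[OF that] by (auto simp: image_vimage_eq)
    qed
    have "?u (case_sum Source Target x) = case_sum i k x" for x
      by (auto simp: glue_def split: sum.splits)
    then have "(\<forall>x\<in>B \<inter> ?U. \<forall>y\<in>B \<inter> ?U. ?u x = ?u y) \<longleftrightarrow>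
      (\<forall>x\<in>case_sum Source Target -` B. \<forall>y\<in>case_sum Source Target -` B. case_sum i k x = case_sum i k y)"
      if "B \<in> \<mu> \<star> \<pi>" for B
      unfolding U[OF that] by (simp del: image_vimage_eq)
    then have "(\<forall>B\<in>\<mu> \<star> \<pi>. \<forall>x\<in>B \<inter> ?U. \<forall>y\<in>B \<inter> ?U. ?u x = ?u y) \<longleftrightarrow>
        constant_on_parts (case_sum i k) ((\<lambda>B. case_sum Source Target -` B) ` (\<mu> \<star> \<pi>))"
      unfolding constant_on_parts_def by (simp only: ball_simps cong: ball_cong)
    also have "\<dots> \<longleftrightarrow> constant_on_parts (case_sum i k) (\<mu> \<cdot> \<pi>)"
      unfolding constant_on_parts_def partition_product_def by blast
    finally show ?thesis .
  qed
  also have "{B \<in> \<mu> \<star> \<pi>. B \<inter> ?U = {}} = {B \<in> \<mu> \<star> \<pi>. B \<subseteq> range Middle}"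
  proof -
    have "B \<inter> ?U = {} \<longleftrightarrow> B \<subseteq> range Middle" if "B \<in> \<mu> \<star> \<pi>" for B
    proof -
      have "B \<subseteq> ?V"
        using that partition_onD1[OF part] by blast
      moreover have "x \<in> ?U \<longleftrightarrow> x \<notin> range Middle" if "x \<in> ?V" for x
        using that by auto
      moreover have "D \<inter> U = {} \<longleftrightarrow> D \<subseteq> R"
        if "D \<subseteq> V" "\<And>x. x \<in> V \<Longrightarrow> x \<in> U \<longleftrightarrow> x \<notin> R" for D U R V :: "glued_vertex set"
        using that by blast
      ultimately show ?thesis
        by meson
    qed
    then show ?thesis
      by (intro Collect_cong conj_cong refl)
  qed
  finally have "card ?J = N ^ middle_parts \<mu> \<pi> * matrix_entry (\<mu> \<cdot> \<pi>) i k"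
    by (simp add: middle_parts_def matrix_entry_def)
  moreover have "(\<Sum>j\<in>colourings N m. matrix_entry \<pi> i j * matrix_entry \<mu> j k) =
      (\<Sum>j\<in>colourings N m. if constant_on_parts (case_sum i j) \<pi> \<and>
        constant_on_parts (case_sum j k) \<mu> then 1 else 0)"
    by (intro sum.cong) (auto simp: matrix_entry_def)
  moreover have "\<dots> = card ?J"
    unfolding sum.inter_filter[OF finite_colourings, symmetric] by simp
  ultimately show ?thesis
    by simp
qed

lemma partitions_eqI:
  assumes "\<pi> \<in> partitions n m" "\<mu> \<in> partitions n m"
    and "\<And>i j. i \<in> {1..n} \<rightarrow> {..<2} \<Longrightarrow> j \<in> {1..m} \<rightarrow> {..<2} \<Longrightarrow> matrix_entry \<pi> i j = matrix_entry \<mu> i j"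
  shows "\<pi> = \<mu>"
proof (rule partition_eqI_colourings)
  show "partition_on ({1..n} <+> {1..m}) \<pi>" "partition_on ({1..n} <+> {1..m}) \<mu>"
    using assms by (auto simp: partitions_iff)
  fix v :: "nat + nat \<Rightarrow> nat" assume "v \<in> {1..n} <+> {1..m} \<rightarrow> {..<2}"
  then have "matrix_entry \<pi> (v \<circ> Inl) (v \<circ> Inr) = matrix_entry \<mu> (v \<circ> Inl) (v \<circ> Inr)"
    by (intro assms(3)) auto
  moreover have "case_sum (v \<circ> Inl) (v \<circ> Inr) = v"
    by (auto simp: fun_eq_iff split: sum.splits)
  ultimately show "constant_on_parts v \<pi> \<longleftrightarrow> constant_on_parts v \<mu>"
    by (simp add: matrix_entry_def of_bool_eq_iff)
qed

lemma matrix_entry_zero [simp]: "matrix_entry \<pi> (\<lambda>_. 0) (\<lambda>_. 0) = 1"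
  by (auto simp: matrix_entry_def constant_on_parts_def split: sum.splits)

text \<open>The constant colouring 0 has entry 1 for every partition, so it isolates the two powers
  of 2; equality of exponents then reduces the rest to unscaled entries.\<close>

lemma scaled_matrix_entry_eqD:
  assumes "\<pi> \<in> partitions n m" "\<mu> \<in> partitions n m"
    and eq: "\<And>i j. i \<in> {1..n} \<rightarrow> {..<2} \<Longrightarrow> j \<in> {1..m} \<rightarrow> {..<2} \<Longrightarrow>
      2 ^ a * matrix_entry \<pi> i j = 2 ^ b * matrix_entry \<mu> i j"
  shows "\<pi> = \<mu>" "a = b"
proof -
  have "2 ^ a = (2::nat) ^ b"
    using eq[of "\<lambda>_. 0" "\<lambda>_. 0"] by simp
  then show "a = b"
    by simp
  show "\<pi> = \<mu>"
    by (rule partitions_eqI[OF assms(1,2)]) (use eq \<open>a = b\<close> in auto)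
qed

text \<open>Computes a product and its exponent without tracing components: an identity of matrices
  over two colours determines both.\<close>

lemma product_eqI:
  assumes "\<pi> \<in> partitions n m" "\<mu> \<in> partitions m l" "\<rho> \<in> partitions n l"
    and "\<And>i k. i \<in> {1..n} \<rightarrow> {..<2} \<Longrightarrow> k \<in> {1..l} \<rightarrow> {..<2} \<Longrightarrow>
      (\<Sum>j\<in>colourings 2 m. matrix_entry \<pi> i j * matrix_entry \<mu> j k) = 2 ^ c * matrix_entry \<rho> i k"
  shows "\<mu> \<cdot> \<pi> = \<rho>" "middle_parts \<mu> \<pi> = c"
proof -
  have "2 ^ middle_parts \<mu> \<pi> * matrix_entry (\<mu> \<cdot> \<pi>) i k = 2 ^ c * matrix_entry \<rho> i k"
    if "i \<in> {1..n} \<rightarrow> {..<2}" "k \<in> {1..l} \<rightarrow> {..<2}" for i k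
    using sum_matrix_entry_mult[OF assms(1,2) that] assms(4)[OF that] by simp
  then show "\<mu> \<cdot> \<pi> = \<rho>" "middle_parts \<mu> \<pi> = c"
    using scaled_matrix_entry_eqD[OF product_in_partitions[OF assms(1,2)] assms(3)] by blast+
qed

text \<open>Associativity of matrix multiplication for two colours gives both claims at once, the
  second being the cocycle identity for the exponents of \<open>t\<close>.\<close>

lemma product_assoc:
  assumes \<pi>: "\<pi> \<in> partitions n m" and \<mu>: "\<mu> \<in> partitions m l" and \<nu>: "\<nu> \<in> partitions l r"
  shows "\<nu> \<cdot> (\<mu> \<cdot> \<pi>) = \<nu> \<cdot> \<mu> \<cdot> \<pi>"
    and "middle_parts \<mu> \<pi> + middle_parts \<nu> (\<mu> \<cdot> \<pi>) = middle_parts \<nu> \<mu> + middle_parts (\<nu> \<cdot> \<mu>) \<pi>"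
proof -
  note \<mu>\<pi> = product_in_partitions[OF \<pi> \<mu>] and \<nu>\<mu> = product_in_partitions[OF \<mu> \<nu>]
  have "2 ^ (middle_parts \<mu> \<pi> + middle_parts \<nu> (\<mu> \<cdot> \<pi>)) * matrix_entry (\<nu> \<cdot> (\<mu> \<cdot> \<pi>)) i s =
      2 ^ (middle_parts \<nu> \<mu> + middle_parts (\<nu> \<cdot> \<mu>) \<pi>) * matrix_entry (\<nu> \<cdot> \<mu> \<cdot> \<pi>) i s"
    if i: "i \<in> {1..n} \<rightarrow> {..<2}" and s: "s \<in> {1..r} \<rightarrow> {..<2}" for i s
  proof -
    have "2 ^ (middle_parts \<mu> \<pi> + middle_parts \<nu> (\<mu> \<cdot> \<pi>)) * matrix_entry (\<nu> \<cdot> (\<mu> \<cdot> \<pi>)) i s =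
        (\<Sum>k\<in>colourings 2 l. 2 ^ middle_parts \<mu> \<pi> * matrix_entry (\<mu> \<cdot> \<pi>) i k * matrix_entry \<nu> k s)"
      using sum_matrix_entry_mult[OF \<mu>\<pi> \<nu> i s]
      by (simp add: power_add mult.assoc flip: sum_distrib_left)
    also have "\<dots> = (\<Sum>k\<in>colourings 2 l. \<Sum>j\<in>colourings 2 m.
        matrix_entry \<pi> i j * matrix_entry \<mu> j k * matrix_entry \<nu> k s)"
      by (intro sum.cong refl, subst sum_matrix_entry_mult[OF \<pi> \<mu> i, symmetric])
        (auto simp: sum_distrib_right)
    also have "\<dots> = (\<Sum>j\<in>colourings 2 m. \<Sum>k\<in>colourings 2 l.
        matrix_entry \<pi> i j * matrix_entry \<mu> j k * matrix_entry \<nu> k s)"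
      by (rule sum.swap)
    also have "\<dots> = (\<Sum>j\<in>colourings 2 m. matrix_entry \<pi> i j *
        (\<Sum>k\<in>colourings 2 l. matrix_entry \<mu> j k * matrix_entry \<nu> k s))"
      by (simp add: sum_distrib_left mult.assoc)
    also have "\<dots> = (\<Sum>j\<in>colourings 2 m. matrix_entry \<pi> i j *
        (2 ^ middle_parts \<nu> \<mu> * matrix_entry (\<nu> \<cdot> \<mu>) j s))"
      by (intro sum.cong refl, subst sum_matrix_entry_mult[OF \<mu> \<nu> _ s]) auto
    also have "\<dots> = 2 ^ (middle_parts \<nu> \<mu> + middle_parts (\<nu> \<cdot> \<mu>) \<pi>) * matrix_entry (\<nu> \<cdot> \<mu> \<cdot> \<pi>) i s"
      using sum_matrix_entry_mult[OF \<pi> \<nu>\<mu> i s]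
      by (simp add: power_add mult.assoc mult.left_commute[of "matrix_entry _ _ _" "2 ^ _"]
          flip: sum_distrib_left)
    finally show ?thesis .
  qed
  note eq = scaled_matrix_entry_eqD[OF product_in_partitions[OF \<mu>\<pi> \<nu>] product_in_partitions[OF \<pi> \<nu>\<mu>] this]
  show "\<nu> \<cdot> (\<mu> \<cdot> \<pi>) = \<nu> \<cdot> \<mu> \<cdot> \<pi>"
    "middle_parts \<mu> \<pi> + middle_parts \<nu> (\<mu> \<cdot> \<pi>) = middle_parts \<nu> \<mu> + middle_parts (\<nu> \<cdot> \<mu>) \<pi>"
    using eq by blast+
qed

section \<open>Deligne's category as a linear category\<close>

definition pm_scale :: "'a::field \<Rightarrow> ('k \<Rightarrow>\<^sub>0 'a) \<Rightarrow> 'k \<Rightarrow>\<^sub>0 'a" where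
  "pm_scale c f = Poly_Mapping.map ((*) c) f"

abbreviation basis :: "'k \<Rightarrow> 'k \<Rightarrow>\<^sub>0 'a::field" where
  "basis k \<equiv> Poly_Mapping.single k 1"

lemma lookup_pm_scale [simp]: "Poly_Mapping.lookup (pm_scale c f) k = c * Poly_Mapping.lookup f k"
  unfolding pm_scale_def by transfer (simp add: when_def)

lemma single_eq_scale: "Poly_Mapping.single k a = pm_scale a (basis k)"
  by (rule poly_mapping_eqI) (simp add: lookup_single when_def)

interpretation pm: vector_space pm_scale
  by unfold_locales (auto intro!: poly_mapping_eqI simp: lookup_add algebra_simps)

lemma linear_combination_of_basis:
  assumes "finite K" "Poly_Mapping.keys f \<subseteq> K"
  shows "f = (\<Sum>k\<in>K. pm_scale (Poly_Mapping.lookup f k) (basis k))"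
proof (rule poly_mapping_eqI)
  fix k
  have "(\<Sum>l\<in>K. Poly_Mapping.lookup f l * (1 when l = k)) =
      (\<Sum>l\<in>K. if l = k then Poly_Mapping.lookup f k else 0)"
    by (intro sum.cong) (auto simp: when_def)
  also have "\<dots> = Poly_Mapping.lookup f k"
    using assms by (auto simp: in_keys_iff)
  finally show "Poly_Mapping.lookup f k =
      Poly_Mapping.lookup (\<Sum>k\<in>K. pm_scale (Poly_Mapping.lookup f k) (basis k)) k"
    by (simp add: lookup_sum lookup_single)
qed

lemma span_basis:
  fixes K :: "'k set"
  assumes K: "finite K"
  shows "pm.span (basis ` K) = {f :: 'k \<Rightarrow>\<^sub>0 'a::field. Poly_Mapping.keys f \<subseteq> K}"
proof (rule equalityI; rule subsetI)
  fix f :: "'k \<Rightarrow>\<^sub>0 'a" assume "f \<in> {f. Poly_Mapping.keys f \<subseteq> K}"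
  then have "f = (\<Sum>k\<in>K. pm_scale (Poly_Mapping.lookup f k) (basis k))"
    using K by (intro linear_combination_of_basis) auto
  moreover have "\<dots> \<in> pm.span (basis ` K)"
    by (intro pm.span_sum pm.span_scale pm.span_base) auto
  ultimately show "f \<in> pm.span (basis ` K)"
    by simp
next
  fix f :: "'k \<Rightarrow>\<^sub>0 'a" assume "f \<in> pm.span (basis ` K)"
  then have "Poly_Mapping.keys f \<subseteq> K"
  proof (induction rule: pm.span_induct_alt)
    case (step c x y)
    then show ?case
      by (auto simp: in_keys_iff lookup_add lookup_single when_def split: if_splits)
  qed simp
  then show "f \<in> {f. Poly_Mapping.keys f \<subseteq> K}"
    by simp
qed

lemma Hom_Rep0: "Hom (Rep0 t) n m = {f. Poly_Mapping.keys f \<subseteq> partitions n m}"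
  by (simp add: Rep0_def)

lemma Hom_Rep0_span: "Hom (Rep0 t) n m = pm.span (basis ` partitions n m)"
  by (simp add: Hom_Rep0 span_basis finite_partitions)

lemma Hom_Rep0_subspace: "pm.subspace (Hom (Rep0 t) n m)"
  by (simp add: Hom_Rep0_span)

lemma basis_in_Hom [simp]: "\<pi> \<in> partitions n m \<Longrightarrow> basis \<pi> \<in> Hom (Rep0 t) n m"
  by (simp add: Hom_Rep0)

lemma Comp_Rep0: "Comp (Rep0 t) n m l g f = (\<Sum>\<pi>\<in>partitions n m. \<Sum>\<mu>\<in>partitions m l.
   pm_scale (t ^ middle_parts \<mu> \<pi> * Poly_Mapping.lookup g \<mu> * Poly_Mapping.lookup f \<pi>) (basis (\<mu> \<cdot> \<pi>)))"
  by (simp add: Rep0_def flip: single_eq_scale)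

lemma linear_Comp_Rep0_left: "Vector_Spaces.linear pm_scale pm_scale (\<lambda>g. Comp (Rep0 t) n m l g f)"
proof (unfold_locales, goal_cases)
  case (1 g g')
  show ?case
    by (simp add: Comp_Rep0 lookup_add algebra_simps pm.scale_left_distrib sum.distrib)
next
  case (2 c g)
  show ?case
    by (simp add: Comp_Rep0 pm.scale_sum_right algebra_simps)
qed

lemma linear_Comp_Rep0_right: "Vector_Spaces.linear pm_scale pm_scale (Comp (Rep0 t) n m l g)"
proof (unfold_locales, goal_cases)
  case (1 f f')
  show ?case
    by (simp add: Comp_Rep0 lookup_add algebra_simps pm.scale_left_distrib sum.distrib)
next
  case (2 c f)
  show ?case
    by (simp add: Comp_Rep0 pm.scale_sum_right algebra_simps)
qed

lemma Comp_basis: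
  assumes "\<pi> \<in> partitions n m" "\<mu> \<in> partitions m l"
  shows "Comp (Rep0 t) n m l (basis \<mu>) (basis \<pi>) = pm_scale (t ^ middle_parts \<mu> \<pi>) (basis (\<mu> \<cdot> \<pi>))"
proof -
  have "Comp (Rep0 t) n m l (basis \<mu>) (basis \<pi>) =
    (\<Sum>\<pi>'\<in>partitions n m. if \<pi>' = \<pi> then \<Sum>\<mu>'\<in>partitions m l. if \<mu>' = \<mu> then
      pm_scale (t ^ middle_parts \<mu> \<pi>) (basis (\<mu> \<cdot> \<pi>)) else 0 else 0)"
    unfolding Comp_Rep0
  proof (intro sum.cong refl)
    fix \<pi>'
    show "(\<Sum>\<mu>'\<in>partitions m l. pm_scale (t ^ middle_parts \<mu>' \<pi>' *
        Poly_Mapping.lookup (basis \<mu>) \<mu>' * Poly_Mapping.lookup (basis \<pi>) \<pi>') (basis (\<mu>' \<cdot> \<pi>'))) =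
      (if \<pi>' = \<pi> then \<Sum>\<mu>'\<in>partitions m l. if \<mu>' = \<mu> then
        pm_scale (t ^ middle_parts \<mu> \<pi>) (basis (\<mu> \<cdot> \<pi>)) else 0 else 0)"
      by (cases "\<pi>' = \<pi>") (simp_all add: lookup_single when_def if_distrib[of "(*) _"]
          if_distrib[of "\<lambda>c. pm_scale c _"] sum.delta finite_partitions cong: if_cong)
  qed
  then show ?thesis
    using assms by (simp add: finite_partitions)
qed

lemma Comp_basis_right:
  assumes "\<pi> \<in> partitions n m"
  shows "Comp (Rep0 t) n m l g (basis \<pi>) =
    (\<Sum>\<mu>\<in>partitions m l. pm_scale (Poly_Mapping.lookup g \<mu>) (Comp (Rep0 t) n m l (basis \<mu>) (basis \<pi>)))"
proof -
  have "Comp (Rep0 t) n m l g (basis \<pi>) =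
    (\<Sum>\<pi>'\<in>partitions n m. if \<pi>' = \<pi> then \<Sum>\<mu>\<in>partitions m l.
       pm_scale (t ^ middle_parts \<mu> \<pi> * Poly_Mapping.lookup g \<mu>) (basis (\<mu> \<cdot> \<pi>)) else 0)"
    unfolding Comp_Rep0
  proof (intro sum.cong refl)
    fix \<pi>'
    show "(\<Sum>\<mu>\<in>partitions m l. pm_scale (t ^ middle_parts \<mu> \<pi>' *
        Poly_Mapping.lookup g \<mu> * Poly_Mapping.lookup (basis \<pi>) \<pi>') (basis (\<mu> \<cdot> \<pi>'))) =
      (if \<pi>' = \<pi> then \<Sum>\<mu>\<in>partitions m l.
       pm_scale (t ^ middle_parts \<mu> \<pi> * Poly_Mapping.lookup g \<mu>) (basis (\<mu> \<cdot> \<pi>)) else 0)"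
      by (cases "\<pi>' = \<pi>") (simp_all add: lookup_single when_def)
  qed
  then show ?thesis
    using assms by (simp add: finite_partitions Comp_basis mult.commute)
qed

lemma Comp_expand_right:
  "Comp (Rep0 t) n m l g f =
    (\<Sum>\<pi>\<in>partitions n m. pm_scale (Poly_Mapping.lookup f \<pi>) (Comp (Rep0 t) n m l g (basis \<pi>)))"
proof -
  have "pm_scale (Poly_Mapping.lookup f \<pi>) (Comp (Rep0 t) n m l g (basis \<pi>)) =
    (\<Sum>\<mu>\<in>partitions m l. pm_scale (t ^ middle_parts \<mu> \<pi> * Poly_Mapping.lookup g \<mu> *
      Poly_Mapping.lookup f \<pi>) (basis (\<mu> \<cdot> \<pi>)))" if "\<pi> \<in> partitions n m" for \<pi>
    unfolding Comp_basis_right[OF that, where g = g] pm.scale_sum_right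
    by (intro sum.cong refl) (simp add: Comp_basis[OF that] mult_ac)
  then show ?thesis
    by (simp add: Comp_Rep0[of t n m l g f])
qed

text \<open>Reduction to triples of basis vectors by expanding each argument. The expansions are
  valid for arbitrary arguments because \<open>Comp (Rep0 t)\<close> reads only coefficients at
  partitions of the right size.\<close>

lemma Comp_Rep0_assoc:
  "Comp (Rep0 t) n l r h (Comp (Rep0 t) n m l g f) = Comp (Rep0 t) n m r (Comp (Rep0 t) m l r h g) f"
proof -
  interpret pair: vector_space_pair pm_scale pm_scale
    by unfold_locales
  note lin = pair.linear_sum[OF linear_Comp_Rep0_left] pair.linear_sum[OF linear_Comp_Rep0_right]
    pair.linear_scale[OF linear_Comp_Rep0_left] pair.linear_scale[OF linear_Comp_Rep0_right]
  have basis: "Comp (Rep0 t) n l r (basis \<nu>) (Comp (Rep0 t) n m l (basis \<mu>) (basis \<pi>)) =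
      Comp (Rep0 t) n m r (Comp (Rep0 t) m l r (basis \<nu>) (basis \<mu>)) (basis \<pi>)"
    if "\<pi> \<in> partitions n m" "\<mu> \<in> partitions m l" "\<nu> \<in> partitions l r" for \<pi> \<mu> \<nu>
    using that product_assoc[OF that] product_in_partitions[OF that(1,2)] product_in_partitions[OF that(2,3)]
    by (simp add: Comp_basis lin flip: power_add)
  have right: "Comp (Rep0 t) n l r h (Comp (Rep0 t) n m l (basis \<mu>) (basis \<pi>)) =
      Comp (Rep0 t) n m r (Comp (Rep0 t) m l r h (basis \<mu>)) (basis \<pi>)"
    if "\<pi> \<in> partitions n m" "\<mu> \<in> partitions m l" for \<pi> \<mu>
  proof -
    have "Comp (Rep0 t) n l r h (Comp (Rep0 t) n m l (basis \<mu>) (basis \<pi>)) =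
        (\<Sum>\<nu>\<in>partitions l r. pm_scale (Poly_Mapping.lookup h \<nu>)
          (Comp (Rep0 t) n l r (basis \<nu>) (Comp (Rep0 t) n m l (basis \<mu>) (basis \<pi>))))"
      unfolding Comp_basis[OF that] lin
      by (simp add: Comp_basis_right[OF product_in_partitions[OF that], of t r h]
          pm.scale_sum_right mult.commute)
    also have "\<dots> = (\<Sum>\<nu>\<in>partitions l r. pm_scale (Poly_Mapping.lookup h \<nu>)
          (Comp (Rep0 t) n m r (Comp (Rep0 t) m l r (basis \<nu>) (basis \<mu>)) (basis \<pi>)))"
      using that by (intro sum.cong refl) (simp add: basis)
    also have "\<dots> = Comp (Rep0 t) n m r (Comp (Rep0 t) m l r h (basis \<mu>)) (basis \<pi>)"
      by (simp add: Comp_basis_right[OF that(2), of t r h] lin)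
    finally show ?thesis .
  qed
  have "Comp (Rep0 t) n l r h (Comp (Rep0 t) n m l g f) =
      (\<Sum>\<pi>\<in>partitions n m. pm_scale (Poly_Mapping.lookup f \<pi>)
        (\<Sum>\<mu>\<in>partitions m l. pm_scale (Poly_Mapping.lookup g \<mu>)
          (Comp (Rep0 t) n l r h (Comp (Rep0 t) n m l (basis \<mu>) (basis \<pi>)))))"
    unfolding Comp_expand_right[of t n m l g f] lin
    by (intro sum.cong refl) (simp add: Comp_basis_right[of _ n m t l g] lin)
  also have "\<dots> = (\<Sum>\<pi>\<in>partitions n m. pm_scale (Poly_Mapping.lookup f \<pi>)
        (\<Sum>\<mu>\<in>partitions m l. pm_scale (Poly_Mapping.lookup g \<mu>)
          (Comp (Rep0 t) n m r (Comp (Rep0 t) m l r h (basis \<mu>)) (basis \<pi>))))"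
    by (intro sum.cong refl arg_cong2[where f = pm_scale]) (simp add: right)
  also have "\<dots> = (\<Sum>\<pi>\<in>partitions n m. pm_scale (Poly_Mapping.lookup f \<pi>)
        (Comp (Rep0 t) n m r (Comp (Rep0 t) m l r h g) (basis \<pi>)))"
    by (intro sum.cong refl arg_cong2[where f = pm_scale])
      (simp add: Comp_expand_right[of t m l r h g] lin)
  also have "\<dots> = Comp (Rep0 t) n m r (Comp (Rep0 t) m l r h g) f"
    by (rule Comp_expand_right[symmetric])
  finally show ?thesis .
qed

section \<open>Permutations as partitions, and the identities\<close>

definition perm_partition :: "nat \<Rightarrow> (nat \<Rightarrow> nat) \<Rightarrow> vertex_partition" where
  "perm_partition n \<sigma> = (\<lambda>a. {Inl a, Inr (\<sigma> a)}) ` {1..n}"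

lemma perm_partition_in_partitions:
  assumes "\<sigma> permutes {1..n}"
  shows "perm_partition n \<sigma> \<in> partitions n n"
proof -
  have inj: "\<sigma> a = \<sigma> b \<longleftrightarrow> a = b" for a b
    using permutes_inj[OF assms] by (auto simp: inj_def)
  have "\<sigma> ` {1..n} = {1..n}"
    using assms by (rule permutes_image)
  then have "\<Union> (perm_partition n \<sigma>) = {1..n} <+> {1..n}"
    unfolding perm_partition_def Plus_def by blast
  moreover have "disjoint (perm_partition n \<sigma>)"
    by (auto simp: disjoint_def perm_partition_def inj)
  moreover have "{} \<notin> perm_partition n \<sigma>"
    by (auto simp: perm_partition_def)
  ultimately show ?thesis
    by (auto simp: partitions_iff partition_on_def)
qed

lemma matrix_entry_perm_partition:
  "matrix_entry (perm_partition n \<sigma>) i j = of_bool (\<forall>a\<in>{1..n}. i a = j (\<sigma> a))"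
  unfolding matrix_entry_def constant_on_parts_def perm_partition_def by auto

lemma matrix_entry_cong:
  assumes \<pi>: "\<pi> \<in> partitions n m" and "\<And>a. a \<in> {1..n} \<Longrightarrow> i a = i' a" "\<And>a. a \<in> {1..m} \<Longrightarrow> j a = j' a"
  shows "matrix_entry \<pi> i j = matrix_entry \<pi> i' j'"
proof -
  have "constant_on_parts (case_sum i j) \<pi> \<longleftrightarrow> constant_on_parts (case_sum i' j') \<pi>"
    by (rule constant_on_parts_cong)
      (use assms(2,3) partition_onD1[OF \<pi>[unfolded partitions_iff], symmetric] in auto)
  then show ?thesis
    by (simp add: matrix_entry_def)
qed

text \<open>Multiplication by a Kronecker delta; the restriction appears because the summation index
  ranges over extensional functions.\<close>

lemma sum_colourings_eq:
  assumes "k \<in> {1..n} \<rightarrow> {..<N}"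
  shows "(\<Sum>j\<in>colourings N n. (F j :: nat) * of_bool (\<forall>a\<in>{1..n}. j a = k a)) = F (restrict k {1..n})"
proof -
  have "(\<forall>a\<in>{1..n}. j a = k a) \<longleftrightarrow> j = restrict k {1..n}" if "j \<in> colourings N n" for j
    using that by (auto simp: fun_eq_iff PiE_def extensional_def)
  then have "(\<Sum>j\<in>colourings N n. F j * of_bool (\<forall>a\<in>{1..n}. j a = k a)) =
      (\<Sum>j\<in>colourings N n. if j = restrict k {1..n} then F j else 0)"
    by (intro sum.cong) (auto simp del: restrict_apply)
  also have "\<dots> = F (restrict k {1..n})"
    using assms by (subst sum.delta[OF finite_colourings]) (auto simp del: restrict_apply)
  finally show ?thesis .
qed

text \<open>A permutation acts by a permutation matrix, so the sum over intermediate colourings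
  collapses to the single term \<open>k \<circ> \<sigma>\<close>, and no power of 2 appears.\<close>

lemma perm_partition_product:
  assumes \<pi>: "\<pi> \<in> partitions n m" and \<sigma>: "\<sigma> permutes {1..m}" and \<rho>: "\<rho> \<in> partitions n m"
    and eq: "\<And>i k. matrix_entry \<pi> i (\<lambda>a. k (\<sigma> a)) = matrix_entry \<rho> i k"
  shows "perm_partition m \<sigma> \<cdot> \<pi> = \<rho>" "middle_parts (perm_partition m \<sigma>) \<pi> = 0"
proof -
  have "(\<Sum>j\<in>colourings 2 m. matrix_entry \<pi> i j * matrix_entry (perm_partition m \<sigma>) j k) =
      2 ^ 0 * matrix_entry \<rho> i k" if k: "k \<in> {1..m} \<rightarrow> {..<2}" for i k
  proof -
    have "(\<lambda>a. k (\<sigma> a)) \<in> {1..m} \<rightarrow> {..<2}"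
      using k permutes_in_image[OF \<sigma>] by (auto simp: Pi_def)
    then have "(\<Sum>j\<in>colourings 2 m. matrix_entry \<pi> i j * of_bool (\<forall>a\<in>{1..m}. j a = k (\<sigma> a))) =
        matrix_entry \<pi> i (restrict (\<lambda>a. k (\<sigma> a)) {1..m})"
      by (rule sum_colourings_eq)
    also have "\<dots> = matrix_entry \<pi> i (\<lambda>a. k (\<sigma> a))"
      by (rule matrix_entry_cong[OF \<pi>]) auto
    also have "\<dots> = matrix_entry \<rho> i k"
      by (rule eq)
    finally show ?thesis
      by (simp add: matrix_entry_perm_partition)
  qed
  then show "perm_partition m \<sigma> \<cdot> \<pi> = \<rho>" "middle_parts (perm_partition m \<sigma>) \<pi> = 0"
    using product_eqI[OF \<pi> perm_partition_in_partitions[OF \<sigma>] \<rho>] by blast+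
qed

lemma product_perm_partition:
  assumes "\<sigma> permutes {1..n}" "\<tau> permutes {1..n}"
  shows "perm_partition n \<tau> \<cdot> perm_partition n \<sigma> = perm_partition n (\<tau> \<circ> \<sigma>)"
    and "middle_parts (perm_partition n \<tau>) (perm_partition n \<sigma>) = 0"
proof -
  have "matrix_entry (perm_partition n \<sigma>) i (\<lambda>a. k (\<tau> a)) = matrix_entry (perm_partition n (\<tau> \<circ> \<sigma>)) i k"
    for i k
    by (simp add: matrix_entry_perm_partition)
  note * = perm_partition_product[OF perm_partition_in_partitions[OF assms(1)] assms(2)
      perm_partition_in_partitions[OF permutes_compose[OF assms]] this]
  show "perm_partition n \<tau> \<cdot> perm_partition n \<sigma> = perm_partition n (\<tau> \<circ> \<sigma>)"
    "middle_parts (perm_partition n \<tau>) (perm_partition n \<sigma>) = 0"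
    by (fact *)+
qed

lemma product_id_left:
  assumes "\<pi> \<in> partitions n m"
  shows "perm_partition m id \<cdot> \<pi> = \<pi>" "middle_parts (perm_partition m id) \<pi> = 0"
  using perm_partition_product[OF assms permutes_id assms] by auto

lemma product_id_right:
  assumes \<pi>: "\<pi> \<in> partitions n m"
  shows "\<pi> \<cdot> perm_partition n id = \<pi>" "middle_parts \<pi> (perm_partition n id) = 0"
proof -
  have "(\<Sum>j\<in>colourings 2 n. matrix_entry (perm_partition n id) i j * matrix_entry \<pi> j k) =
      2 ^ 0 * matrix_entry \<pi> i k" if "i \<in> {1..n} \<rightarrow> {..<2}" for i k
  proof -
    have "(\<Sum>j\<in>colourings 2 n. matrix_entry (perm_partition n id) i j * matrix_entry \<pi> j k) =
        (\<Sum>j\<in>colourings 2 n. matrix_entry \<pi> j k * of_bool (\<forall>a\<in>{1..n}. j a = i a))"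
      by (auto simp: matrix_entry_perm_partition intro!: sum.cong)
    also have "\<dots> = matrix_entry \<pi> (restrict i {1..n}) k"
      by (rule sum_colourings_eq[OF that])
    also have "\<dots> = matrix_entry \<pi> i k"
      by (rule matrix_entry_cong[OF \<pi>]) auto
    finally show ?thesis
      by simp
  qed
  then show "\<pi> \<cdot> perm_partition n id = \<pi>" "middle_parts \<pi> (perm_partition n id) = 0"
    using product_eqI[OF perm_partition_in_partitions[OF permutes_id] \<pi> \<pi>] by blast+
qed

lemma Ident_Rep0: "Ident (Rep0 t) n = basis (perm_partition n id)"
  by (simp add: Rep0_def perm_partition_def)

lemma linear_category_Rep0: "linear_category (Rep0 t) pm_scale"
proof -
  interpret pair: vector_space_pair pm_scale pm_scale
    by unfold_locales
  note expand = linear_combination_of_basis[OF finite_partitions]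
  show ?thesis
  proof (intro linear_category.intro preadditive_category.intro linear_category_axioms.intro
      pm.vector_space_axioms, goal_cases)
    case (1 X)
    show ?case
      unfolding Ident_Rep0 by (intro basis_in_Hom perm_partition_in_partitions permutes_id)
  next
    case (2 n m l f g)
    show ?case
      unfolding Comp_Rep0
      by (intro pm.subspace_sum[OF Hom_Rep0_subspace] pm.subspace_scale[OF Hom_Rep0_subspace]
          basis_in_Hom product_in_partitions)
  next
    case 3
    show ?case by (rule Comp_Rep0_assoc)
  next
    case (4 n m f)
    have "Comp (Rep0 t) n m m (Ident (Rep0 t) m) f =
        (\<Sum>\<pi>\<in>partitions n m. pm_scale (Poly_Mapping.lookup f \<pi>) (basis \<pi>))"
      unfolding Comp_expand_right[of t n m m _ f] Ident_Rep0
      by (intro sum.cong refl)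
        (simp add: Comp_basis perm_partition_in_partitions permutes_id product_id_left)
    also have "\<dots> = f"
      by (rule expand[symmetric]) (use 4 in \<open>simp add: Hom_Rep0\<close>)
    finally show ?case .
  next
    case (5 n m f)
    have "Comp (Rep0 t) n n m f (Ident (Rep0 t) n) =
        (\<Sum>\<pi>\<in>partitions n m. pm_scale (Poly_Mapping.lookup f \<pi>) (basis \<pi>))"
      unfolding Ident_Rep0 Comp_basis_right[OF perm_partition_in_partitions[OF permutes_id], where g = f]
      by (intro sum.cong refl)
        (simp add: Comp_basis perm_partition_in_partitions permutes_id product_id_right)
    also have "\<dots> = f"
      by (rule expand[symmetric]) (use 5 in \<open>simp add: Hom_Rep0\<close>)
    finally show ?case .
  next
    case (6 n m)
    show ?case by (rule pm.subspace_0[OF Hom_Rep0_subspace])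
  next
    case (7 n m f g)
    then show ?case by (intro pm.subspace_add[OF Hom_Rep0_subspace])
  next
    case (8 n m f)
    then show ?case by (intro pm.subspace_neg[OF Hom_Rep0_subspace])
  next
    case 9
    show ?case by (rule pair.linear_add[OF linear_Comp_Rep0_left])
  next
    case 10
    show ?case by (rule pair.linear_add[OF linear_Comp_Rep0_right])
  next
    case 11
    show ?case by (rule Comp_Rep0_assoc)
  next
    case (12 n m f c)
    then show ?case by (intro pm.subspace_scale[OF Hom_Rep0_subspace])
  next
    case 13
    show ?case by (rule linear_Comp_Rep0_left)
  next
    case 14
    show ?case by (rule linear_Comp_Rep0_right)
  next
    case (15 n m)
    show ?case
      using finite_partitions by (intro exI[of _ "basis ` partitions n m"]) (simp add: Hom_Rep0_span)
  qed
qed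

section \<open>Nonnegative integer parameters\<close>

text \<open>
  The parts are the connected components of the graph with edges \<open>r\<close>; two vertices are connected
  iff every colouring constant along the edges gives them the same colour.
\<close>

definition component_partition :: "'b set \<Rightarrow> ('b \<times> 'b) set \<Rightarrow> 'b set set" where
  "component_partition V r =
    V // {(x, y) \<in> V \<times> V. \<forall>v :: 'b \<Rightarrow> nat. (\<forall>(a, b)\<in>r. v a = v b) \<longrightarrow> v x = v y}"

lemma same_part_quotient:
  assumes "equiv V r"
  shows "same_part (V // r) = r"
proof (intro equalityI subrelI)
  fix x y assume "(x, y) \<in> same_part (V // r)"
  then show "(x, y) \<in> r"
    using assms in_quotient_imp_in_rel by (fastforce simp: same_part_def)
next
  fix x y assume "(x, y) \<in> r"
  then have "r `` {x} \<in> V // r" "x \<in> r `` {x}" "y \<in> r `` {x}"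
    using assms equiv_class_self[of V r x] by (auto simp: equiv_def intro!: quotientI)
  then show "(x, y) \<in> same_part (V // r)"
    by (auto simp: same_part_def)
qed

lemma component_partition:
  shows partition_on_component_partition: "partition_on V (component_partition V r)"
    and same_part_component_partition: "same_part (component_partition V r) =
      {(x, y) \<in> V \<times> V. \<forall>v :: 'b \<Rightarrow> nat. (\<forall>(a, b)\<in>r. v a = v b) \<longrightarrow> v x = v y}"
proof -
  have "equiv V {(x, y) \<in> V \<times> V. \<forall>v :: 'b \<Rightarrow> nat. (\<forall>(a, b)\<in>r. v a = v b) \<longrightarrow> v x = v y}"
    by (intro equivI) (auto simp: refl_on_def sym_def trans_def)
  then show "partition_on V (component_partition V r)"
    "same_part (component_partition V r) =
      {(x, y) \<in> V \<times> V. \<forall>v :: 'b \<Rightarrow> nat. (\<forall>(a, b)\<in>r. v a = v b) \<longrightarrow> v x = v y}"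
    unfolding component_partition_def by (auto intro: partition_on_quotient simp: same_part_quotient)
qed

lemma constant_on_component_partition:
  fixes v :: "'b \<Rightarrow> nat"
  assumes "r \<subseteq> V \<times> V"
  shows "constant_on_parts v (component_partition V r) \<longleftrightarrow> (\<forall>(x, y)\<in>r. v x = v y)"
  unfolding constant_on_parts_iff_same_part same_part_component_partition
  using assms by blast

text \<open>The expansion of the product of \<open>1 - 1\<close> over \<open>S\<close>.\<close>

lemma alternating_sum_Pow:
  assumes "finite S" "S \<noteq> {}"
  shows "(\<Sum>E\<in>Pow S. (- 1) ^ card E) = (0 :: 'a::comm_ring_1)"
  using prod_diff_conv_sum[of S "\<lambda>_. 1 :: 'a" "\<lambda>_. 1"] assms by (simp add: zero_power card_gt_0_iff)

text \<open>
  If \<open>t = N\<close>, expanding the product of \<open>1 - [i\<^sub>a = i\<^sub>b]\<close> over all pairs \<open>a < b\<close> in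
  \<open>{1..N+1}\<close> gives a nonzero morphism \<open>[0] \<rightarrow> [N+1]\<close> whose left composites with all
  \<open>[N+1] \<rightarrow> [0]\<close> vanish, because no colouring of \<open>N + 1\<close> vertices by \<open>N\<close> colours is injective.
\<close>

lemma negligible_morphism:
  fixes t :: "'a::field_char_0"
  assumes t: "t = of_nat N"
  obtains f where "f \<in> Hom (Rep0 t) 0 (Suc N)" "f \<noteq> 0"
    "\<And>g. g \<in> Hom (Rep0 t) (Suc N) 0 \<Longrightarrow> Comp (Rep0 t) 0 (Suc N) 0 g f = 0"
proof -
  interpret linear_category "Rep0 t" pm_scale
    by (rule linear_category_Rep0)
  let ?n = "Suc N"
  let ?V = "{1..0} <+> {1..?n} :: (nat + nat) set"
  define edges where "edges = {(Inr a, Inr b) :: (nat + nat) \<times> (nat + nat) | a b. a \<in> {1..?n} \<and> b \<in> {1..?n} \<and> a < b}"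
  have edges_V: "edges \<subseteq> ?V \<times> ?V"
    by (auto simp: edges_def)
  have fin: "finite edges"
    by (rule finite_subset[OF edges_V]) auto
  define cl where "cl E = component_partition ?V E" for E
  have cl: "cl E \<in> partitions 0 ?n" for E
    unfolding cl_def partitions_iff by (rule partition_on_component_partition)
  have const: "constant_on_parts v (cl E) \<longleftrightarrow> (\<forall>(x, y)\<in>E. v x = v y)" if "E \<subseteq> edges" for E
    and v :: "nat + nat \<Rightarrow> nat"
    unfolding cl_def using that edges_V by (intro constant_on_component_partition) auto
  define f :: "vertex_partition \<Rightarrow>\<^sub>0 'a" where
    "f = (\<Sum>E\<in>Pow edges. pm_scale ((- 1) ^ card E) (basis (cl E)))"
  have "f \<in> Hom (Rep0 t) 0 ?n"
    unfolding f_def by (intro sum_in_Hom scale_in_Hom basis_in_Hom cl) (auto simp: Rep0_def)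
  moreover have "f \<noteq> 0"
  proof
    assume "f = 0"
    \<comment> \<open>A colouring that is injective on the vertices is constant on the singletons of
      \<open>cl {}\<close> but not along any edge of \<open>E\<close>. Hence the coefficient of
      \<open>f\<close> at \<open>cl {}\<close> comes from \<open>E = {}\<close> alone and equals
      1.\<close>
    have "cl E \<noteq> cl {}" if E: "E \<subseteq> edges" "E \<noteq> {}" for E
    proof
      assume eq: "cl E = cl {}"
      define v where "v = case_sum (\<lambda>_ :: nat. 0) (\<lambda>a. a :: nat)"
      obtain a b where ab: "(Inr a, Inr b) \<in> E" "a < b"
        using E by (fastforce simp: edges_def)
      have "constant_on_parts v (cl {})"
        using const[of "{}"] by simp
      then show False
        using const[OF E(1), of v] ab unfolding eq by (auto simp: v_def)
    qed
    then have "(\<Sum>E\<in>Pow edges. (- 1) ^ card E * (1 when cl E = cl {})) =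
        (\<Sum>E\<in>Pow edges. if E = {} then 1 else 0 :: 'a)"
      by (intro sum.cong) (auto simp: when_def)
    moreover have "Poly_Mapping.lookup f (cl {}) = (\<Sum>E\<in>Pow edges. (- 1) ^ card E * (1 when cl E = cl {}))"
      unfolding f_def by (simp add: lookup_sum lookup_single)
    ultimately show False
      using \<open>f = 0\<close> fin by simp
  qed
  moreover have "Comp (Rep0 t) 0 ?n 0 g f = 0" if g: "g \<in> Hom (Rep0 t) ?n 0" for g
  proof -
    have basis: "Comp (Rep0 t) 0 ?n 0 (basis \<mu>) f = 0" if \<mu>: "\<mu> \<in> partitions ?n 0" for \<mu>
    proof -
      have empty: "\<mu> \<cdot> \<pi> = {}" if "\<pi> \<in> partitions 0 ?n" for \<pi>
        using product_in_partitions[OF that \<mu>] by (simp add: partitions_iff partition_on_empty Plus_def)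
      have power: "N ^ middle_parts \<mu> (cl E) =
          (\<Sum>j\<in>colourings N ?n. of_bool (\<forall>(x, y)\<in>E. case_sum (\<lambda>_. 0) j x = case_sum (\<lambda>_. 0) j y) *
            matrix_entry \<mu> j (\<lambda>_. 0))" if "E \<subseteq> edges" for E
        using sum_matrix_entry_mult[OF cl \<mu>, of "\<lambda>_. 0" N "\<lambda>_. 0" E] const[OF that]
        by (simp add: matrix_entry_def)
      define same where "same j = {(x, y) \<in> edges. case_sum (\<lambda>_. 0) j x = case_sum (\<lambda>_. 0 :: nat) j y}"
        for j :: "nat \<Rightarrow> nat"
      \<comment> \<open>By the pigeonhole principle \<open>j\<close> repeats a colour, so
        \<open>same j\<close> is nonempty. Only its subsets contribute, and their signs
        cancel.\<close>
      have same: "(\<Sum>E\<in>Pow edges. (- 1) ^ card E *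
          of_bool (\<forall>(x, y)\<in>E. case_sum (\<lambda>_. 0) j x = case_sum (\<lambda>_. 0) j y)) = (0 :: 'a)"
        if j: "j \<in> colourings N ?n" for j
      proof -
        have "\<not> inj_on j {1..?n}"
          using j card_inj_on_le[of j "{1..?n}" "{..<N}"] by (auto simp: PiE_def)
        then obtain a b where ab: "a \<in> {1..?n}" "b \<in> {1..?n}" "j a = j b" "a < b"
          unfolding inj_on_def by (metis linorder_neqE_nat)
        then have "(Inr a, Inr b) \<in> same j"
          by (auto simp: same_def edges_def)
        moreover have "finite (same j)"
          by (rule finite_subset[OF _ fin]) (auto simp: same_def)
        ultimately have "(\<Sum>E\<in>Pow (same j). (- 1) ^ card E) = (0 :: 'a)"
          by (intro alternating_sum_Pow) auto
        moreover have "(\<Sum>E\<in>Pow edges. (- 1) ^ card E *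
            of_bool (\<forall>(x, y)\<in>E. case_sum (\<lambda>_. 0) j x = case_sum (\<lambda>_. 0) j y)) =
            (\<Sum>E\<in>Pow (same j). (- 1) ^ card E :: 'a)"
          using fin by (intro sum.mono_neutral_cong_right) (auto simp: same_def)
        ultimately show ?thesis
          by simp
      qed
      \<comment> \<open>As \<open>[0]\<close> has only the empty partition, the composite is a
        multiple of one basis vector, with this scalar. Writing powers of \<open>N\<close> as counts
        of colourings and exchanging the sums leaves, for each colouring, an alternating sum that
        vanishes.\<close>
      have "(\<Sum>E\<in>Pow edges. (- 1) ^ card E * t ^ middle_parts \<mu> (cl E)) =
          (\<Sum>E\<in>Pow edges. \<Sum>j\<in>colourings N ?n. (- 1) ^ card E *
            of_bool (\<forall>(x, y)\<in>E. case_sum (\<lambda>_. 0) j x = case_sum (\<lambda>_. 0) j y) *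
            of_nat (matrix_entry \<mu> j (\<lambda>_. 0)))"
      proof (intro sum.cong refl)
        fix E assume E: "E \<in> Pow edges"
        have "t ^ middle_parts \<mu> (cl E) = of_nat (N ^ middle_parts \<mu> (cl E))"
          by (simp add: t)
        also have "\<dots> = (\<Sum>j\<in>colourings N ?n.
            of_bool (\<forall>(x, y)\<in>E. case_sum (\<lambda>_. 0) j x = case_sum (\<lambda>_. 0) j y) *
            of_nat (matrix_entry \<mu> j (\<lambda>_. 0)))"
          using E by (subst power) auto
        finally show "(- 1) ^ card E * t ^ middle_parts \<mu> (cl E) = (\<Sum>j\<in>colourings N ?n. (- 1) ^ card E *
            of_bool (\<forall>(x, y)\<in>E. case_sum (\<lambda>_. 0) j x = case_sum (\<lambda>_. 0) j y) *
            of_nat (matrix_entry \<mu> j (\<lambda>_. 0)))"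
          by (simp add: sum_distrib_left mult.assoc)
      qed
      also have "\<dots> = (\<Sum>j\<in>colourings N ?n. \<Sum>E\<in>Pow edges. (- 1) ^ card E *
            of_bool (\<forall>(x, y)\<in>E. case_sum (\<lambda>_. 0) j x = case_sum (\<lambda>_. 0) j y) *
            of_nat (matrix_entry \<mu> j (\<lambda>_. 0)))"
        by (rule sum.swap)
      also have "\<dots> = 0"
        unfolding sum_distrib_right[symmetric] using same by (intro sum.neutral) auto
      finally have "(\<Sum>E\<in>Pow edges. (- 1) ^ card E * t ^ middle_parts \<mu> (cl E)) = 0" .
      moreover have "Comp (Rep0 t) 0 ?n 0 (basis \<mu>) f =
          pm_scale (\<Sum>E\<in>Pow edges. (- 1) ^ card E * t ^ middle_parts \<mu> (cl E)) (basis {})"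
        unfolding f_def Comp_sum_right Comp_simps
        by (simp add: Comp_basis[OF cl \<mu>] empty[OF cl] pm.scale_sum_left)
      ultimately show ?thesis
        by simp
    qed
    have "Comp (Rep0 t) 0 ?n 0 g f = Comp (Rep0 t) 0 ?n 0
        (\<Sum>\<mu>\<in>partitions ?n 0. pm_scale (Poly_Mapping.lookup g \<mu>) (basis \<mu>)) f"
      using linear_combination_of_basis[OF finite_partitions, of g ?n 0] g by (simp add: Hom_Rep0)
    also have "\<dots> = 0"
      unfolding Comp_sum_left Comp_simps by (intro sum.neutral ballI) (simp add: basis)
    finally show ?thesis .
  qed
  ultimately show thesis
    by (rule that)
qed

text \<open>Regarded as a 1 x 1 matrix between objects with identity idempotents, the negligible
  morphism keeps all its composites zero, contrary to the consequence of Schur's lemma.\<close>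

lemma not_semisimple_if_Nats:
  assumes "t \<in> \<nat>"
  shows "\<not> semisimple_category (Deligne_Rep (t :: 'a::field_char_0))"
proof
  assume ss: "semisimple_category (Deligne_Rep t)"
  obtain N where t: "t = of_nat N"
    using assms by (auto simp: Nats_def)
  interpret rep: linear_category "Rep0 t" pm_scale
    by (rule linear_category_Rep0)
  interpret add: linear_category "additive_envelope (Rep0 t)" rep.mat_scale
    by (rule rep.linear_category_additive_envelope)
  interpret linear_category "Deligne_Rep t" rep.mat_scale
    unfolding Deligne_Rep_def by (rule add.linear_category_karoubi_envelope)
  obtain f where f: "f \<in> Hom (Rep0 t) 0 (Suc N)" "f \<noteq> 0"
    "\<And>g. g \<in> Hom (Rep0 t) (Suc N) 0 \<Longrightarrow> Comp (Rep0 t) 0 (Suc N) 0 g f = 0"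
    using negligible_morphism[OF t] by blast
  define obj where "obj n = ([n], Ident (additive_envelope (Rep0 t)) [n])" for n
  have add_Ob: "[n] \<in> Ob (additive_envelope (Rep0 t))" for n
    by (simp add: additive_envelope_def Rep0_def)
  have obj: "obj n \<in> Ob (Deligne_Rep t)" for n
    unfolding obj_def Deligne_Rep_def add.karoubi_Ob_iff
    by (intro conjI add_Ob add.Ident_in_Hom add.Comp_Ident_left)
  have unit: "rep.mat_unit 0 0 f \<in> Hom (additive_envelope (Rep0 t)) [0] [Suc N]"
    using f(1) by (auto simp: additive_envelope_def rep.mat_unit_def)
  have "rep.mat_unit 0 0 f \<in> Hom (Deligne_Rep t) (obj 0) (obj (Suc N))"
    unfolding obj_def Deligne_Rep_def
    by (intro add.karoubi_HomI unit add.Comp_Ident_left add.Comp_Ident_right add_Ob)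
  moreover have "rep.mat_unit 0 0 f \<noteq> 0"
    using f(2) by (auto simp: rep.mat_unit_def fun_eq_iff)
  ultimately obtain g where g: "g \<in> Hom (Deligne_Rep t) (obj (Suc N)) (obj 0)"
    "Comp (Deligne_Rep t) (obj 0) (obj (Suc N)) (obj 0) g (rep.mat_unit 0 0 f) \<noteq> 0"
    using semisimple_nonzero_left_composite[OF ss obj obj] by blast
  have "g \<in> Hom (additive_envelope (Rep0 t)) [Suc N] [0]"
    using g(1) unfolding obj_def Deligne_Rep_def
    by (rule add.karoubi_HomD(1)[rotated 2]) (use obj in \<open>simp_all add: obj_def Deligne_Rep_def\<close>)
  then have "g 0 0 \<in> Hom (Rep0 t) (Suc N) 0"
    using rep.additive_HomD[of g "[Suc N]" "[0]" 0 0] by simp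
  then have "Comp (additive_envelope (Rep0 t)) [0] [Suc N] [0] g (rep.mat_unit 0 0 f) = 0"
    using f(3) by (auto simp: additive_envelope_def rep.mat_unit_def fun_eq_iff)
  then show False
    using g(2) by (simp add: Deligne_Rep_def obj_def add.karoubi_Comp)
qed

section \<open>Nondegeneracy of the trace\<close>

definition kernel_partition :: "'b set \<Rightarrow> ('b \<Rightarrow> 'c) \<Rightarrow> 'b set set" where
  "kernel_partition V v = V // {(x, y) \<in> V \<times> V. v x = v y}"

lemma kernel_partition:
  shows partition_on_kernel_partition: "partition_on V (kernel_partition V v)"
    and same_part_kernel_partition: "same_part (kernel_partition V v) = {(x, y) \<in> V \<times> V. v x = v y}"
proof -
  have "equiv V {(x, y) \<in> V \<times> V. v x = v y}"
    by (intro equivI) (auto simp: refl_on_def sym_def trans_def)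
  then show "partition_on V (kernel_partition V v)"
    "same_part (kernel_partition V v) = {(x, y) \<in> V \<times> V. v x = v y}"
    unfolding kernel_partition_def by (auto intro: partition_on_quotient simp: same_part_quotient)
qed

lemma same_part_subset: "partition_on V P \<Longrightarrow> same_part P \<subseteq> V \<times> V"
  using equiv_same_part[of V P] by (simp add: equiv_def)

lemma same_part_inject:
  "\<lbrakk>partition_on V P; partition_on V Q; same_part P = same_part Q\<rbrakk> \<Longrightarrow> P = Q"
  using quotient_same_part by metis

lemma constant_on_parts_iff_kernel:
  "partition_on V P \<Longrightarrow> constant_on_parts v P \<longleftrightarrow> same_part P \<subseteq> same_part (kernel_partition V v)"
  using same_part_subset[of V P]
  unfolding constant_on_parts_iff_same_part same_part_kernel_partition by blast

text \<open>Such colourings are the injections of the set of parts into the \<open>N\<close>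
  colours. Truncated subtraction does no harm: with more than \<open>N\<close> parts the factor for
  \<open>i = N\<close> is 0.\<close>

lemma card_kernel_partition_eq:
  assumes P: "partition_on V P" and V: "finite V"
  shows "card {v \<in> V \<rightarrow>\<^sub>E {..<N::nat}. kernel_partition V v = P} = (\<Prod>i<card P. N - i)"
    (is "card ?S = _")
proof -
  define part where "part x = (THE B. B \<in> P \<and> x \<in> B)" for x
  have part: "part x = B" if "B \<in> P" "x \<in> B" for x B
    unfolding part_def by (rule the_equality) (use that partition_part_unique[OF P] in auto)
  have part_mem: "part x \<in> P" "x \<in> part x" if "x \<in> V" for x
    using that part partition_onD1[OF P] by auto
  have nonempty: "(SOME x. x \<in> B) \<in> B" if "B \<in> P" for B
    unfolding some_in_eq using that partition_onD3[OF P] by blast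
  have sub: "B \<subseteq> V" if "B \<in> P" for B
    using that partition_onD1[OF P] by blast
  have same: "(x, y) \<in> same_part P \<longleftrightarrow> part x = part y" if "x \<in> V" "y \<in> V" for x y
  proof
    assume "(x, y) \<in> same_part P"
    then obtain B where "B \<in> P" "x \<in> B" "y \<in> B"
      by (auto simp: same_part_def)
    then show "part x = part y"
      by (simp add: part)
  next
    assume eq: "part x = part y"
    show "(x, y) \<in> same_part P"
      unfolding same_part_def
      using part_mem[OF that(1)] part_mem(2)[OF that(2)] by (auto simp: eq)
  qed
  have kernel: "kernel_partition V v = P \<longleftrightarrow> (\<forall>x\<in>V. \<forall>y\<in>V. v x = v y \<longleftrightarrow> part x = part y)" for v :: "'a \<Rightarrow> nat"
  proof -
    have "kernel_partition V v = P \<longleftrightarrow> same_part (kernel_partition V v) = same_part P"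
      using same_part_inject[OF partition_on_kernel_partition P] by blast
    also have "\<dots> \<longleftrightarrow> (\<forall>x\<in>V. \<forall>y\<in>V. v x = v y \<longleftrightarrow> (x, y) \<in> same_part P)"
      unfolding same_part_kernel_partition using same_part_subset[OF P] by blast
    also have "\<dots> \<longleftrightarrow> (\<forall>x\<in>V. \<forall>y\<in>V. v x = v y \<longleftrightarrow> part x = part y)"
      by (simp add: same)
    finally show ?thesis .
  qed
  let ?T = "{h \<in> P \<rightarrow>\<^sub>E {..<N}. inj_on h P}"
  have "bij_betw (\<lambda>v. \<lambda>B\<in>P. v (SOME x. x \<in> B)) ?S ?T"
  proof (rule bij_betw_byWitness[where f' = "\<lambda>h. \<lambda>x\<in>V. h (part x)"])
    show "\<forall>v\<in>?S. (\<lambda>x\<in>V. (\<lambda>B\<in>P. v (SOME x. x \<in> B)) (part x)) = v"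
    proof (intro ballI ext)
      fix v x assume v: "v \<in> ?S"
      show "(\<lambda>x\<in>V. (\<lambda>B\<in>P. v (SOME x. x \<in> B)) (part x)) x = v x"
      proof (cases "x \<in> V")
        case True
        note pm = part_mem[OF True]
        have "part (SOME y. y \<in> part x) = part x"
          by (rule part[OF pm(1) nonempty[OF pm(1)]])
        moreover have "(SOME y. y \<in> part x) \<in> V"
          using nonempty[OF pm(1)] sub[OF pm(1)] by blast
        ultimately have "v (SOME y. y \<in> part x) = v x"
          using v True kernel[of v] by blast
        then show ?thesis
          using True pm by simp
      next
        case False
        then show ?thesis
          using v by (auto simp: PiE_def extensional_def)
      qed
    qed
    show "\<forall>h\<in>?T. (\<lambda>B\<in>P. (\<lambda>x\<in>V. h (part x)) (SOME x. x \<in> B)) = h"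
    proof (intro ballI ext)
      fix h B assume h: "h \<in> ?T"
      show "(\<lambda>B\<in>P. (\<lambda>x\<in>V. h (part x)) (SOME x. x \<in> B)) B = h B"
      proof (cases "B \<in> P")
        case True
        then show ?thesis
          using nonempty[of B] part[of B "SOME x. x \<in> B"] sub[of B] by auto
      next
        case False
        then show ?thesis
          using h by (auto simp: PiE_def extensional_def)
      qed
    qed
    show "(\<lambda>v. \<lambda>B\<in>P. v (SOME x. x \<in> B)) ` ?S \<subseteq> ?T"
    proof (intro image_subsetI CollectI conjI restrict_PiE_iff[THEN iffD2] ballI inj_onI)
      fix v B assume "v \<in> ?S" "B \<in> P"
      then show "v (SOME x. x \<in> B) \<in> {..<N}"
        using nonempty[of B] sub[of B] by (auto simp: PiE_def Pi_def)
    next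
      fix v B D assume v: "v \<in> ?S" and B: "B \<in> P" and D: "D \<in> P"
        and "(\<lambda>B\<in>P. v (SOME x. x \<in> B)) B = (\<lambda>B\<in>P. v (SOME x. x \<in> B)) D"
      then have "v (SOME x. x \<in> B) = v (SOME x. x \<in> D)"
        by simp
      then have "part (SOME x. x \<in> B) = part (SOME x. x \<in> D)"
        using v kernel[of v] nonempty[OF B] nonempty[OF D] sub[OF B] sub[OF D] by blast
      then show "B = D"
        using part[OF B nonempty[OF B]] part[OF D nonempty[OF D]] by simp
    qed
    show "(\<lambda>h. \<lambda>x\<in>V. h (part x)) ` ?T \<subseteq> ?S"
    proof (intro image_subsetI CollectI conjI restrict_PiE_iff[THEN iffD2] ballI)
      fix h x assume "h \<in> ?T" "x \<in> V"
      then show "h (part x) \<in> {..<N}"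
        using part_mem(1)[of x] by (auto simp: PiE_def Pi_def)
    next
      fix h assume "h \<in> ?T"
      then have "h (part x) = h (part y) \<longleftrightarrow> part x = part y" if "x \<in> V" "y \<in> V" for x y
        using part_mem(1)[OF that(1)] part_mem(1)[OF that(2)] by (auto dest: inj_onD)
      then show "kernel_partition V (\<lambda>x\<in>V. h (part x)) = P"
        unfolding kernel by simp
    qed
  qed
  then have "card ?S = card ?T"
    by (rule bij_betw_same_card)
  also have "\<dots> = (\<Prod>i<card P. N - i)"
    using card_inj_on_subset_funcset[OF finite_elements[OF V P] finite_lessThan subset_refl]
    by (simp add: atLeast0LessThan)
  finally show ?thesis .
qed

text \<open>Every colouring has exactly one kernel partition \<open>R\<close>, and it is constant on
  the parts of \<open>P\<close> precisely when \<open>R\<close> is coarser than \<open>P\<close>.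
  Grouping by \<open>R\<close> diagonalises the pairing of \<open>P\<close> and
  \<open>Q\<close>.\<close>

lemma sum_constant_on_two_partitions:
  assumes V: "finite V" and P: "partition_on V P" and Q: "partition_on V Q"
  shows "(\<Sum>v\<in>V \<rightarrow>\<^sub>E {..<N::nat}. of_bool (constant_on_parts v P) * of_bool (constant_on_parts v Q)) =
    (\<Sum>R | partition_on V R. of_bool (same_part P \<subseteq> same_part R \<and> same_part Q \<subseteq> same_part R) *
       (\<Prod>i<card R. N - i))"
proof -
  let ?F = "\<lambda>R. of_bool (same_part P \<subseteq> same_part R \<and> same_part Q \<subseteq> same_part R) :: nat"
  have "(\<Sum>v\<in>V \<rightarrow>\<^sub>E {..<N}. of_bool (constant_on_parts v P) * of_bool (constant_on_parts v Q)) =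
      (\<Sum>v\<in>V \<rightarrow>\<^sub>E {..<N}. ?F (kernel_partition V v))"
    by (intro sum.cong) (auto simp: constant_on_parts_iff_kernel[OF P] constant_on_parts_iff_kernel[OF Q])
  also have "\<dots> = (\<Sum>R | partition_on V R. \<Sum>v | v \<in> V \<rightarrow>\<^sub>E {..<N} \<and> kernel_partition V v = R.
      ?F (kernel_partition V v))"
    by (subst sum.group) (auto intro: finite_PiE V finitely_many_partition_on partition_on_kernel_partition)
  also have "\<dots> = (\<Sum>R | partition_on V R. ?F R * card {v \<in> V \<rightarrow>\<^sub>E {..<N}. kernel_partition V v = R})"
    by (intro sum.cong) (auto simp: mult.commute)
  also have "\<dots> = (\<Sum>R | partition_on V R. ?F R * (\<Prod>i<card R. N - i))"
    using V by (intro sum.cong refl arg_cong2[where f = "(*)"] card_kernel_partition_eq) auto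
  finally show ?thesis .
qed

section \<open>Transposed partitions and the trace form\<close>

definition flip_partition :: "vertex_partition \<Rightarrow> vertex_partition" where
  "flip_partition \<pi> = (\<lambda>B. case_sum Inr Inl ` B) ` \<pi>"

lemma flip_partition_in_partitions:
  assumes "\<pi> \<in> partitions n m"
  shows "flip_partition \<pi> \<in> partitions m n"
proof -
  have "inj (case_sum Inr Inl :: nat + nat \<Rightarrow> nat + nat)"
    by (auto simp: inj_def split: sum.splits)
  then have "partition_on (case_sum Inr Inl ` ({1..n} <+> {1..m})) (flip_partition \<pi> - {{}})"
    using partition_on_inj_image[of "{1..n} <+> {1..m}" \<pi> "case_sum Inr Inl"] assms
    by (simp add: flip_partition_def partitions_iff inj_on_subset)
  moreover have "case_sum Inr Inl ` ({1..n} <+> {1..m}) = {1..m} <+> {1..n}"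
    by (force simp: Plus_def image_Un image_image)
  moreover have "{} \<notin> flip_partition \<pi>"
    using partition_onD3[OF assms[unfolded partitions_iff]] by (auto simp: flip_partition_def)
  ultimately show ?thesis
    by (simp add: partitions_iff)
qed

lemma flip_flip_partition: "flip_partition (flip_partition \<pi>) = \<pi>"
proof -
  have "case_sum Inr Inl (case_sum Inr Inl x) = x" for x :: "nat + nat"
    by (simp split: sum.splits)
  then show ?thesis
    by (simp add: flip_partition_def image_image)
qed

lemma matrix_entry_flip: "matrix_entry (flip_partition \<pi>) i j = matrix_entry \<pi> j i"
proof -
  have "case_sum i j (case_sum Inr Inl x) = case_sum j i x" for x
    by (simp split: sum.splits)
  then show ?thesis
    by (simp add: matrix_entry_def constant_on_parts_def flip_partition_def)
qed

text \<open>A pair of colourings of the two rows is one colouring of their disjoint union.\<close>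

lemma sum_sum_matrix_entry:
  assumes \<pi>: "\<pi> \<in> partitions n m" and \<rho>: "\<rho> \<in> partitions n m"
  shows "(\<Sum>i\<in>colourings N n. \<Sum>j\<in>colourings N m. matrix_entry \<pi> i j * matrix_entry \<rho> i j) =
    (\<Sum>v\<in>({1..n} <+> {1..m}) \<rightarrow>\<^sub>E {..<N}. of_bool (constant_on_parts v \<pi>) * of_bool (constant_on_parts v \<rho>))"
proof -
  let ?V = "{1..n} <+> {1..m}"
  have "(\<Sum>i\<in>colourings N n. \<Sum>j\<in>colourings N m. matrix_entry \<pi> i j * matrix_entry \<rho> i j) =
      (\<Sum>(i, j)\<in>colourings N n \<times> colourings N m. matrix_entry \<pi> i j * matrix_entry \<rho> i j)"
    by (rule sum.cartesian_product)
  also have "\<dots> = (\<Sum>v\<in>?V \<rightarrow>\<^sub>E {..<N}. of_bool (constant_on_parts v \<pi>) * of_bool (constant_on_parts v \<rho>))"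
  proof (rule sum.reindex_bij_witness[where
        i = "\<lambda>v. (\<lambda>a\<in>{1..n}. v (Inl a), \<lambda>b\<in>{1..m}. v (Inr b))"
        and j = "\<lambda>(i, j). restrict (case_sum i j) ?V"])
    fix p assume p: "p \<in> colourings N n \<times> colourings N m"
    obtain i j where [simp]: "p = (i, j)"
      by fastforce
    show "(\<lambda>v. (\<lambda>a\<in>{1..n}. v (Inl a), \<lambda>b\<in>{1..m}. v (Inr b)))
        ((\<lambda>(i, j). restrict (case_sum i j) ?V) p) = p"
      using p by (auto simp: fun_eq_iff PiE_def extensional_def)
    show "(\<lambda>(i, j). restrict (case_sum i j) ?V) p \<in> ?V \<rightarrow>\<^sub>E {..<N}"
      using p by (auto simp: PiE_def Pi_def)
    have "constant_on_parts (restrict (case_sum i j) ?V) \<nu> \<longleftrightarrow> constant_on_parts (case_sum i j) \<nu>"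
      if "\<nu> \<in> partitions n m" for \<nu>
      by (rule constant_on_parts_cong)
        (use that partition_onD1[of ?V \<nu>, symmetric] in \<open>auto simp: partitions_iff\<close>)
    then show "of_bool (constant_on_parts ((\<lambda>(i, j). restrict (case_sum i j) ?V) p) \<pi>) *
        of_bool (constant_on_parts ((\<lambda>(i, j). restrict (case_sum i j) ?V) p) \<rho>) =
        (case p of (i, j) \<Rightarrow> matrix_entry \<pi> i j * matrix_entry \<rho> i j)"
      using \<pi> \<rho> by (simp add: matrix_entry_def)
  next
    fix v assume v: "v \<in> ?V \<rightarrow>\<^sub>E {..<N}"
    show "(\<lambda>(i, j). restrict (case_sum i j) ?V) (\<lambda>a\<in>{1..n}. v (Inl a), \<lambda>b\<in>{1..m}. v (Inr b)) = v"
    proof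
      fix x show "(\<lambda>(i, j). restrict (case_sum i j) ?V) (\<lambda>a\<in>{1..n}. v (Inl a), \<lambda>b\<in>{1..m}. v (Inr b)) x = v x"
        using v by (cases x) (auto simp: PiE_def extensional_def)
    qed
    show "(\<lambda>a\<in>{1..n}. v (Inl a), \<lambda>b\<in>{1..m}. v (Inr b)) \<in> colourings N n \<times> colourings N m"
      using PiE_mem[OF v, of "Inl _"] PiE_mem[OF v, of "Inr _"] by auto
  qed
  finally show ?thesis .
qed

text \<open>The number of components after identifying each vertex \<open>i\<close> with \<open>i'\<close>.\<close>

definition closed_parts :: "nat \<Rightarrow> vertex_partition \<Rightarrow> nat" where
  "closed_parts n \<pi> = card (component_partition {1..n} (map_prod (case_sum id id) (case_sum id id) ` same_part \<pi>))"

text \<open>A diagonal entry uses the same colour at \<open>a\<close> and \<open>a'\<close>, so it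
  tests constancy on the components of the closed graph. The trace of the matrix is therefore a
  power of \<open>N\<close>, whose exponent is the one used in \<open>trace\<close> for general
  \<open>t\<close>.\<close>

lemma sum_matrix_entry_diag:
  assumes \<pi>: "\<pi> \<in> partitions n n"
  shows "(\<Sum>i\<in>colourings N n. matrix_entry \<pi> i i) = N ^ closed_parts n \<pi>"
proof -
  let ?r = "map_prod (case_sum id id) (case_sum id id) ` same_part \<pi>"
  let ?P = "component_partition {1..n} ?r"
  have r: "?r \<subseteq> {1..n} \<times> {1..n}"
    using same_part_subset[of "{1..n} <+> {1..n}" \<pi>] \<pi> by (fastforce simp: partitions_iff)
  have "constant_on_parts (case_sum i i) \<pi> \<longleftrightarrow> constant_on_parts i ?P" for i :: "nat \<Rightarrow> nat"
  proof -
    have "i (case_sum id id x) = case_sum i i x" for x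
      by (simp split: sum.splits)
    then show ?thesis
      by (subst constant_on_component_partition[OF r])
        (simp add: constant_on_parts_iff_same_part split_beta)
  qed
  then have "(\<Sum>i\<in>colourings N n. matrix_entry \<pi> i i) =
      (\<Sum>i\<in>colourings N n. if constant_on_parts i ?P then 1 else 0)"
    by (intro sum.cong) (auto simp: matrix_entry_def)
  also have "\<dots> = card {i \<in> colourings N n. constant_on_parts i ?P}"
    unfolding sum.inter_filter[OF finite_colourings, symmetric] by simp
  also have "\<dots> = N ^ card ?P"
    using card_colourings_extending[OF partition_on_component_partition finite_atLeastAtMost empty_subsetI,
        of "\<lambda>_. 0" N 1 n ?r] by simp
  finally show ?thesis
    by (simp add: closed_parts_def)
qed

lemma power_closed_parts_product:
  assumes \<pi>: "\<pi> \<in> partitions n m" and \<mu>: "\<mu> \<in> partitions m n"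
  shows "N ^ (middle_parts \<mu> \<pi> + closed_parts n (\<mu> \<cdot> \<pi>)) =
    (\<Sum>i\<in>colourings N n. \<Sum>j\<in>colourings N m. matrix_entry \<pi> i j * matrix_entry \<mu> j i)"
proof -
  have "(\<Sum>j\<in>colourings N m. matrix_entry \<pi> i j * matrix_entry \<mu> j i) =
      N ^ middle_parts \<mu> \<pi> * matrix_entry (\<mu> \<cdot> \<pi>) i i" if "i \<in> colourings N n" for i
    using that by (intro sum_matrix_entry_mult[OF \<pi> \<mu>]) auto
  then show ?thesis
    by (simp add: power_add sum_matrix_entry_diag[OF product_in_partitions[OF \<pi> \<mu>], symmetric] sum_distrib_left)
qed

text \<open>In characteristic zero the difference would have infinitely many roots. This is the
  passage from counting with \<open>N\<close> colours to an arbitrary parameter.\<close>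

lemma poly_eq_if_eq_on_Nats:
  fixes p q :: "'a::field_char_0 poly"
  assumes "\<And>N. poly p (of_nat N) = poly q (of_nat N)"
  shows "p = q"
proof (rule ccontr)
  assume "p \<noteq> q"
  then have "finite {x. poly (p - q) x = 0}"
    by (intro poly_roots_finite) simp
  moreover have "range of_nat \<subseteq> {x. poly (p - q) x = 0}"
    using assms by auto
  moreover have "infinite (range (of_nat :: nat \<Rightarrow> 'a))"
    by (intro range_inj_infinite inj_of_nat)
  ultimately show False
    using finite_subset by blast
qed

text \<open>For \<open>t = N\<close> both sides count the colourings constant on the parts of
  \<open>\<pi>\<close> and of the flipped \<open>\<mu>\<close>; both are polynomials in
  \<open>t\<close>, so the identity extends.\<close>

lemma power_closed_parts_product_eq_sum:
  fixes t :: "'a::field_char_0"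
  assumes \<pi>: "\<pi> \<in> partitions n m" and \<mu>: "\<mu> \<in> partitions m n"
  shows "t ^ (middle_parts \<mu> \<pi> + closed_parts n (\<mu> \<cdot> \<pi>)) =
    (\<Sum>\<rho>\<in>partitions n m. of_bool (same_part \<pi> \<subseteq> same_part \<rho> \<and>
       same_part (flip_partition \<mu>) \<subseteq> same_part \<rho>) * (\<Prod>i<card \<rho>. t - of_nat i))"
proof -
  define e where "e = middle_parts \<mu> \<pi> + closed_parts n (\<mu> \<cdot> \<pi>)"
  let ?b = "\<lambda>\<rho>. same_part \<pi> \<subseteq> same_part \<rho> \<and> same_part (flip_partition \<mu>) \<subseteq> same_part \<rho>"
  define p :: "'a poly" where
    "p = (\<Sum>\<rho>\<in>partitions n m. of_bool (?b \<rho>) * (\<Prod>i<card \<rho>. [:- of_nat i, 1:]))"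
  have poly_p: "poly p x = (\<Sum>\<rho>\<in>partitions n m. of_bool (?b \<rho>) * (\<Prod>i<card \<rho>. x - of_nat i))" for x
    unfolding p_def poly_sum poly_mult poly_prod by (intro sum.cong) auto
  \<comment> \<open>Subtraction is truncated on the left only. When \<open>k\<close> exceeds
    \<open>N\<close>, the factor for \<open>i = N\<close> makes both products vanish.\<close>
  have falling: "of_nat (\<Prod>i<k. N - i) = (\<Prod>i<k. of_nat N - of_nat i :: 'a)" for k N
  proof (cases "k \<le> N")
    case True
    then show ?thesis
      by (auto simp: of_nat_prod intro!: prod.cong of_nat_diff)
  next
    case False
    then have "(\<Prod>i<k. N - i) = 0" "(\<Prod>i<k. of_nat N - of_nat i :: 'a) = 0"
      by (auto intro!: bexI[of _ N] prod_zero)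
    then show ?thesis
      by (simp only: of_nat_0)
  qed
  have "of_nat N ^ e = poly p (of_nat N)" for N
  proof -
    have "N ^ e = (\<Sum>i\<in>colourings N n. \<Sum>j\<in>colourings N m.
        matrix_entry \<pi> i j * matrix_entry (flip_partition \<mu>) i j)"
      unfolding e_def power_closed_parts_product[OF \<pi> \<mu>] matrix_entry_flip ..
    also have "\<dots> = (\<Sum>\<rho>\<in>partitions n m. of_bool (?b \<rho>) * (\<Prod>i<card \<rho>. N - i))"
      unfolding sum_sum_matrix_entry[OF \<pi> flip_partition_in_partitions[OF \<mu>]] partitions_def
      using \<pi> flip_partition_in_partitions[OF \<mu>]
      by (intro sum_constant_on_two_partitions) (auto simp: partitions_iff)
    finally have "of_nat (N ^ e) = (of_nat (\<Sum>\<rho>\<in>partitions n m. of_bool (?b \<rho>) * (\<Prod>i<card \<rho>. N - i)) :: 'a)"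
      by (rule arg_cong)
    then show ?thesis
      unfolding poly_p of_nat_sum of_nat_mult falling by simp
  qed
  then have "monom 1 e = p"
    by (intro poly_eq_if_eq_on_Nats) (simp add: poly_monom)
  then have "t ^ e = poly p t"
    by (auto simp: poly_monom)
  then show ?thesis
    unfolding e_def poly_p .
qed

text \<open>The categorical trace: closing up a partition leaves loops, each worth
  \<open>t\<close>.\<close>

definition trace :: "'a::field \<Rightarrow> nat \<Rightarrow> (vertex_partition \<Rightarrow>\<^sub>0 'a) \<Rightarrow> 'a" where
  "trace t n f = (\<Sum>\<pi>\<in>partitions n n. Poly_Mapping.lookup f \<pi> * t ^ closed_parts n \<pi>)"

lemma trace_zero [simp]: "trace t n 0 = 0"
  by (simp add: trace_def)

lemma trace_add: "trace t n (f + g) = trace t n f + trace t n g"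
  by (simp add: trace_def lookup_add algebra_simps sum.distrib)

lemma trace_scale: "trace t n (pm_scale c f) = c * trace t n f"
  by (simp add: trace_def sum_distrib_left mult.assoc)

lemma trace_sum: "trace t n (\<Sum>k\<in>K. f k) = (\<Sum>k\<in>K. trace t n (f k))"
  by (induction K rule: infinite_finite_induct) (auto simp: trace_add)

lemma trace_basis: "\<pi> \<in> partitions n n \<Longrightarrow> trace t n (basis \<pi>) = t ^ closed_parts n \<pi>"
proof -
  assume "\<pi> \<in> partitions n n"
  moreover have "trace t n (basis \<pi>) = (\<Sum>\<mu>\<in>partitions n n. if \<mu> = \<pi> then t ^ closed_parts n \<pi> else 0)"
    unfolding trace_def by (intro sum.cong) (auto simp: lookup_single when_def)
  ultimately show ?thesis
    by (simp add: finite_partitions)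
qed

lemma trace_Comp_basis:
  assumes "\<pi> \<in> partitions n m" "\<mu> \<in> partitions m n"
  shows "trace t n (Comp (Rep0 t) n m n (basis \<mu>) (basis \<pi>)) =
    t ^ (middle_parts \<mu> \<pi> + closed_parts n (\<mu> \<cdot> \<pi>))"
  using assms by (simp add: Comp_basis trace_scale trace_basis product_in_partitions power_add)

lemma trace_Comp_expand:
  assumes f: "f \<in> Hom (Rep0 t) n m" and g: "g \<in> Hom (Rep0 t) m n"
  shows "trace t n (Comp (Rep0 t) n m n g f) = (\<Sum>\<pi>\<in>partitions n m. \<Sum>\<mu>\<in>partitions m n.
    Poly_Mapping.lookup f \<pi> * Poly_Mapping.lookup g \<mu> *
      trace t n (Comp (Rep0 t) n m n (basis \<mu>) (basis \<pi>)))"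
proof -
  interpret linear_category "Rep0 t" pm_scale
    by (rule linear_category_Rep0)
  have f': "f = (\<Sum>\<pi>\<in>partitions n m. pm_scale (Poly_Mapping.lookup f \<pi>) (basis \<pi>))"
    using f by (intro linear_combination_of_basis finite_partitions) (simp add: Hom_Rep0)
  have g': "g = (\<Sum>\<pi>\<in>partitions m n. pm_scale (Poly_Mapping.lookup g \<pi>) (basis \<pi>))"
    using g by (intro linear_combination_of_basis finite_partitions) (simp add: Hom_Rep0)
  show ?thesis
    by (subst f', subst g') (simp add: Comp_sum_left Comp_sum_right Comp_simps trace_sum trace_scale
        pm.scale_sum_right sum_distrib_left mult.assoc)
qed

text \<open>By bilinearity it suffices to compare exponents on basis vectors. For two colours both
  powers are the trace of a product of the same two matrices, so the exponents agree, and they do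
  not depend on \<open>t\<close>.\<close>

lemma trace_commute:
  assumes f: "f \<in> Hom (Rep0 t) n m" and g: "g \<in> Hom (Rep0 t) m n"
  shows "trace t n (Comp (Rep0 t) n m n g f) = trace t m (Comp (Rep0 t) m n m f g)"
proof -
  have basis: "trace t n (Comp (Rep0 t) n m n (basis \<mu>) (basis \<pi>)) =
      trace t m (Comp (Rep0 t) m n m (basis \<pi>) (basis \<mu>))"
    if \<pi>: "\<pi> \<in> partitions n m" and \<mu>: "\<mu> \<in> partitions m n" for \<pi> \<mu>
  proof -
    have "2 ^ (middle_parts \<mu> \<pi> + closed_parts n (\<mu> \<cdot> \<pi>)) =
        (2 :: nat) ^ (middle_parts \<pi> \<mu> + closed_parts m (\<pi> \<cdot> \<mu>))"
      unfolding power_closed_parts_product[OF \<pi> \<mu>] power_closed_parts_product[OF \<mu> \<pi>]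
      by (subst sum.swap) (simp add: mult.commute)
    then show ?thesis
      unfolding trace_Comp_basis[OF \<pi> \<mu>] trace_Comp_basis[OF \<mu> \<pi>] by simp
  qed
  show ?thesis
    unfolding trace_Comp_expand[OF f g] trace_Comp_expand[OF g f]
    by (subst sum.swap) (auto simp: basis mult.commute intro!: sum.cong)
qed

text \<open>Uniqueness in Moebius inversion: induction from the largest sets \<open>R a\<close>
  downwards, where all terms but \<open>G a\<close> are already known to vanish. The order is given
  through \<open>R\<close> so that refinement of partitions can be used in both directions.\<close>

lemma zeta_transform_injective:
  assumes S: "finite S" and U: "finite U" and R: "\<And>a. a \<in> S \<Longrightarrow> R a \<subseteq> U" and inj: "inj_on R S"
    and zero: "\<And>a. a \<in> S \<Longrightarrow> (\<Sum>b | b \<in> S \<and> R a \<subseteq> R b. G b) = (0 :: 'c::comm_monoid_add)"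
  shows "a \<in> S \<Longrightarrow> G a = 0"
proof (induction "card (U - R a)" arbitrary: a rule: less_induct)
  case less
  have "G b = 0" if b: "b \<in> {b \<in> S. R a \<subseteq> R b} - {a}" for b
  proof (rule less.hyps)
    have "R a \<noteq> R b"
      using b less.prems inj by (auto dest: inj_onD)
    then have "U - R b \<subset> U - R a"
      using b R[of b] by blast
    then show "card (U - R b) < card (U - R a)"
      using U by (intro psubset_card_mono) auto
  qed (use b in auto)
  then have "(\<Sum>b | b \<in> S \<and> R a \<subseteq> R b. G b) = G a"
    using less.prems S by (subst sum.remove[of _ a]) auto
  then show ?case
    using zero less.prems by simp
qed

text \<open>The Gram matrix is a product of a zeta matrix, the diagonal of falling factorials and a
  transposed zeta matrix. The diagonal is invertible because \<open>t\<close> is not a natural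
  number, and the zeta matrices are removed one after the other.\<close>

theorem trace_nondegenerate:
  fixes t :: "'a::field_char_0"
  assumes t: "t \<notin> \<nat>" and f: "f \<in> Hom (Rep0 t) n m"
    and zero: "\<And>g. g \<in> Hom (Rep0 t) m n \<Longrightarrow> trace t n (Comp (Rep0 t) n m n g f) = 0"
  shows "f = 0"
proof -
  interpret linear_category "Rep0 t" pm_scale
    by (rule linear_category_Rep0)
  let ?P = "partitions n m"
  let ?V = "({1..n} <+> {1..m}) :: (nat + nat) set"
  let ?c = "Poly_Mapping.lookup f"
  let ?ff = "\<lambda>\<rho>. \<Prod>i<card \<rho>. t - of_nat i"
  have f': "f = (\<Sum>\<pi>\<in>?P. pm_scale (?c \<pi>) (basis \<pi>))"
    using f by (intro linear_combination_of_basis finite_partitions) (simp add: Hom_Rep0)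
  have sub: "same_part \<pi> \<subseteq> ?V \<times> ?V" if "\<pi> \<in> ?P" for \<pi>
    using that by (intro same_part_subset) (simp add: partitions_iff)
  have inj: "inj_on same_part ?P"
    by (rule inj_onI, rule same_part_inject[of ?V]) (simp_all add: partitions_iff)
  have ff: "?ff \<rho> \<noteq> 0" for \<rho> :: vertex_partition
    using t by auto
  \<comment> \<open>The sum of coefficients over all refinements of \<open>\<rho>\<close>. Pairing
    \<open>f\<close> with the flip of \<open>\<sigma>\<close> yields the sum of
    \<open>?ff \<rho> * F \<rho>\<close> over all \<open>\<rho>\<close> coarser than
    \<open>\<sigma>\<close>.\<close>
  define F where "F \<rho> = (\<Sum>\<pi> | \<pi> \<in> ?P \<and> same_part \<pi> \<subseteq> same_part \<rho>. ?c \<pi>)" for \<rho>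
  have "?ff \<rho> * F \<rho> = 0" if "\<rho> \<in> ?P" for \<rho>
  proof (rule zeta_transform_injective[where R = same_part and U = "?V \<times> ?V"])
    fix \<sigma> assume \<sigma>: "\<sigma> \<in> ?P"
    have "0 = trace t n (Comp (Rep0 t) n m n (basis (flip_partition \<sigma>)) f)"
      using zero \<sigma> flip_partition_in_partitions by simp
    also have "\<dots> = (\<Sum>\<pi>\<in>?P. ?c \<pi> * trace t n (Comp (Rep0 t) n m n (basis (flip_partition \<sigma>)) (basis \<pi>)))"
      by (subst f') (simp add: Comp_sum_right Comp_simps trace_sum trace_scale)
    also have "\<dots> = (\<Sum>\<pi>\<in>?P. \<Sum>\<rho>\<in>?P. of_bool (same_part \<pi> \<subseteq> same_part \<rho>) * ?c \<pi> *
        (of_bool (same_part \<sigma> \<subseteq> same_part \<rho>) * ?ff \<rho>))"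
    proof (intro sum.cong refl)
      fix \<pi> assume \<pi>: "\<pi> \<in> ?P"
      show "?c \<pi> * trace t n (Comp (Rep0 t) n m n (basis (flip_partition \<sigma>)) (basis \<pi>)) =
        (\<Sum>\<rho>\<in>?P. of_bool (same_part \<pi> \<subseteq> same_part \<rho>) * ?c \<pi> *
          (of_bool (same_part \<sigma> \<subseteq> same_part \<rho>) * ?ff \<rho>))"
        unfolding trace_Comp_basis[OF \<pi> flip_partition_in_partitions[OF \<sigma>]]
          power_closed_parts_product_eq_sum[OF \<pi> flip_partition_in_partitions[OF \<sigma>]]
          flip_flip_partition sum_distrib_left
        by (intro sum.cong) auto
    qed
    also have "\<dots> = (\<Sum>\<rho>\<in>?P. \<Sum>\<pi>\<in>?P. of_bool (same_part \<pi> \<subseteq> same_part \<rho>) * ?c \<pi> *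
        (of_bool (same_part \<sigma> \<subseteq> same_part \<rho>) * ?ff \<rho>))"
      by (rule sum.swap)
    also have "\<dots> = (\<Sum>\<rho>\<in>?P. if same_part \<sigma> \<subseteq> same_part \<rho> then ?ff \<rho> * F \<rho> else 0)"
    proof (intro sum.cong refl)
      fix \<rho>
      have "F \<rho> = (\<Sum>\<pi>\<in>?P. of_bool (same_part \<pi> \<subseteq> same_part \<rho>) * ?c \<pi>)"
        unfolding F_def sum.inter_filter[OF finite_partitions] by (intro sum.cong) auto
      then show "(\<Sum>\<pi>\<in>?P. of_bool (same_part \<pi> \<subseteq> same_part \<rho>) * ?c \<pi> *
        (of_bool (same_part \<sigma> \<subseteq> same_part \<rho>) * ?ff \<rho>)) =
        (if same_part \<sigma> \<subseteq> same_part \<rho> then ?ff \<rho> * F \<rho> else 0)"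
        unfolding sum_distrib_right[symmetric] by simp
    qed
    finally show "(\<Sum>\<rho> | \<rho> \<in> ?P \<and> same_part \<sigma> \<subseteq> same_part \<rho>. ?ff \<rho> * F \<rho>) = 0"
      unfolding sum.inter_filter[OF finite_partitions] by simp
  qed (use that sub inj finite_partitions in auto)
  then have F: "F \<rho> = 0" if "\<rho> \<in> ?P" for \<rho>
    using ff that by auto
  \<comment> \<open>\<open>F\<close> sums over finer rather than coarser partitions; passing to
    complements of \<open>same_part\<close> reverses the order.\<close>
  have "?c \<pi> = 0" if "\<pi> \<in> ?P" for \<pi>
  proof (rule zeta_transform_injective[where R = "\<lambda>\<pi>. ?V \<times> ?V - same_part \<pi>" and U = "?V \<times> ?V"])
    show "inj_on (\<lambda>\<pi>. ?V \<times> ?V - same_part \<pi>) ?P"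
    proof (rule inj_onI)
      fix \<pi> \<rho> assume "\<pi> \<in> ?P" "\<rho> \<in> ?P" "?V \<times> ?V - same_part \<pi> = ?V \<times> ?V - same_part \<rho>"
      moreover from this have "same_part \<pi> = same_part \<rho>"
        using sub by blast
      ultimately show "\<pi> = \<rho>"
        using inj by (auto dest: inj_onD)
    qed
    fix \<rho> assume \<rho>: "\<rho> \<in> ?P"
    have "{\<pi> \<in> ?P. ?V \<times> ?V - same_part \<rho> \<subseteq> ?V \<times> ?V - same_part \<pi>} =
        {\<pi> \<in> ?P. same_part \<pi> \<subseteq> same_part \<rho>}"
      using sub by blast
    then show "(\<Sum>\<pi> | \<pi> \<in> ?P \<and> ?V \<times> ?V - same_part \<rho> \<subseteq> ?V \<times> ?V - same_part \<pi>. ?c \<pi>) = 0"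
      using F[OF \<rho>] by (simp only: F_def)
  qed (use that finite_partitions in auto)
  then show "f = 0"
    by (subst f') (auto intro: sum.neutral)
qed

section \<open>Semisimplicity\<close>

lemma ball_edges_iff:
  "(\<forall>(x, y)\<in>{(f a, g b) | a b. P a b}. Q x y) \<longleftrightarrow> (\<forall>a b. P a b \<longrightarrow> Q (f a) (g b))"
  by blast

text \<open>Only the propagating parts, those with both unprimed and primed vertices, have to pass
  through the middle. There are at most \<open>n\<close> of them, and exactly \<open>n\<close> only
  for a permutation. One middle vertex per propagating part suffices, and none of these forms a
  middle part.\<close>

lemma non_permutation_factors:
  assumes \<pi>: "\<pi> \<in> partitions n n" and nperm: "\<And>\<sigma>. \<sigma> permutes {1..n} \<Longrightarrow> \<pi> \<noteq> perm_partition n \<sigma>"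
  obtains k \<nu> \<mu> where "k < n" "\<nu> \<in> partitions n k" "\<mu> \<in> partitions k n"
    "\<mu> \<cdot> \<nu> = \<pi>" "middle_parts \<mu> \<nu> = 0"
proof -
  let ?V = "{1..n} <+> {1..n} :: (nat + nat) set"
  have part: "partition_on ?V \<pi>"
    using \<pi> by (simp add: partitions_iff)
  have sub: "B \<subseteq> ?V" if "B \<in> \<pi>" for B
    using that partition_onD1[OF part] by blast
  note unique = partition_part_unique[OF part]
  define Pr where "Pr = {B \<in> \<pi>. (\<exists>a. Inl a \<in> B) \<and> (\<exists>b. Inr b \<in> B)}"
  define top where "top B = (SOME a. Inl a \<in> B)" for B :: "(nat + nat) set"
  define bot where "bot B = (SOME b. Inr b \<in> B)" for B :: "(nat + nat) set"
  have top: "Inl (top B) \<in> B" and bot: "Inr (bot B) \<in> B" if "B \<in> Pr" for B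
    using that unfolding Pr_def top_def bot_def by (auto intro: someI)
  have top_n: "top B \<in> {1..n}" and bot_n: "bot B \<in> {1..n}" if "B \<in> Pr" for B
    using top[OF that] bot[OF that] sub[of B] that by (auto simp: Pr_def)
  have inj_top: "inj_on top Pr" and inj_bot: "inj_on bot Pr"
    using top bot unique unfolding Pr_def inj_on_def by (metis (mono_tags, lifting) mem_Collect_eq)+
  have fin: "finite Pr"
    unfolding Pr_def using finite_elements[OF _ part] by simp
  define k where "k = card Pr"
  have "top ` Pr \<subseteq> {1..n}"
    using top_n by blast
  from card_inj_on_le[OF inj_top this] have "k \<le> n"
    by (simp add: k_def)
  \<comment> \<open>With \<open>n\<close> propagating parts the chosen representatives exhaust both
    rows. Every part is then a pair of one unprimed and one primed vertex, so \<open>\<pi>\<close>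
    would be a permutation.\<close>
  have "k \<noteq> n"
  proof
    assume "k = n"
    have top_img: "top ` Pr = {1..n}"
      by (rule card_subset_eq)
        (use \<open>top ` Pr \<subseteq> {1..n}\<close> \<open>k = n\<close> card_image[OF inj_top] in \<open>simp_all add: k_def\<close>)
    have bot_img: "bot ` Pr = {1..n}"
      by (rule card_subset_eq)
        (use bot_n \<open>k = n\<close> card_image[OF inj_bot] in \<open>auto simp: k_def\<close>)
    define \<sigma> where "\<sigma> a = (if a \<in> {1..n} then bot (inv_into Pr top a) else a)" for a
    have bij: "bij_betw (\<lambda>a. bot (inv_into Pr top a)) {1..n} {1..n}"
      using bij_betw_trans[OF bij_betw_inv_into[of top Pr "{1..n}"], of bot "{1..n}"]
        inj_top inj_bot top_img bot_img by (auto simp: bij_betw_def o_def)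
    then have "bij_betw \<sigma> {1..n} {1..n}"
      by (rule bij_betw_cong[THEN iffD1, rotated]) (simp add: \<sigma>_def)
    then have perm: "\<sigma> permutes {1..n}"
      by (rule bij_imp_permutes) (auto simp: \<sigma>_def)
    have pr: "B \<in> Pr \<and> x = Inl (top B) \<or> B \<in> Pr \<and> x = Inr (bot B)" if "B \<in> \<pi>" "x \<in> B" for B x
    proof (cases x)
      case (Inl a)
      then have "a \<in> top ` Pr"
        using sub[OF that(1)] that top_img by (auto simp: subset_iff)
      then obtain D where D: "D \<in> Pr" "a = top D"
        by blast
      then have "D = B"
        using unique[of D B x] top[of D] that Inl by (auto simp: Pr_def)
      then show ?thesis
        using D Inl by simp
    next
      case (Inr a)
      then have "a \<in> bot ` Pr"
        using sub[OF that(1)] that bot_img by (auto simp: subset_iff)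
      then obtain D where D: "D \<in> Pr" "a = bot D"
        by blast
      then have "D = B"
        using unique[of D B x] bot[of D] that Inr by (auto simp: Pr_def)
      then show ?thesis
        using D Inr by simp
    qed
    have "B = {Inl (top B), Inr (bot B)}" if "B \<in> Pr" for B
      using pr[of B] top[OF that] bot[OF that] that by (auto simp: Pr_def)
    then have "perm_partition n \<sigma> = Pr"
      unfolding perm_partition_def top_img[symmetric] image_image
      using inj_top top_n by (auto simp: \<sigma>_def image_iff)
    moreover have "\<pi> = Pr"
    proof
      show "\<pi> \<subseteq> Pr"
        using pr partition_onD3[OF part] by (metis ex_in_conv subsetI)
    qed (auto simp: Pr_def)
    ultimately show False
      using nperm[OF perm] by simp
  qed
  then have k: "k < n"
    using \<open>k \<le> n\<close> by simp
  obtain e where e: "bij_betw e {1..k} Pr"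
    using ex_bij_betw_nat_finite_1[OF fin] unfolding k_def by blast
  have e_Pr: "e c \<in> Pr" if "c \<in> {1..k}" for c
    using e that by (auto simp: bij_betw_def)
  \<comment> \<open>The upper factor keeps the unprimed traces of the parts and ties middle vertex
    \<open>c\<close> to the propagating part \<open>e c\<close>; \<open>s\<close> does the same for
    the primed row.\<close>
  define r :: "((nat + nat) \<times> (nat + nat)) set" where "r = {(Inl a, Inl b) | a b. (Inl a, Inl b) \<in> same_part \<pi>} \<union>
    {(Inr c, Inl a) | c a. c \<in> {1..k} \<and> Inl a \<in> e c}"
  define s :: "((nat + nat) \<times> (nat + nat)) set" where "s = {(Inr a, Inr b) | a b. (Inr a, Inr b) \<in> same_part \<pi>} \<union>
    {(Inl c, Inr b) | c b. c \<in> {1..k} \<and> Inr b \<in> e c}"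
  define \<nu> where "\<nu> = component_partition ({1..n} <+> {1..k}) r"
  define \<mu> where "\<mu> = component_partition ({1..k} <+> {1..n}) s"
  have e_sub: "e c \<subseteq> ?V" if "c \<in> {1..k}" for c
    using e_Pr[OF that] sub by (auto simp: Pr_def)
  have r: "r \<subseteq> ({1..n} <+> {1..k}) \<times> ({1..n} <+> {1..k})"
    using same_part_subset[OF part] e_sub by (fastforce simp: r_def)
  have s: "s \<subseteq> ({1..k} <+> {1..n}) \<times> ({1..k} <+> {1..n})"
    using same_part_subset[OF part] e_sub by (fastforce simp: s_def)
  have \<nu>: "\<nu> \<in> partitions n k" and \<mu>: "\<mu> \<in> partitions k n"
    by (simp_all add: \<nu>_def \<mu>_def partitions_iff partition_on_component_partition)
  \<comment> \<open>\<open>A\<close> and \<open>B\<close> are the conditions that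
    \<open>\<pi>\<close> imposes within the unprimed and within the primed row. What remains of
    constancy on \<open>\<pi>\<close> is one equation for each propagating part.\<close>
  define A where "A i \<longleftrightarrow> (\<forall>a b. (Inl a, Inl b) \<in> same_part \<pi> \<longrightarrow> i a = i b)" for i :: "nat \<Rightarrow> nat"
  define B where "B i \<longleftrightarrow> (\<forall>a b. (Inr a, Inr b) \<in> same_part \<pi> \<longrightarrow> i a = i b)" for i :: "nat \<Rightarrow> nat"
  have same_top: "(Inl (top (e c)), Inl a) \<in> same_part \<pi>" if "c \<in> {1..k}" "Inl a \<in> e c" for c a
    using that top[OF e_Pr] e_Pr by (auto simp: same_part_def Pr_def)
  have same_bot: "(Inr (bot (e c)), Inr a) \<in> same_part \<pi>" if "c \<in> {1..k}" "Inr a \<in> e c" for c a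
    using that bot[OF e_Pr] e_Pr by (auto simp: same_part_def Pr_def)
  have entry_\<nu>: "matrix_entry \<nu> i j = of_bool (A i) * of_bool (\<forall>c\<in>{1..k}. j c = i (top (e c)))" for i j
  proof -
    have "constant_on_parts (case_sum i j) \<nu> \<longleftrightarrow> (\<forall>(x, y)\<in>r. case_sum i j x = case_sum i j y)"
      unfolding \<nu>_def by (rule constant_on_component_partition[OF r])
    also have "\<dots> \<longleftrightarrow> A i \<and> (\<forall>c\<in>{1..k}. \<forall>a. Inl a \<in> e c \<longrightarrow> j c = i a)"
      unfolding r_def A_def ball_Un ball_edges_iff by auto
    also have "\<dots> \<longleftrightarrow> A i \<and> (\<forall>c\<in>{1..k}. j c = i (top (e c)))"
      using same_top top[OF e_Pr] unfolding A_def by metis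
    finally show ?thesis
      by (simp add: matrix_entry_def)
  qed
  have entry_\<mu>: "matrix_entry \<mu> j l = of_bool (B l) * of_bool (\<forall>c\<in>{1..k}. j c = l (bot (e c)))" for j l
  proof -
    have "constant_on_parts (case_sum j l) \<mu> \<longleftrightarrow> (\<forall>(x, y)\<in>s. case_sum j l x = case_sum j l y)"
      unfolding \<mu>_def by (rule constant_on_component_partition[OF s])
    also have "\<dots> \<longleftrightarrow> B l \<and> (\<forall>c\<in>{1..k}. \<forall>b. Inr b \<in> e c \<longrightarrow> j c = l b)"
      unfolding s_def B_def ball_Un ball_edges_iff by auto
    also have "\<dots> \<longleftrightarrow> B l \<and> (\<forall>c\<in>{1..k}. j c = l (bot (e c)))"
      using same_bot bot[OF e_Pr] unfolding B_def by metis
    finally show ?thesis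
      by (simp add: matrix_entry_def)
  qed
  have entry_\<pi>: "matrix_entry \<pi> i l =
      of_bool (A i) * (of_bool (B l) * of_bool (\<forall>c\<in>{1..k}. i (top (e c)) = l (bot (e c))))" for i l
  proof -
    have "constant_on_parts (case_sum i l) \<pi> \<longleftrightarrow>
        A i \<and> B l \<and> (\<forall>c\<in>{1..k}. i (top (e c)) = l (bot (e c)))" (is "?lhs \<longleftrightarrow> ?rhs")
    proof
      assume c: ?lhs
      have "case_sum i l x = case_sum i l y" if "(x, y) \<in> same_part \<pi>" for x y
        using c that by (auto simp: constant_on_parts_iff_same_part)
      moreover have "(Inl (top (e c)), Inr (bot (e c))) \<in> same_part \<pi>" if "c \<in> {1..k}" for c
        using top[OF e_Pr[OF that]] bot[OF e_Pr[OF that]] e_Pr[OF that] by (auto simp: same_part_def Pr_def)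
      ultimately show ?rhs
        unfolding A_def B_def by fastforce
    next
      assume ?rhs
      then have A: "(Inl a, Inl b) \<in> same_part \<pi> \<Longrightarrow> i a = i b"
        and B: "(Inr a, Inr b) \<in> same_part \<pi> \<Longrightarrow> l a = l b"
        and eq: "c \<in> {1..k} \<Longrightarrow> i (top (e c)) = l (bot (e c))" for a b c
        unfolding A_def B_def by blast+
      have mixed: "i a = l b" if "D \<in> \<pi>" "Inl a \<in> D" "Inr b \<in> D" for D a b
      proof -
        have "D \<in> Pr"
          using that by (auto simp: Pr_def)
        then obtain c where c: "c \<in> {1..k}" "e c = D"
          using e by (auto simp: bij_betw_def)
        then show ?thesis
          using A[OF same_top[of c a]] B[OF same_bot[of c b]] eq[of c] that by simp
      qed
      show ?lhs
        unfolding constant_on_parts_def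
      proof (intro ballI)
        fix D x y assume D: "D \<in> \<pi>" "x \<in> D" "y \<in> D"
        then have "(x, y) \<in> same_part \<pi>"
          by (auto simp: same_part_def)
        then show "case_sum i l x = case_sum i l y"
          using D A B mixed[of D] by (cases x; cases y) auto
      qed
    qed
    then show ?thesis
      by (simp add: matrix_entry_def)
  qed
  \<comment> \<open>The entry of \<open>\<nu>\<close> forces the middle colour at \<open>c\<close>
    to be that of \<open>top (e c)\<close>. Substituting this into the entry of \<open>\<mu>\<close>
    gives exactly the equations linking the two rows of \<open>\<pi>\<close>.\<close>
  have "(\<Sum>j\<in>colourings 2 k. matrix_entry \<nu> i j * matrix_entry \<mu> j l) = 2 ^ 0 * matrix_entry \<pi> i l"
    if i: "i \<in> {1..n} \<rightarrow> {..<2}" for i l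
  proof -
    have "(\<Sum>j\<in>colourings 2 k. matrix_entry \<nu> i j * matrix_entry \<mu> j l) =
        (\<Sum>j\<in>colourings 2 k. (of_bool (A i) * matrix_entry \<mu> j l) *
          of_bool (\<forall>c\<in>{1..k}. j c = i (top (e c))))"
      by (intro sum.cong refl) (simp add: entry_\<nu> mult_ac)
    also have "\<dots> = of_bool (A i) * matrix_entry \<mu> (restrict (\<lambda>c. i (top (e c))) {1..k}) l"
      by (rule sum_colourings_eq) (use i top_n[OF e_Pr] in \<open>auto simp: Pi_def\<close>)
    also have "\<dots> = 2 ^ 0 * matrix_entry \<pi> i l"
      by (simp add: entry_\<mu> entry_\<pi>)
    finally show ?thesis .
  qed
  then have "\<mu> \<cdot> \<nu> = \<pi>" "middle_parts \<mu> \<nu> = 0"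
    using product_eqI[OF \<nu> \<mu> \<pi>] by blast+
  then show thesis
    using that k \<nu> \<mu> by blast
qed

text \<open>A basis of \<open>J\<close> is extended by vectors of \<open>L\<close> to a basis of the
  sum; \<open>P\<close> kills the former and fixes the latter, and the extension to the whole space
  keeps the range.\<close>

lemma (in vector_space) exists_projection:
  assumes L: "subspace L" and J: "subspace J" and disj: "L \<inter> J \<subseteq> {0}"
  obtains P where "Vector_Spaces.linear scale scale P" "\<And>l. l \<in> L \<Longrightarrow> P l = l"
    "\<And>j. j \<in> J \<Longrightarrow> P j = 0" "\<And>x. P x \<in> L"
proof -
  interpret pair: vector_space_pair scale scale
    by unfold_locales
  obtain BJ where BJ: "BJ \<subseteq> J" "independent BJ" "J \<subseteq> span BJ"
    using maximal_independent_subset[of J] by blast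
  obtain B where B: "BJ \<subseteq> B" "B \<subseteq> BJ \<union> L" "independent B" "BJ \<union> L \<subseteq> span B"
    using maximal_independent_subset_extend[of BJ "BJ \<union> L"] BJ(2) by blast
  obtain P where P: "Vector_Spaces.linear scale scale P" "\<forall>b\<in>B. P b = (if b \<in> BJ then 0 else b)"
    "range P = span ((\<lambda>b. if b \<in> BJ then 0 else b) ` B)"
    using pair.linear_independent_extend_subspace[OF B(3), of "\<lambda>b. if b \<in> BJ then 0 else b"]
    by blast
  have "span ((\<lambda>b. if b \<in> BJ then 0 else b) ` B) \<subseteq> L"
    by (rule span_minimal[OF _ L]) (use B(2) subspace_0[OF L] in auto)
  then have in_L: "P x \<in> L" for x
    using P(3) by blast
  have "P j = 0" if "j \<in> span BJ" for j
    by (rule pair.linear_eq_0_on_span[OF P(1) _ that]) (use P(2) B(1) in auto)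
  \<comment> \<open>The added basis vectors need not span \<open>L\<close>, so this is not
    immediate. Modulo \<open>J\<close> the map \<open>P\<close> is the identity on the sum, hence
    \<open>P l - l\<close> lies in both \<open>L\<close> and \<open>J\<close>.\<close>
  moreover have "P l = l" if l: "l \<in> L" for l
  proof -
    have "l \<in> span B"
      using l B(4) by blast
    then have "P l - l \<in> J"
    proof (induction rule: span_induct_alt)
      case base
      show ?case
        using pair.linear_0[OF P(1)] subspace_0[OF J] by simp
    next
      case (step c b x)
      have "P b - b \<in> J"
        using P(2) step.hyps BJ(1) subspace_0[OF J] subspace_neg[OF J, of b] by auto
      moreover have "P (scale c b + x) - (scale c b + x) = scale c (P b - b) + (P x - x)"
        by (simp add: pair.linear_add[OF P(1)] pair.linear_scale[OF P(1)] scale_right_diff_distrib)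
      ultimately show ?case
        using step.IH subspace_add[OF J] subspace_scale[OF J] by metis
    qed
    moreover have "P l - l \<in> L"
      using in_L l subspace_diff[OF L] by blast
    ultimately show ?thesis
      using disj by auto
  qed
  ultimately show thesis
    using that[OF P(1)] BJ(3) in_L by blast
qed

lemma idempotent_free_eq_0:
  fixes t :: "'a::field_char_0"
  assumes t: "t \<notin> \<nat>" and f: "idempotent_free (Rep0 t) n n f"
  shows "f = 0"
  using f
proof (induction n arbitrary: f rule: less_induct)
  case (less n)
  interpret linear_category "Rep0 t" pm_scale
    by (rule linear_category_Rep0)
  let ?H = "Hom (Rep0 t)"
  let ?C = "Comp (Rep0 t)"
  have Ob [simp]: "k \<in> Ob (Rep0 t)" for k
    by (simp add: Rep0_def)
  \<comment> \<open>For a morphism out of or into \<open>[k]\<close>, its composites that are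
    endomorphisms of \<open>[k]\<close> are idempotent-free, so they vanish by induction.
    Nondegeneracy of the trace then kills the morphism itself.\<close>
  have from_smaller: "radical_free (Rep0 t) k m" and to_smaller: "radical_free (Rep0 t) m k"
    if "k < n" for k m
    unfolding radical_free_def
  proof (intro allI impI)
    fix g assume g: "idempotent_free (Rep0 t) k m g"
    have "?C k m k h g = 0" if "h \<in> ?H m k" for h
      using less.IH[OF \<open>k < n\<close>] idempotent_free_Comp_left[OF Ob Ob Ob g that] by blast
    then show "g = 0"
      using g by (intro trace_nondegenerate[OF t, of g k m]) (simp_all add: idempotent_free_def)
  next
    show "\<forall>g. idempotent_free (Rep0 t) m k g \<longrightarrow> g = 0"
    proof (intro allI impI)
      fix g assume g: "idempotent_free (Rep0 t) m k g"
      then have gH: "g \<in> ?H m k"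
        by (simp add: idempotent_free_def)
      have "?C k m k g h = 0" if "h \<in> ?H k m" for h
        using less.IH[OF \<open>k < n\<close>] idempotent_free_Comp_right[OF Ob Ob Ob g that] by blast
      then show "g = 0"
        using trace_nondegenerate[OF t gH] trace_commute[OF gH] by simp
    qed
  qed
  define gen where "gen = {?C n k n x y | k x y. k < n \<and> x \<in> ?H k n \<and> y \<in> ?H n k}"
  define J where "J = pm.span gen"
  \<comment> \<open>Scalars are absorbed into the left factors, which leaves a plain sum of
    composites on which to induct by the number of terms.\<close>
  have J_sum: "\<exists>r k x y. (\<forall>i<r. k i < n \<and> x i \<in> ?H (k i) n \<and> y i \<in> ?H n (k i)) \<and>
      l = (\<Sum>i<(r::nat). ?C n (k i) n (x i) (y i))" if "l \<in> J" for l
    using that unfolding J_def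
  proof (induction rule: pm.span_induct_alt)
    case base
    show ?case
      by (intro exI[of _ 0]) simp
  next
    case (step c b l)
    obtain k' x' y' where b: "b = ?C n k' n x' y'" "k' < n" "x' \<in> ?H k' n" "y' \<in> ?H n k'"
      using step.hyps unfolding gen_def by blast
    obtain r :: nat and k x y where IH: "\<forall>i<r. k i < n \<and> x i \<in> ?H (k i) n \<and> y i \<in> ?H n (k i)"
      "l = (\<Sum>i<r. ?C n (k i) n (x i) (y i))"
      using step.IH by blast
    have "pm_scale c b + l = (\<Sum>i<Suc r. ?C n ((k(r := k')) i) n ((x(r := pm_scale c x')) i) ((y(r := y')) i))"
      by (simp add: b IH(2) Comp_simps add.commute)
    moreover have "\<forall>i<Suc r. (k(r := k')) i < n \<and> (x(r := pm_scale c x')) i \<in> ?H ((k(r := k')) i) n \<and>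
        (y(r := y')) i \<in> ?H n ((k(r := k')) i)"
      using b IH(1) by (auto simp: less_Suc_eq intro: scale_in_Hom)
    ultimately show ?case
      by blast
  qed
  \<comment> \<open>Since \<open>y\<^sub>r = y\<^sub>r g y\<^sub>r\<close> and \<open>l g = 0\<close>, subtracting \<open>l g y\<^sub>r\<close> removes the last term of \<open>l = \<Sum> x\<^sub>i y\<^sub>i\<close>.\<close>
  have no_J: "l = 0" if kill: "\<And>k g. k < n \<Longrightarrow> g \<in> ?H k n \<Longrightarrow> ?C k n n l g = 0"
    and "\<forall>i<r. k i < n \<and> x i \<in> ?H (k i) n \<and> y i \<in> ?H n (k i)"
    and "l = (\<Sum>i<(r::nat). ?C n (k i) n (x i) (y i))" for l r k x y
    using that(2,3)
  proof (induction r arbitrary: y)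
    case (Suc r)
    then have kr: "k r < n" "x r \<in> ?H (k r) n" "y r \<in> ?H n (k r)"
      by auto
    obtain g where g: "g \<in> ?H (k r) n" "?C n (k r) (k r) (?C (k r) n (k r) (y r) g) (y r) = y r"
      using is_regular_if_radical_free[OF Ob Ob to_smaller[OF kr(1)] kr(3)] by (auto simp: is_regular_def)
    define y' where "y' i = y i - ?C n (k r) (k i) (?C (k r) n (k i) (y i) g) (y r)" for i
    have "l = l - ?C n (k r) n (?C (k r) n n l g) (y r)"
      by (simp add: kill[OF kr(1) g(1)] Comp_simps)
    also have "?C n (k r) n (?C (k r) n n l g) (y r) =
        (\<Sum>i<Suc r. ?C n (k i) n (x i) (?C n (k r) (k i) (?C (k r) n (k i) (y i) g) (y r)))"
      unfolding Suc.prems(2) by (simp add: Comp_sum_left assoc Comp_simps)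
    also have "l - \<dots> = (\<Sum>i<Suc r. ?C n (k i) n (x i) (y' i))"
      unfolding Suc.prems(2) y'_def Comp_simps sum_subtractf ..
    also have "\<dots> = (\<Sum>i<r. ?C n (k i) n (x i) (y' i))"
      by (simp add: y'_def g Comp_simps)
    finally have "l = (\<Sum>i<r. ?C n (k i) n (x i) (y' i))" .
    moreover have "\<forall>i<r. k i < n \<and> x i \<in> ?H (k i) n \<and> y' i \<in> ?H n (k i)"
      unfolding y'_def using Suc.prems(1) kr g by (auto intro!: diff_in_Hom Comp_in_Hom)
    ultimately show ?case
      by (intro Suc.IH)
  qed simp
  have fH: "f \<in> ?H n n"
    using less.prems by (simp add: idempotent_free_def)
  \<comment> \<open>A left ideal, because the averaged map below commutes with composition on the
    left. All its members stay idempotent-free and annihilate morphisms of smaller objects on both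
    sides.\<close>
  define L where "L = (\<lambda>a. ?C n n n a f) ` ?H n n"
  have L: "pm.subspace L"
    unfolding L_def using vsp.linear_subspace_image[OF linear_Comp_left subspace_Hom[OF Ob Ob]] by blast
  have L_free: "idempotent_free (Rep0 t) n n l" if "l \<in> L" for l
    using that less.prems unfolding L_def by (auto intro: idempotent_free_Comp_left[OF Ob Ob Ob])
  have L_left: "?C n n n a l \<in> L" if "a \<in> ?H n n" "l \<in> L" for a l
    using that unfolding L_def by (auto simp: assoc intro!: imageI Comp_in_Hom)
  have L_gen: "?C k n n l g = 0" if "l \<in> L" "k < n" "g \<in> ?H k n" for l k g
    using from_smaller[OF that(2)] idempotent_free_Comp_right[OF Ob Ob Ob L_free[OF that(1)] that(3)]
    unfolding radical_free_def by blast
  have gen_L: "?C n n k g l = 0" if "l \<in> L" "k < n" "g \<in> ?H n k" for l k g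
    using to_smaller[OF that(2)] idempotent_free_Comp_left[OF Ob Ob Ob L_free[OF that(1)] that(3)]
    unfolding radical_free_def by blast
  have J_L: "?C n n n j l = 0" if "j \<in> J" "l \<in> L" for j l
    using that(1) unfolding J_def
    by (rule vsp.linear_eq_0_on_span[OF linear_Comp_left, rotated])
      (auto simp: gen_def assoc[symmetric] gen_L[OF that(2)] Comp_simps)
  have J_left: "?C n n n a j \<in> J" if a: "a \<in> ?H n n" and j: "j \<in> J" for a j
  proof -
    have "?C n n n a ` gen \<subseteq> gen"
      unfolding gen_def using a by (auto simp: assoc intro!: Comp_in_Hom) (metis Comp_in_Hom Ob)
    then show ?thesis
      using j pm.span_mono[of "?C n n n a ` gen" gen] unfolding J_def
      by (auto simp: vsp.linear_span_image[OF linear_Comp_right])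
  qed
  \<comment> \<open>Elements of \<open>L\<close> vanish on every morphism from a smaller object,
    which is the hypothesis under which a sum of composites through smaller objects is 0.\<close>
  have "L \<inter> J \<subseteq> {0}"
  proof
    fix l assume l: "l \<in> L \<inter> J"
    then obtain r :: nat and k x y where sum:
      "\<forall>i<r. k i < n \<and> x i \<in> ?H (k i) n \<and> y i \<in> ?H n (k i)" "l = (\<Sum>i<r. ?C n (k i) n (x i) (y i))"
      using J_sum by blast
    have "l = 0"
      by (rule no_J[OF _ sum]) (use L_gen l in blast)
    then show "l \<in> {0}"
      by simp
  qed
  then obtain P where P: "Vector_Spaces.linear pm_scale pm_scale P" "\<And>l. l \<in> L \<Longrightarrow> P l = l"
    "\<And>j. j \<in> J \<Longrightarrow> P j = 0" "\<And>x. P x \<in> L"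
    using pm.exists_projection[OF L] unfolding J_def by (metis pm.subspace_span)
  define G where "G = {\<sigma>. \<sigma> permutes {1..n}}"
  define D :: "(nat \<Rightarrow> nat) \<Rightarrow> vertex_partition \<Rightarrow>\<^sub>0 'a" where "D \<sigma> = basis (perm_partition n \<sigma>)" for \<sigma>
  have DH: "D \<sigma> \<in> ?H n n" if "\<sigma> \<in> G" for \<sigma>
    using that unfolding D_def G_def mem_Collect_eq
    by (intro basis_in_Hom perm_partition_in_partitions)
  have DD: "?C n n n (D \<tau>) (D \<sigma>) = D (\<tau> \<circ> \<sigma>)" if "\<sigma> \<in> G" "\<tau> \<in> G" for \<sigma> \<tau>
    using that by (simp add: D_def G_def Comp_basis perm_partition_in_partitions product_perm_partition)
  have D_id: "D id = Ident (Rep0 t) n"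
    by (simp add: D_def Ident_Rep0)
  have inv_G: "inv \<sigma> \<in> G" "\<sigma> \<circ> inv \<sigma> = id" "inv \<sigma> \<circ> \<sigma> = id" if "\<sigma> \<in> G" for \<sigma>
    using that permutes_inv permutes_inv_o by (auto simp: G_def)
  \<comment> \<open>Maschke's averaging argument for the symmetric group.\<close>
  define \<phi> where "\<phi> x = (\<Sum>\<sigma>\<in>G. ?C n n n (D \<sigma>) (P (?C n n n (D (inv \<sigma>)) x)))" for x
  define e0 where "e0 = \<phi> (Ident (Rep0 t) n)"
  have e0: "e0 \<in> L"
    unfolding e0_def \<phi>_def using P(4) DH by (intro pm.subspace_sum[OF L] L_left)
  \<comment> \<open>The projection has become right multiplication by \<open>e0\<close>. For
    permutations this is the substitution \<open>\<tau> \<circ> \<sigma>\<close> for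
    \<open>\<sigma>\<close>; for all other partitions both sides are 0, since \<open>P\<close> kills
    \<open>J\<close> and \<open>J\<close> annihilates \<open>e0\<close>.\<close>
  have \<phi>_eq: "\<phi> (basis \<pi>) = ?C n n n (basis \<pi>) e0" if \<pi>: "\<pi> \<in> partitions n n" for \<pi>
  proof (cases "\<exists>\<tau>. \<tau> permutes {1..n} \<and> \<pi> = perm_partition n \<tau>")
    case True
    then obtain \<tau> where \<tau>: "\<tau> \<in> G" "basis \<pi> = D \<tau>"
      by (auto simp: G_def D_def)
    have "\<phi> (D \<tau>) = (\<Sum>\<sigma>\<in>G. ?C n n n (D (\<tau> \<circ> \<sigma>)) (P (?C n n n (D (inv (\<tau> \<circ> \<sigma>))) (D \<tau>))))"
      using setum_permutations_compose_left[of \<tau> "{1..n}" "\<lambda>\<sigma>. ?C n n n (D \<sigma>) (P (?C n n n (D (inv \<sigma>)) (D \<tau>)))"] \<tau>(1)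
      by (simp add: \<phi>_def G_def o_def)
    also have "\<dots> = (\<Sum>\<sigma>\<in>G. ?C n n n (D \<tau>) (?C n n n (D \<sigma>) (P (?C n n n (D (inv \<sigma>)) (D id)))))"
    proof (intro sum.cong refl)
      fix \<sigma> assume \<sigma>: "\<sigma> \<in> G"
      have \<tau>\<sigma>: "\<tau> \<circ> \<sigma> \<in> G"
        using \<sigma> \<tau>(1) by (auto simp: G_def intro: permutes_compose)
      have "bij \<tau>" "bij \<sigma>"
        using \<sigma> \<tau>(1) by (auto simp: G_def intro: permutes_bij)
      then have "inv (\<tau> \<circ> \<sigma>) \<circ> \<tau> = inv \<sigma>"
        by (simp add: o_inv_distrib o_assoc[symmetric] inv_G(3)[OF \<tau>(1)])
      then have "?C n n n (D (inv (\<tau> \<circ> \<sigma>))) (D \<tau>) = ?C n n n (D (inv \<sigma>)) (D id)"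
        using DD[OF \<tau>(1) inv_G(1)[OF \<tau>\<sigma>]] DH[OF inv_G(1)[OF \<sigma>]] by (simp add: D_id Comp_Ident_right)
      then show "?C n n n (D (\<tau> \<circ> \<sigma>)) (P (?C n n n (D (inv (\<tau> \<circ> \<sigma>))) (D \<tau>))) =
          ?C n n n (D \<tau>) (?C n n n (D \<sigma>) (P (?C n n n (D (inv \<sigma>)) (D id))))"
        using DD[OF \<sigma> \<tau>(1)] by (simp add: assoc)
    qed
    also have "\<dots> = ?C n n n (D \<tau>) e0"
      by (simp add: e0_def \<phi>_def Comp_sum_right D_id)
    finally show ?thesis
      using \<tau> by simp
  next
    case False
    then obtain k \<nu> \<mu> where fac: "k < n" "\<nu> \<in> partitions n k" "\<mu> \<in> partitions k n"
      "\<mu> \<cdot> \<nu> = \<pi>" "middle_parts \<mu> \<nu> = 0"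
      using non_permutation_factors[OF \<pi>] by blast
    then have "?C n k n (basis \<mu>) (basis \<nu>) = basis \<pi>"
      by (simp add: Comp_basis)
    then have "basis \<pi> \<in> gen"
      unfolding gen_def mem_Collect_eq using fac
      by (intro exI[of _ k] exI[of _ "basis \<mu>"] exI[of _ "basis \<nu>"]) simp
    then have "basis \<pi> \<in> J"
      unfolding J_def by (rule pm.span_base)
    then have "\<phi> (basis \<pi>) = 0"
      unfolding \<phi>_def using P(3) J_left DH inv_G(1) by (intro sum.neutral) (simp add: Comp_simps)
    then show ?thesis
      using J_L[OF \<open>basis \<pi> \<in> J\<close> e0] by simp
  qed
  have lin_\<phi>: "Vector_Spaces.linear pm_scale pm_scale \<phi>"
    unfolding \<phi>_def Vector_Spaces.linear_iff
    by (simp add: pm.vector_space_axioms vsp.linear_add[OF P(1)] vsp.linear_scale[OF P(1)] Comp_simps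
        sum.distrib pm.scale_sum_right)
  have "\<phi> f = ?C n n n f e0"
    by (rule vsp.linear_eq_on[OF lin_\<phi> linear_Comp_left, of f "basis ` partitions n n"])
      (use fH \<phi>_eq in \<open>auto simp: Hom_Rep0_span\<close>)
  moreover have "\<phi> f = pm_scale (of_nat (card G)) f"
  proof -
    \<comment> \<open>\<open>P\<close> is the identity on \<open>L\<close>, so each summand is
      \<open>\<sigma>\<close> composed with its inverse and \<open>f\<close>.\<close>
    have "?C n n n (D \<sigma>) (P (?C n n n (D (inv \<sigma>)) f)) = f" if \<sigma>: "\<sigma> \<in> G" for \<sigma>
    proof -
      have "?C n n n (D (inv \<sigma>)) f \<in> L"
        unfolding L_def using DH[OF inv_G(1)[OF \<sigma>]] by blast
      then show ?thesis
        using DD[OF inv_G(1)[OF \<sigma>] \<sigma>] fH by (simp add: P(2) assoc inv_G(2)[OF \<sigma>] D_id Comp_Ident_left)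
    qed
    then show ?thesis
      by (simp add: \<phi>_def pm.sum_constant_scale)
  qed
  ultimately have fe0: "?C n n n f e0 = pm_scale (of_nat (card G)) f"
    by simp
  have "finite G" "id \<in> G"
    by (auto simp: G_def finite_permutations permutes_id)
  then have card: "of_nat (card G) \<noteq> (0 :: 'a)"
    by (auto simp: card_eq_0_iff)
  \<comment> \<open>Division by the order of the symmetric group uses characteristic zero. From
    \<open>e = a f\<close> and \<open>f e = f\<close> follows
    \<open>e e = a f e = e\<close>.\<close>
  define e where "e = pm_scale (inverse (of_nat (card G))) e0"
  have fe: "?C n n n f e = f"
    using card by (simp add: e_def Comp_simps fe0)
  have eL: "e \<in> L"
    unfolding e_def using e0 L by (intro pm.subspace_scale)
  then obtain a where a: "a \<in> ?H n n" "e = ?C n n n a f"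
    unfolding L_def by blast
  have "?C n n n e e = ?C n n n a (?C n n n f e)"
    by (simp add: assoc a(2)[symmetric])
  then have "?C n n n e e = e"
    by (simp add: fe a(2)[symmetric])
  \<comment> \<open>Composition with the identity exhibits the idempotent \<open>e\<close> in its
    own right ideal; as a member of \<open>L\<close>, it is idempotent-free.\<close>
  moreover have "?C n n n e (Ident (Rep0 t) n) = e"
    using L_free[OF eL] by (simp add: idempotent_free_def Comp_Ident_right)
  ultimately have "e = 0"
    using L_free[OF eL] Ident_in_Hom[OF Ob, of n] unfolding idempotent_free_def by metis
  then show "f = 0"
    using fe by (simp add: Comp_simps)
qed

text \<open>For an idempotent-free \<open>f\<close> from \<open>[n]\<close> to \<open>[m]\<close>,
  every \<open>g f\<close> is an idempotent-free endomorphism and hence 0, so \<open>f\<close> is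
  orthogonal to everything under the trace form.\<close>

lemma semisimple_if_not_Nats:
  fixes t :: "'a::field_char_0"
  assumes t: "t \<notin> \<nat>"
  shows "semisimple_category (Deligne_Rep t)"
proof -
  interpret linear_category "Rep0 t" pm_scale
    by (rule linear_category_Rep0)
  have "radical_free (Rep0 t) n m" if "n \<in> Ob (Rep0 t)" "m \<in> Ob (Rep0 t)" for n m
    unfolding radical_free_def
  proof (intro allI impI)
    fix f assume f: "idempotent_free (Rep0 t) n m f"
    have "Comp (Rep0 t) n m n g f = 0" if g: "g \<in> Hom (Rep0 t) m n" for g
      using idempotent_free_eq_0[OF t] idempotent_free_Comp_left[OF _ _ _ f g] \<open>n \<in> _\<close> \<open>m \<in> _\<close> by blast
    then show "f = 0"
      using f by (intro trace_nondegenerate[OF t, of f n m]) (simp_all add: idempotent_free_def)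
  qed
  then show ?thesis
    unfolding Deligne_Rep_def by (rule semisimple_karoubi_additive_envelope)
qed

theorem corollary5p23:
  fixes t :: "'a::field_char_0"
  shows "semisimple_category (Deligne_Rep t) \<longleftrightarrow> t \<notin> \<nat>"
  using semisimple_if_not_Nats not_semisimple_if_Nats by blast

end
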